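(* Let $1\le p\le 2$, $p^{-1}+p'^{-1}=1$, and $\theta\in[-\pi/2,\pi/2]$. The operator $\mathcal{L}_\theta f(\rho)=\int_0^\infty f(t)\,e^{-\rho t e^{i\theta}}\,dt$ ($\rho>0$), defined initially on $L^1(\mathbb{R}_+)\cap L^p(\mathbb{R}_+)$, extends to a bounded operator from $L^p(\mathbb{R}_+)$ to $L^{p'}(\mathbb{R}_+)$, with norm $K_2(\theta,p):=\|\mathcal{L}_\theta\|_{L^p(\mathbb{R}_+)\to L^{p'}(\mathbb{R}_+)}$ satisfying $$K_2(\theta,p)\le K_1(\theta)^{2/p'},$$ where $K_1(\theta)=\|\mathcal{L}_\theta\|_{L^2(\mathbb{R}_+)\to L^2(\mathbb{R}_+)}$. Consequently, uniformly in $\theta$, $$K_2(\theta,p)\le(2\pi)^{1/p'}\qquad\text{for all }\theta\in[-\pi/2,\pi/2].$$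
   Context: $\mathbb{R}_+=(0,\infty)$ with Lebesgue measure. For $p=1$, $p'=\infty$ and $1/p'=0$. The number $K_1(\theta)$ equals $\sqrt{\pi}\,(1-\mu)^{(1-\mu)/4}(1+\mu)^{(1+\mu)/4}$ with $\mu=2|\theta|/\pi$ for $|\theta|<\pi/2$, and $K_1(\pm\pi/2)=\sqrt{2\pi}$. *)

theory Defs
  imports "HOL-Analysis.Analysis" "HOL-Probability.Essential_Supremum"
begin

text \<open>
  Elements of \<open>L\<^sup>p\<close> are represented by complex-valued functions; classes modulo equality almost
  everywhere are not formed. Exponents range over \<^typ>\<open>ennreal\<close>, so that \<open>1 / \<infinity> = 0\<close>.
\<close>

definition Lp :: "ennreal \<Rightarrow> 'a measure \<Rightarrow> ('a \<Rightarrow> complex) set" where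
  "Lp p M = {f \<in> borel_measurable M.
     if p = \<infinity> then esssup M (\<lambda>x. ereal (norm (f x))) < \<infinity>
     else integrable M (\<lambda>x. norm (f x) powr enn2real p)}"

definition Lp_norm :: "ennreal \<Rightarrow> 'a measure \<Rightarrow> ('a \<Rightarrow> complex) \<Rightarrow> real" where
  "Lp_norm p M f =
     (if p = \<infinity> then real_of_ereal (esssup M (\<lambda>x. ereal (norm (f x))))
      else (LINT x|M. norm (f x) powr enn2real p) powr (1 / enn2real p))"

definition bounded_Lp_operator ::
  "'a measure \<Rightarrow> ennreal \<Rightarrow> ennreal \<Rightarrow> (('a \<Rightarrow> complex) \<Rightarrow> 'a \<Rightarrow> complex) \<Rightarrow> bool" where
  "bounded_Lp_operator M p q T \<longleftrightarrow>
     (\<forall>f \<in> Lp p M. T f \<in> Lp q M) \<and>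
     (\<forall>f \<in> Lp p M. \<forall>g \<in> Lp p M. (AE x in M. f x = g x) \<longrightarrow> (AE x in M. T f x = T g x)) \<and>
     (\<forall>f \<in> Lp p M. \<forall>g \<in> Lp p M. \<forall>a b.
        AE x in M. T (\<lambda>y. a * f y + b * g y) x = a * T f x + b * T g x) \<and>
     (\<exists>C. \<forall>f \<in> Lp p M. Lp_norm q M (T f) \<le> C * Lp_norm p M f)"

definition Lp_operator_norm ::
  "'a measure \<Rightarrow> ennreal \<Rightarrow> ennreal \<Rightarrow> (('a \<Rightarrow> complex) \<Rightarrow> 'a \<Rightarrow> complex) \<Rightarrow> real" where
  "Lp_operator_norm M p q T =
     Inf {C. 0 \<le> C \<and> (\<forall>f \<in> Lp p M. Lp_norm q M (T f) \<le> C * Lp_norm p M f)}"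

abbreviation Rpos :: "real measure" where
  "Rpos \<equiv> lebesgue_on {0<..}"

definition laplace :: "real \<Rightarrow> (real \<Rightarrow> complex) \<Rightarrow> real \<Rightarrow> complex" where
  "laplace \<theta> f \<rho> = (LINT t|Rpos. f t * exp (- (of_real \<rho> * of_real t * cis \<theta>)))"

definition laplace_extension ::
  "real \<Rightarrow> ennreal \<Rightarrow> ennreal \<Rightarrow> ((real \<Rightarrow> complex) \<Rightarrow> real \<Rightarrow> complex) \<Rightarrow> bool" where
  "laplace_extension \<theta> p q T \<longleftrightarrow>
     bounded_Lp_operator Rpos p q T \<and>
     (\<forall>f \<in> Lp 1 Rpos \<inter> Lp p Rpos. AE \<rho> in Rpos. T f \<rho> = laplace \<theta> f \<rho>)"

text \<open>
  The transform extends from \<open>L\<^sup>1 \<inter> L\<^sup>p\<close> to a bounded operator \<open>L\<^sup>p \<rightarrow> L\<^sup>q\<close>, and \<open>K\<close> is the norm of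
  the extension, independently of the choice of representatives.
\<close>

definition laplace_has_norm :: "real \<Rightarrow> ennreal \<Rightarrow> ennreal \<Rightarrow> real \<Rightarrow> bool" where
  "laplace_has_norm \<theta> p q K \<longleftrightarrow>
     (\<exists>T. laplace_extension \<theta> p q T) \<and>
     (\<forall>T. laplace_extension \<theta> p q T \<longrightarrow> Lp_operator_norm Rpos p q T = K)"

text \<open>
  The case distinction is needed because \<open>0 powr 0 = 0\<close>, so the first formula does not give the
  limiting value at \<open>\<mu> = 1\<close>.
\<close>

definition K1 :: "real \<Rightarrow> real" where
  "K1 \<theta> =
     (if \<bar>\<theta>\<bar> < pi / 2
      then let \<mu> = 2 * \<bar>\<theta>\<bar> / pi
           in sqrt pi * (1 - \<mu>) powr ((1 - \<mu>) / 4) * (1 + \<mu>) powr ((1 + \<mu>) / 4)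
      else sqrt (2 * pi))"

end

theory Submission
  imports Defs "HOL-Complex_Analysis.Complex_Analysis" "HOL-Probability.Probability"
begin

text \<open>
  Let \<open>M f y\<close> be the integral of \<open>f t * t powr (- 1 / 2 - \<i> * y)\<close> over \<open>t > 0\<close>. Expanding
  \<open>\<bar>laplace \<theta> f \<rho>\<bar>\<^sup>2\<close> and integrating over \<open>\<rho>\<close> gives the kernel \<open>1 / (t * cis \<theta> + s * cis (- \<theta>))\<close>, which
  is \<open>1 / sqrt (t * s)\<close> times the Fourier transform at \<open>ln s - ln t\<close> of the positive weight
  \<open>w y = exp (2 * \<theta> * y) / (2 * cosh (\<pi> * y))\<close>, by the reflection formula for the Gamma function. Hence
  the squared \<open>L\<^sup>2\<close> norm of the transform is the integral of \<open>w y * \<bar>M f y\<bar>\<^sup>2\<close>. As the integral of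
  \<open>\<bar>M f y\<bar>\<^sup>2\<close> is at most \<open>2 * \<pi>\<close> times the squared norm of \<open>f\<close> (Gaussian regularisation and Schur's
  test), the operator norm squared is at most \<open>2 * \<pi> * sup w = (K1 \<theta>)\<^sup>2\<close>, and Gaussians in \<open>ln t\<close>,
  modulated so that \<open>M f\<close> concentrates at the maximum of \<open>w\<close>, attain this in the limit. For
  \<open>\<theta> = \<plusminus> \<pi> / 2\<close> the upper bound follows by Fatou's lemma, the lower one from modulated exponentials.
  The bound from \<open>L\<^sup>p\<close> to the dual space is the Riesz-Thorin interpolation with the trivial estimate from
  \<open>L\<^sup>1\<close> to \<open>L\<^sup>\<infinity>\<close>, carried out on simple functions and passed to the limit by Fatou's lemma.
\<close>

text \<open>The kernel 1 / (t * cis \<theta> + s * cis (- \<theta>)) is homogeneous of degree -1,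
  hence a weighted convolution in the logarithms of t and s; this is why the Mellin transform
  diagonalises it. With \<mu> = 2 |\<theta>| / pi, A = (1 + \<mu>) / 2 and B = (1 - \<mu>) / 2,
  weighted AM-GM gives sup w = A^A * B^B, whence the shape of \<open>K1\<close>. At |\<theta>| = pi
  / 2 the damping by cos \<theta> is lost: the double integral no longer converges absolutely, the
  weight is not integrable and its supremum 1 is only approached at infinity. Hence the separate
  treatment of these two angles. The exponent 2 / p' is the point z of the strip with 1 / p = 1 - z
  / 2, where the bound is 1 at z = 0 and \<open>K1 \<theta>\<close> at z = 1. Elements are
  functions, not classes, so the extension is determined only up to null sets. It is built from
  almost everywhere limits, and the norm is well defined because any two extensions agree almost
  everywhere. For p = 1 the transform is already defined on the whole space.\<close>

section \<open>Interpolation of bilinear forms in finitely many variables\<close>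

text \<open>Phragmen-Lindelof damping: \<open>exp (of_real \<epsilon> * (z\<^sup>2 - 1))\<close>
  decays as the imaginary part grows, so the maximum principle applies on a rectangle tall enough to
  beat B. Subtracting 1 keeps the modulus of the factor at most 1 on the whole strip. Then
  \<epsilon> tends to 0.\<close>

lemma three_lines:
  fixes \<Phi> :: "complex \<Rightarrow> complex"
  assumes hol: "\<Phi> holomorphic_on UNIV"
    and bdd: "\<And>z. 0 \<le> Re z \<Longrightarrow> Re z \<le> 1 \<Longrightarrow> norm (\<Phi> z) \<le> B"
    and b0: "\<And>z. Re z = 0 \<Longrightarrow> norm (\<Phi> z) \<le> 1"
    and b1: "\<And>z. Re z = 1 \<Longrightarrow> norm (\<Phi> z) \<le> 1"
    and s: "0 \<le> s" "s \<le> 1"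
  shows "norm (\<Phi> (of_real s)) \<le> 1"
proof -
  have key: "norm (\<Phi> (of_real s)) * exp (\<epsilon> * (s\<^sup>2 - 1)) \<le> 1" if \<epsilon>: "\<epsilon> > 0" for \<epsilon> :: real
  proof -
    define \<Psi> where "\<Psi> z = \<Phi> z * exp (of_real \<epsilon> * (z\<^sup>2 - 1))" for z
    have nexp: "norm (exp (of_real \<epsilon> * (z\<^sup>2 - 1))) = exp (\<epsilon> * ((Re z)\<^sup>2 - (Im z)\<^sup>2 - 1))" for z
      by (simp add: norm_exp_eq_Re power2_eq_square)
    have "filterlim (\<lambda>R::real. \<epsilon> * R\<^sup>2) at_top at_top"
      using \<epsilon> by real_asymp
    then have "((\<lambda>R::real. B * exp (- (\<epsilon> * R\<^sup>2))) \<longlongrightarrow> B * 0) at_top"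
      by (intro tendsto_intros) (auto intro!: filterlim_compose[OF exp_at_bot] simp: filterlim_uminus_at_bot)
    then have "eventually (\<lambda>R::real. B * exp (- (\<epsilon> * R\<^sup>2)) < 1) at_top"
      by (intro order_tendstoD) auto
    then have "eventually (\<lambda>R::real. B * exp (- (\<epsilon> * R\<^sup>2)) < 1 \<and> R > 0) at_top"
      using eventually_gt_at_top[of 0] by eventually_elim auto
    then obtain R where R: "B * exp (- (\<epsilon> * R\<^sup>2)) < 1" "R > 0"
      using eventually_happens by fastforce
    let ?S = "cbox (Complex 0 (-R)) (Complex 1 R)"
    have "norm (\<Psi> (of_real s)) \<le> 1"
    proof (rule maximum_modulus_frontier[where f = \<Psi> and S = ?S])
      have "\<Psi> holomorphic_on UNIV"
        unfolding \<Psi>_def by (intro holomorphic_intros hol)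
      then show "\<Psi> holomorphic_on interior ?S" "continuous_on (closure ?S) \<Psi>"
        by (auto intro: holomorphic_on_subset intro!: holomorphic_on_imp_continuous_on)
      show "bounded ?S" by simp
      show "complex_of_real s \<in> ?S"
        using s R by (auto simp: in_cbox_complex_iff)
      fix z assume "z \<in> frontier ?S"
      then have z: "0 \<le> Re z" "Re z \<le> 1" "Re z = 0 \<or> Re z = 1 \<or> \<bar>Im z\<bar> = R"
        using R by (auto simp: frontier_def in_cbox_complex_iff in_box_complex_iff)
      have x2: "(Re z)\<^sup>2 \<le> 1"
        using z by (simp add: power_le_one)
      show "norm (\<Psi> z) \<le> 1"
      proof (cases "\<bar>Im z\<bar> = R")
        case True
        then have "(Im z)\<^sup>2 = R\<^sup>2" by (metis power2_abs)
        then have "exp (\<epsilon> * ((Re z)\<^sup>2 - (Im z)\<^sup>2 - 1)) \<le> exp (- (\<epsilon> * R\<^sup>2))"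
          using x2 \<epsilon> by (auto simp: algebra_simps)
        moreover have "norm (\<Phi> z) \<le> B" using bdd z by auto
        moreover have "0 \<le> B" using calculation(2) norm_ge_zero order_trans by blast
        ultimately have "norm (\<Psi> z) \<le> B * exp (- (\<epsilon> * R\<^sup>2))"
          unfolding \<Psi>_def norm_mult nexp by (intro mult_mono) auto
        with R show ?thesis by simp
      next
        case False
        then have "norm (\<Phi> z) \<le> 1" using z b0 b1 by auto
        moreover have "exp (\<epsilon> * ((Re z)\<^sup>2 - (Im z)\<^sup>2 - 1)) \<le> 1"
        proof -
          have "(Re z)\<^sup>2 - (Im z)\<^sup>2 - 1 \<le> 0"
            using x2 zero_le_power2[of "Im z"] by linarith
          then show ?thesis using \<epsilon> by (simp add: mult_le_0_iff)
        qed
        ultimately show ?thesis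
          unfolding \<Psi>_def norm_mult nexp by (intro mult_le_one) auto
      qed
    qed
    then show ?thesis by (simp add: \<Psi>_def norm_mult nexp)
  qed
  have "((\<lambda>\<epsilon>. norm (\<Phi> (of_real s)) * exp (\<epsilon> * (s\<^sup>2 - 1))) \<longlongrightarrow> norm (\<Phi> (of_real s)) * exp (0 * (s\<^sup>2 - 1))) (at_right 0)"
    by (intro tendsto_intros)
  then have "norm (\<Phi> (of_real s)) * exp (0 * (s\<^sup>2 - 1)) \<le> 1"
    by (rule tendsto_upperbound) (auto simp: eventually_at_filter key)
  then show ?thesis by simp
qed

text \<open>Thorin's argument: each coefficient v moves along an analytic family of modulus |v|^P on
  Re z = 0 and |v|^(P/2) on Re z = 1, which returns to v at z = 2 / Q. The bounds \<open>L1\<close>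
  and \<open>L2\<close> on the two edges are then expressed through the same sums X and Y.\<close>

lemma riesz_thorin_finite:
  fixes c :: "'i \<Rightarrow> 'j \<Rightarrow> complex" and m :: "'i \<Rightarrow> real" and n :: "'j \<Rightarrow> real"
  assumes fin: "finite I" "finite J" and m: "\<And>i. i \<in> I \<Longrightarrow> 0 \<le> m i" and n: "\<And>j. j \<in> J \<Longrightarrow> 0 \<le> n j"
    and K: "0 < K" and P: "1 < P" "1 / P + 1 / Q = 1" "Q \<ge> 2"
    and L1: "\<And>x y. norm (\<Sum>i\<in>I. \<Sum>j\<in>J. x i * y j * c i j)
               \<le> (\<Sum>i\<in>I. norm (x i) * m i) * (\<Sum>j\<in>J. norm (y j) * n j)"
    and L2: "\<And>x y. norm (\<Sum>i\<in>I. \<Sum>j\<in>J. x i * y j * c i j)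
               \<le> K * sqrt (\<Sum>i\<in>I. (norm (x i))\<^sup>2 * m i) * sqrt (\<Sum>j\<in>J. (norm (y j))\<^sup>2 * n j)"
  shows "norm (\<Sum>i\<in>I. \<Sum>j\<in>J. x i * y j * c i j)
      \<le> K powr (2 / Q) * (\<Sum>i\<in>I. norm (x i) powr P * m i) powr (1 / P)
                        * (\<Sum>j\<in>J. norm (y j) powr P * n j) powr (1 / P)"
proof -
  define X where "X = (\<Sum>i\<in>I. norm (x i) powr P * m i)"
  define Y where "Y = (\<Sum>j\<in>J. norm (y j) powr P * n j)"
  have X0: "X \<ge> 0" and Y0: "Y \<ge> 0"
    unfolding X_def Y_def by (auto intro!: sum_nonneg mult_nonneg_nonneg m n)
  show ?thesis
  proof (cases "X = 0 \<or> Y = 0")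
    case True
    \<comment> \<open>A vanishing power sum forces every product of modulus and weight to vanish, so
      \<open>L1\<close> alone gives the bound 0. In the other case division by X * Y is
      legitimate.\<close>
    have "(\<Sum>i\<in>I. norm (x i) * m i) * (\<Sum>j\<in>J. norm (y j) * n j) = 0"
    proof -
      have "(\<Sum>i\<in>I. norm (x i) * m i) = 0" if "X = 0"
        using that fin m unfolding X_def
        by (subst (asm) sum_nonneg_eq_0_iff) (auto intro!: sum.neutral)
      moreover have "(\<Sum>j\<in>J. norm (y j) * n j) = 0" if "Y = 0"
        using that fin n unfolding Y_def
        by (subst (asm) sum_nonneg_eq_0_iff) (auto intro!: sum.neutral)
      ultimately show ?thesis using True by auto
    qed
    then show ?thesis
      using L1[of x y] by (auto intro: order_trans)
  next
    case False
    then have XY: "X > 0" "Y > 0" using X0 Y0 by auto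
    \<comment> \<open>As an exponential the power is entire in z, and \<open>sgn 0 = 0\<close> makes
      it vanish at v = 0, where \<open>ln 0\<close> is a mere default.\<close>
    define e where "e v z = sgn v * exp (of_real (P * ln (norm v)) * (1 - z / 2))" for v z :: complex
    have ne: "norm (e v z) = norm v powr (P * (1 - Re z / 2))" for v z
      by (cases "v = 0") (auto simp: e_def norm_mult norm_sgn powr_def algebra_simps)
    \<comment> \<open>The edge bounds are X * Y and K * sqrt (X * Y); dividing by X * Y and by exp
      (L * z) normalises both to 1.\<close>
    define L where "L = ln (K / sqrt (X * Y))"
    have LK: "exp L = K / sqrt (X * Y)" unfolding L_def using K XY by simp
    define b where "b z = (\<Sum>i\<in>I. \<Sum>j\<in>J. e (x i) z * e (y j) z * c i j)" for z
    define \<Phi> where "\<Phi> z = of_real (1 / (X * Y)) * exp (- of_real L * z) * b z" for z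
    have nPhi: "norm (\<Phi> z) = norm (b z) * exp (- L * Re z) / (X * Y)" for z
      using XY by (simp add: \<Phi>_def norm_mult norm_divide)
    have "norm (\<Phi> (of_real (2 / Q))) \<le> 1"
    proof (rule three_lines)
      show "\<Phi> holomorphic_on UNIV"
        unfolding \<Phi>_def b_def e_def by (intro holomorphic_intros) auto
      show "0 \<le> 2 / Q" "2 / Q \<le> 1" using P by auto
      show "norm (\<Phi> z) \<le> 1" if z: "Re z = 0" for z
      proof -
        have "norm (b z) \<le> X * Y"
          using L1[of "\<lambda>i. e (x i) z" "\<lambda>j. e (y j) z"]
          by (simp add: b_def ne z X_def Y_def)
        then show ?thesis using XY by (simp add: nPhi z)
      qed
      show "norm (\<Phi> z) \<le> 1" if z: "Re z = 1" for z
      proof -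
        have sq: "(norm v powr (P / 2))\<^sup>2 = norm v powr P" for v :: complex
          by (simp add: power2_eq_square flip: powr_add)
        have "norm (b z) \<le> K * sqrt X * sqrt Y"
          using L2[of "\<lambda>i. e (x i) z" "\<lambda>j. e (y j) z"]
          by (simp add: b_def ne z X_def Y_def sq)
        then have "norm (b z) * exp (- L) / (X * Y) \<le> K * sqrt X * sqrt Y * exp (- L) / (X * Y)"
          using XY by (intro divide_right_mono mult_right_mono) auto
        also have "\<dots> = 1"
          using XY K by (simp add: exp_minus LK real_sqrt_mult field_simps)
        finally show ?thesis by (simp add: nPhi z)
      qed
      \<comment> \<open>Only finiteness matters to \<open>three_lines\<close>; the estimate uses
        that 1 - Re z / 2 lies between 0 and 1 on the strip.\<close>
      define B where "B = exp (\<bar>L\<bar>) * (\<Sum>i\<in>I. \<Sum>j\<in>J. exp (\<bar>P * ln (norm (x i))\<bar>) * exp (\<bar>P * ln (norm (y j))\<bar>) * norm (c i j)) / (X * Y)"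
      show "norm (\<Phi> z) \<le> B" if z: "0 \<le> Re z" "Re z \<le> 1" for z
      proof -
        have eb: "norm (e v z) \<le> exp (\<bar>P * ln (norm v)\<bar>)" for v
        proof (cases "v = 0")
          case False
          have "P * ln (norm v) * (1 - Re z / 2) \<le> \<bar>P * ln (norm v)\<bar> * 1"
          proof -
            have "P * ln (norm v) * (1 - Re z / 2) \<le> \<bar>P * ln (norm v)\<bar> * (1 - Re z / 2)"
              using z by (intro mult_right_mono) auto
            also have "\<dots> \<le> \<bar>P * ln (norm v)\<bar> * 1"
              using z by (intro mult_left_mono) auto
            finally show ?thesis .
          qed
          then show ?thesis using False by (simp add: ne powr_def algebra_simps)
        qed (simp add: e_def)
        have "norm (b z) \<le> (\<Sum>i\<in>I. \<Sum>j\<in>J. exp (\<bar>P * ln (norm (x i))\<bar>) * exp (\<bar>P * ln (norm (y j))\<bar>) * norm (c i j))"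
          unfolding b_def
          by (intro order_trans[OF norm_sum] sum_mono) (auto simp: norm_mult intro!: mult_mono eb)
        moreover have "exp (- L * Re z) \<le> exp \<bar>L\<bar>"
          using z by (auto simp: abs_if mult_le_cancel_left1 mult_nonneg_nonneg intro: order_trans[of _ 0])
        ultimately show ?thesis
          unfolding nPhi B_def using XY
          by (intro divide_right_mono) (auto simp: mult.commute[of "exp \<bar>L\<bar>"] intro!: mult_mono sum_nonneg)
      qed
    qed
    then have "norm (b (of_real (2 / Q))) \<le> X * Y * exp (L * (2 / Q))"
      using XY unfolding nPhi by (simp add: exp_minus field_simps)
    also have "exp (L * (2 / Q)) = (K / sqrt (X * Y)) powr (2 / Q)"
      using K XY by (simp add: L_def powr_def)
    also have "X * Y * \<dots> = K powr (2 / Q) * (X powr (1 / P) * Y powr (1 / P))"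
    proof -
      have "1 / P = 1 - 1 / Q" using P by simp
      then have "(X * Y) powr (1 / P) = (X * Y) powr (1 - 1 / Q)" by (rule arg_cong)
      then have "(X * Y) powr (1 / P) = X * Y * (X * Y) powr - (1 / Q)"
        using XY by (simp only: powr_diff powr_minus) (simp add: field_simps)
      moreover have "sqrt (X * Y) powr (2 / Q) = (X * Y) powr (1 / Q)"
        using XY by (simp add: powr_half_sqrt[symmetric] powr_powr)
      ultimately show ?thesis
        using K XY by (simp add: powr_divide powr_mult powr_minus field_simps)
    qed
    also have "b (of_real (2 / Q)) = (\<Sum>i\<in>I. \<Sum>j\<in>J. x i * y j * c i j)"
    proof -
      have "P * (1 - 1 / Q) = 1" using P by (simp add: field_simps)
      then have "complex_of_real (P * (1 - 1 / Q)) = 1" by simp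
      then have E: "complex_of_real P * complex_of_real l * (1 - 1 / complex_of_real Q) = of_real l" for l
        by (simp add: mult.commute[of _ "complex_of_real l"] mult.assoc)
      have "e v (of_real (2 / Q)) = v" for v
        by (cases "v = 0") (auto simp: e_def sgn_eq E exp_of_real)
      then show ?thesis by (simp add: b_def)
    qed
    finally show ?thesis by (simp add: X_def Y_def mult.assoc)
  qed
qed

section \<open>The Fourier transform of the hyperbolic secant\<close>

lemma integrable_lborel_iff_lebesgue:
  fixes f :: "real \<Rightarrow> 'a :: {banach, second_countable_topology}"
  assumes "f \<in> borel_measurable borel"
  shows "integrable lebesgue f \<longleftrightarrow> integrable lborel f"
  using assms by (intro integrable_completion) simp

lemma integral_exp_substitution:
  fixes f :: "real \<Rightarrow> 'a :: euclidean_space"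
  shows "integrable Rpos f \<longleftrightarrow> integrable lebesgue (\<lambda>x. exp x *\<^sub>R f (exp x))" (is ?A)
    and "integrable Rpos f \<Longrightarrow> (LINT t|Rpos. f t) = (LINT x|lebesgue. exp x *\<^sub>R f (exp x))"
proof -
  have der: "(exp has_field_derivative exp x) (at x within UNIV)" for x :: real
    by (auto intro!: derivative_eq_intros)
  have im: "exp ` UNIV = {0::real<..}"
    by (auto simp: image_iff intro: exp_ln[symmetric])
  have inj: "inj_on exp (UNIV :: real set)" by (auto simp: inj_on_def)
  note cov = has_absolute_integral_change_of_variables_real[of UNIV exp exp f, OF _ der inj, unfolded im]
    absolutely_integrable_change_of_variables_real[of UNIV exp exp f, OF _ der inj, unfolded im]
  have U: "set_integrable lebesgue UNIV g \<longleftrightarrow> integrable lebesgue g" for g :: "real \<Rightarrow> 'a"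
    by (simp add: set_integrable_def)
  have R: "set_integrable lebesgue {0<..} f \<longleftrightarrow> integrable Rpos f"
    by (simp add: set_integrable_def integrable_restrict_space)
  show ?A using cov(2) by (simp add: U R)
  assume i: "integrable Rpos f"
  then have i': "integrable lebesgue (\<lambda>x. exp x *\<^sub>R f (exp x))" using \<open>?A\<close> by simp
  have "(LINT t|Rpos. f t) = integral {0<..} f"
    using set_lebesgue_integral_eq_integral(2)[of "{0<..}" f] i
    by (simp add: R set_lebesgue_integral_def integral_restrict_space)
  moreover have "integral UNIV (\<lambda>x. exp x *\<^sub>R f (exp x)) = (LINT x|lebesgue. exp x *\<^sub>R f (exp x))"
    using set_lebesgue_integral_eq_integral(2)[of UNIV "\<lambda>x. exp x *\<^sub>R f (exp x)"] i'
    by (simp add: U set_lebesgue_integral_def)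
  ultimately show "(LINT t|Rpos. f t) = (LINT x|lebesgue. exp x *\<^sub>R f (exp x))"
    using cov(1)[of "integral {0<..} f"] i i' by (simp add: U R)
qed

lemma Gamma_log_integral:
  fixes a :: complex
  assumes "0 < Re a"
  shows "integrable lborel (\<lambda>x::real. exp (a * of_real x - of_real (exp x)))"
    and "(LINT x|lborel. exp (a * of_real x - of_real (exp x))) = Gamma a"
proof -
  let ?f = "\<lambda>t. complex_of_real t powr (a - 1) / of_real (exp t)"
  have eq: "exp x *\<^sub>R ?f (exp x) = exp (a * of_real x - of_real (exp x))" for x
    by (simp add: powr_def Ln_of_real scaleR_conv_of_real exp_diff algebra_simps flip: exp_of_real)
  have i: "integrable Rpos ?f"
    using absolutely_integrable_Gamma_integral'[OF assms]
    by (simp add: set_integrable_def integrable_restrict_space)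
  have "(LINT t|Rpos. ?f t) = Gamma a"
    using set_lebesgue_integral_eq_integral(2)[OF absolutely_integrable_Gamma_integral'[OF assms]]
      Gamma_integral_complex'[OF assms]
    by (simp add: set_lebesgue_integral_def integral_restrict_space integral_unique)
  moreover note integral_exp_substitution[of ?f, unfolded eq]
  moreover have m: "(\<lambda>x::real. exp (a * of_real x - of_real (exp x))) \<in> borel_measurable borel"
    by measurable
  ultimately show "integrable lborel (\<lambda>x::real. exp (a * of_real x - of_real (exp x)))"
    and "(LINT x|lborel. exp (a * of_real x - of_real (exp x))) = Gamma a"
    using i by (auto simp: integrable_lborel_iff_lebesgue[OF m] integral_completion)
qed

text \<open>One double integral in two orders. Over v first, translation by
  \<open>ln (1 + exp x)\<close> reduces the inner integral to Gamma 1 = 1. Over x first, the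
  integrand factors and yields Gamma (1 - a) * Gamma a, which the reflection formula
  evaluates.\<close>

lemma logistic_Mellin_integral:
  fixes a :: complex
  assumes a: "0 < Re a" "Re a < 1"
  shows "integrable lborel (\<lambda>x::real. exp (a * of_real x) / of_real (1 + exp x))"
    and "(LINT x|lborel. exp (a * of_real x) / of_real (1 + exp x)) = of_real pi / sin (of_real pi * a)"
proof -
  define h :: "complex \<Rightarrow> real \<Rightarrow> complex" where "h b x = exp (b * of_real x - of_real (exp x))" for b x
  define G :: "real \<Rightarrow> real \<Rightarrow> complex" where
    "G v x = exp (a * of_real x + of_real v - of_real (exp v * (1 + exp x)))" for v x
  have hm[measurable]: "h b \<in> borel_measurable borel" for b
    unfolding h_def by measurable
  have hi: "integrable lborel (h b)" "(LINT x|lborel. h b x) = Gamma b" if "0 < Re b" for b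
  proof -
    have "h b = (\<lambda>x. exp (b * of_real x - of_real (exp x)))" by (simp add: h_def fun_eq_iff)
    then show "integrable lborel (h b)" "(LINT x|lborel. h b x) = Gamma b"
      using Gamma_log_integral[OF that] by simp_all
  qed
  have hsi: "integrable lborel (\<lambda>x. h b (v + x))" "(LINT x|lborel. h b (v + x)) = Gamma b" if "0 < Re b" for b v
    using lborel_integrable_real_affine[OF hi(1)[OF that], of 1 v]
      lborel_integral_real_affine[of 1 "h b" v] hi(2)[OF that] by simp_all
  have Gx: "G v x = h (1 - a) v * h a (v + x)" for v x
    unfolding G_def h_def mult_exp_exp
    by (rule arg_cong[where f = exp]) (simp add: exp_add algebra_simps)
  have Gv: "G v x = exp (a * of_real x) / of_real (1 + exp x) * h 1 (ln (1 + exp x) + v)" for v x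
  proof -
    define c where "c = 1 + exp x"
    have p: "0 < c" by (simp add: c_def add_pos_pos)
    have "exp (ln c + v) = exp v * c" using p by (simp add: exp_add)
    then have "h 1 (ln c + v) = exp (of_real (ln c) + (of_real v - of_real (exp v * c)))"
      by (simp add: h_def add_diff_eq)
    also have "\<dots> = of_real c * exp (of_real v - of_real (exp v * c))"
      using p by (simp only: exp_add exp_of_real exp_ln)
    finally have "exp (a * of_real x) / of_real c * h 1 (ln c + v) = exp (a * of_real x) * exp (of_real v - of_real (exp v * c))"
      using p by simp
    then show ?thesis
      unfolding G_def c_def[symmetric] by (simp only: mult_exp_exp add_diff_eq)
  qed
  have Gi: "integrable (lborel \<Otimes>\<^sub>M lborel) (case_prod G)"
  proof (rule lborel_pair.Fubini_integrable)
    show "case_prod G \<in> borel_measurable (lborel \<Otimes>\<^sub>M lborel)"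
      unfolding G_def by measurable
    show "AE v in lborel. integrable lborel (\<lambda>x. case_prod G (v, x))"
      using a by (simp add: Gx hsi)
    have "(LINT x|lborel. norm (h a x)) = (LINT x|lborel. norm (h a (v + x)))" for v
      using lborel_integral_real_affine[of 1 "\<lambda>x. norm (h a x)" v] by (simp only: abs_one scaleR_one mult_1)
    then have eq: "(LINT x|lborel. norm (case_prod G (v, x))) = norm (h (1 - a) v) * (LINT x|lborel. norm (h a x))" for v
      by (simp only: Gx norm_mult prod.case integral_mult_right_zero)
    show "integrable lborel (\<lambda>v. LINT x|lborel. norm (case_prod G (v, x)))"
      unfolding eq using a by (intro integrable_mult_left integrable_norm hi(1)) simp
  qed
  have in1: "(LINT v|lborel. G v x) = exp (a * of_real x) / of_real (1 + exp x)" for x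
    unfolding Gv by (simp add: hsi)
  show "integrable lborel (\<lambda>x::real. exp (a * of_real x) / of_real (1 + exp x))"
    using lborel_pair.integrable_snd[OF Gi] by (simp add: in1)
  have "(LINT x|lborel. exp (a * of_real x) / of_real (1 + exp x)) = (LINT v|lborel. LINT x|lborel. G v x)"
    using lborel_pair.Fubini_integral[OF Gi] by (simp add: in1)
  also have "\<dots> = Gamma (1 - a) * Gamma a"
    using a by (simp add: Gx hsi hi)
  also have "\<dots> = of_real pi / sin (of_real pi * a)"
    using Gamma_reflection_complex[of a] by (simp add: mult.commute)
  finally show "(LINT x|lborel. exp (a * of_real x) / of_real (1 + exp x)) = of_real pi / sin (of_real pi * a)" .
qed

definition mellin_weight :: "real \<Rightarrow> real \<Rightarrow> real" where
  "mellin_weight \<theta> y = exp (2 * \<theta> * y) / (exp (pi * y) + exp (- (pi * y)))"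

text \<open>The substitution 2 * pi * y in the logistic integral with a = 1 / 2 + (2 * \<theta> +
  \<i> * x) / (2 * pi); the summand 1 / 2 turns the sine into a cosine. The condition on \<theta>
  says exactly that Re a lies strictly between 0 and 1.\<close>

lemma mellin_weight_Fourier:
  assumes th: "\<bar>\<theta>\<bar> < pi / 2"
  shows "integrable lborel (\<lambda>y. of_real (mellin_weight \<theta> y) * cis (x * y))"
    and "(LINT y|lborel. of_real (mellin_weight \<theta> y) * cis (x * y)) = 1 / (2 * cos (of_real \<theta> + \<i> * of_real x / 2))"
proof -
  define a :: complex where "a = 1 / 2 + (2 * of_real \<theta> + \<i> * of_real x) / (2 * of_real pi)"
  have ra: "Re a = 1 / 2 + \<theta> / pi" by (simp add: a_def Re_divide_numeral)
  have a: "0 < Re a" "Re a < 1"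
    using th unfolding ra by (auto simp: field_simps abs_if split: if_splits)
  let ?J = "\<lambda>x::real. exp (a * of_real x) / of_real (1 + exp x)"
  have eq: "?J (0 + 2 * pi * y) = of_real (mellin_weight \<theta> y) * cis (x * y)" for y
  proof -
    have 1: "a * of_real (2 * pi * y) = of_real (pi * y) + (of_real (2 * \<theta> * y) + \<i> * of_real (x * y))"
      by (simp add: a_def field_simps)
    have 2: "1 + exp (2 * pi * y) = exp (pi * y) * (exp (pi * y) + exp (- (pi * y)))"
      by (simp add: algebra_simps flip: exp_add)
    have "?J (0 + 2 * pi * y) = exp (of_real (pi * y)) * (exp (of_real (2 * \<theta> * y)) * cis (x * y)) / of_real (1 + exp (2 * pi * y))"
      by (simp only: add_0_left 1 exp_add cis_conv_exp)
    also have "\<dots> = of_real (mellin_weight \<theta> y) * cis (x * y)"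
      unfolding 2 mellin_weight_def by (simp only: exp_of_real) simp
    finally show ?thesis .
  qed
  note J = logistic_Mellin_integral[OF a]
  show "integrable lborel (\<lambda>y. of_real (mellin_weight \<theta> y) * cis (x * y))"
    using lborel_integrable_real_affine[OF J(1), of "2 * pi" 0, unfolded eq] by simp
  have "of_real pi / sin (of_real pi * a) = 2 * pi * (LINT y|lborel. of_real (mellin_weight \<theta> y) * cis (x * y))"
    using lborel_integral_real_affine[of "2 * pi" ?J 0, unfolded eq J(2)] by (simp add: scaleR_conv_of_real)
  moreover have "of_real pi * a = of_real \<theta> + \<i> * of_real x / 2 + of_real pi / 2"
    by (simp add: a_def field_simps)
  then have "sin (of_real pi * a) = cos (of_real \<theta> + \<i> * of_real x / 2)"
    by (simp add: sin_add)
  ultimately have "2 * (LINT y|lborel. of_real (mellin_weight \<theta> y) * cis (x * y)) * complex_of_real pi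
      = 1 / cos (of_real \<theta> + \<i> * of_real x / 2) * complex_of_real pi"
    by (simp add: mult_ac)
  then have "2 * (LINT y|lborel. of_real (mellin_weight \<theta> y) * cis (x * y)) = 1 / cos (of_real \<theta> + \<i> * of_real x / 2)"
    by (subst (asm) mult_right_cancel) auto
  then have "2 * (LINT y|lborel. of_real (mellin_weight \<theta> y) * cis (x * y)) / 2 = 1 / cos (of_real \<theta> + \<i> * of_real x / 2) / 2"
    by (simp only:)
  then show "(LINT y|lborel. of_real (mellin_weight \<theta> y) * cis (x * y)) = 1 / (2 * cos (of_real \<theta> + \<i> * of_real x / 2))"
    by (simp add: mult.commute)
qed

text \<open>By Euler's formula 2 cos (\<theta> + \<i> x / 2) is the sum of cis \<theta> * exp (- x /
  2) and cis (- \<theta>) * exp (x / 2); for x = ln s - ln t the two exponentials are sqrt (t / s)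
  and sqrt (s / t).\<close>

lemma mellin_weight_kernel:
  assumes th: "\<bar>\<theta>\<bar> < pi / 2" and ts: "0 < t" "0 < s"
  shows "(LINT y|lborel. of_real (mellin_weight \<theta> y) * cis ((ln s - ln t) * y))
     = of_real (sqrt t * sqrt s) / (of_real t * cis \<theta> + of_real s * cis (- \<theta>))"
proof -
  define x where "x = ln s - ln t"
  have ex: "exp (x / 2) = sqrt s / sqrt t"
    using ts by (simp add: x_def diff_divide_distrib exp_diff ln_sqrt[symmetric])
  have 2: "\<i> * (of_real \<theta> + \<i> * of_real x / 2) = \<i> * of_real \<theta> + of_real (- (x / 2))"
     "- (\<i> * (of_real \<theta> + \<i> * of_real x / 2)) = \<i> * of_real (- \<theta>) + of_real (x / 2)"
    by (simp_all add: algebra_simps)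
  have "2 * cos (of_real \<theta> + \<i> * of_real x / 2) = cis \<theta> * of_real (exp (- (x / 2))) + cis (- \<theta>) * of_real (exp (x / 2))"
  proof -
    have "2 * cos (of_real \<theta> + \<i> * of_real x / 2) = exp (\<i> * of_real \<theta> + of_real (- (x / 2)))
        + exp (\<i> * of_real (- \<theta>) + of_real (x / 2))"
      unfolding 2[symmetric] by (simp add: cos_exp_eq)
    then show ?thesis by (simp only: exp_add cis_conv_exp exp_of_real)
  qed
  also have "\<dots> = (of_real t * cis \<theta> + of_real s * cis (- \<theta>)) / of_real (sqrt t * sqrt s)"
  proof -
    have *: "(sqrt t)\<^sup>2 = t" "(sqrt s)\<^sup>2 = s" "sqrt t \<noteq> 0" "sqrt s \<noteq> 0" using ts by auto
    have "exp (- (x / 2)) = t / (sqrt t * sqrt s)" "exp (x / 2) = s / (sqrt t * sqrt s)"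
      using * unfolding exp_minus ex by (simp_all add: field_simps power2_eq_square)
    then show ?thesis by (simp only: of_real_divide add_divide_distrib) (simp add: mult_ac)
  qed
  finally show ?thesis using mellin_weight_Fourier(2)[OF th, of x] by (simp add: x_def)
qed

section \<open>Square integrals of integral transforms\<close>

lemma sigma_finite_Rpos: "sigma_finite_measure Rpos"
proof -
  obtain A :: "real set set" where "countable A" "A \<subseteq> sets lborel" "\<Union>A = space lborel"
      "\<forall>a\<in>A. emeasure lborel a \<noteq> \<infinity>"
    using lborel.sigma_finite_countable by blast
  then interpret sigma_finite_measure "lebesgue :: real measure"
    by unfold_locales (auto intro!: exI[of _ A] simp: subset_eq)
  show ?thesis by (intro sigma_finite_measure_restrict_space sigma_finite_measure_axioms) auto
qed

text \<open>The squared modulus is a double integral over (t, s), into which the integral over x is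
  moved. Hypothesis k bounds the absolute kernel by a product of integrable functions of t and of s,
  which is Tonelli's condition on the triple product.\<close>

lemma square_integral_Fubini:
  fixes F :: "'b \<Rightarrow> 'a \<Rightarrow> complex"
  assumes N: "sigma_finite_measure N" and M: "sigma_finite_measure M"
    and F[measurable]: "case_prod F \<in> borel_measurable (N \<Otimes>\<^sub>M M)"
    and Fi: "\<And>x. x \<in> space N \<Longrightarrow> integrable M (F x)"
    and g: "integrable M g"
    and k: "\<And>t s. t \<in> space M \<Longrightarrow> s \<in> space M \<Longrightarrow>
       (\<integral>\<^sup>+x. ennreal (norm (F x t) * norm (F x s)) \<partial>N) \<le> ennreal (c * norm (g t) * norm (g s :: real))"
  shows "integrable N (\<lambda>x. (norm (LINT t|M. F x t))\<^sup>2)"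
    and "of_real (LINT x|N. (norm (LINT t|M. F x t))\<^sup>2)
       = (LINT p|(M \<Otimes>\<^sub>M M). LINT x|N. F x (fst p) * cnj (F x (snd p)))"
proof -
  interpret N: sigma_finite_measure N by fact
  interpret M: sigma_finite_measure M by fact
  interpret MM: pair_sigma_finite M M by unfold_locales
  interpret MMs: sigma_finite_measure "M \<Otimes>\<^sub>M M" by (rule MM.sigma_finite_measure_axioms)
  interpret NMM: pair_sigma_finite N "M \<Otimes>\<^sub>M M" by unfold_locales
  have [measurable]: "g \<in> borel_measurable M" using g by auto
  \<comment> \<open>Stated for any normed field because it serves both the real dominating function
    and the complex integrand.\<close>
  have prod: "integrable (M \<Otimes>\<^sub>M M) (\<lambda>p. u (fst p) * v (snd p))"
      "(LINT p|(M \<Otimes>\<^sub>M M). u (fst p) * v (snd p)) = (LINT t|M. u t) * (LINT s|M. v s)"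
    if u: "integrable M u" and v: "integrable M v" 
    for u v :: "'a \<Rightarrow> 'c :: {real_normed_field, second_countable_topology, banach}"
  proof -
    have [measurable]: "u \<in> borel_measurable M" "v \<in> borel_measurable M" using u v by auto
    show i: "integrable (M \<Otimes>\<^sub>M M) (\<lambda>p. u (fst p) * v (snd p))"
    proof (rule MM.Fubini_integrable)
      show "integrable M (\<lambda>x. LINT y|M. norm (u (fst (x, y)) * v (snd (x, y))))"
        using u v by (simp add: norm_mult)
      show "AE x in M. integrable M (\<lambda>y. u (fst (x, y)) * v (snd (x, y)))"
        using v by simp
    qed measurable
    show "(LINT p|(M \<Otimes>\<^sub>M M). u (fst p) * v (snd p)) = (LINT t|M. u t) * (LINT s|M. v s)"
      using MM.integral_fst'[OF i] u v by simp
  qed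
  let ?G = "\<lambda>x p. F x (fst p) * cnj (F x (snd p))"
  have Gm: "case_prod ?G \<in> borel_measurable (N \<Otimes>\<^sub>M (M \<Otimes>\<^sub>M M))"
  proof -
    have [measurable]: "(\<lambda>z. F (fst z) (fst (snd z))) \<in> borel_measurable (N \<Otimes>\<^sub>M (M \<Otimes>\<^sub>M M))"
      "(\<lambda>z. F (fst z) (snd (snd z))) \<in> borel_measurable (N \<Otimes>\<^sub>M (M \<Otimes>\<^sub>M M))"
      by measurable
    have [measurable]: "(\<lambda>z. cnj (F (fst z) (snd (snd z)))) \<in> borel_measurable (N \<Otimes>\<^sub>M (M \<Otimes>\<^sub>M M))"
      by (rule measurable_compose[where g = cnj]) (auto intro!: borel_measurable_continuous_onI continuous_intros)
    show ?thesis by (simp add: case_prod_beta')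
  qed
  have G: "integrable (N \<Otimes>\<^sub>M (M \<Otimes>\<^sub>M M)) (case_prod ?G)"
  proof (rule integrableI_bounded[OF Gm])
    have "(\<integral>\<^sup>+z. ennreal (norm (case_prod ?G z)) \<partial>(N \<Otimes>\<^sub>M (M \<Otimes>\<^sub>M M)))
        = (\<integral>\<^sup>+p. (\<integral>\<^sup>+x. ennreal (norm (F x (fst p)) * norm (F x (snd p))) \<partial>N) \<partial>(M \<Otimes>\<^sub>M M))"
      using Gm by (subst NMM.nn_integral_snd[symmetric]) (auto simp: norm_mult)
    also have "\<dots> \<le> (\<integral>\<^sup>+p. ennreal (norm (c * norm (g (fst p)) * norm (g (snd p)))) \<partial>(M \<Otimes>\<^sub>M M))"
      by (intro nn_integral_mono order_trans[OF k]) (auto simp: space_pair_measure intro!: ennreal_leI)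
    also have "\<dots> < \<infinity>"
    proof -
      have "integrable (M \<Otimes>\<^sub>M M) (\<lambda>p. c * norm (g (fst p)) * norm (g (snd p)))"
        using prod(1)[of "\<lambda>t. c * norm (g t)" "\<lambda>t. norm (g t)"] g by simp
      then show ?thesis unfolding integrable_iff_bounded by simp
    qed
    finally show "(\<integral>\<^sup>+z. ennreal (norm (case_prod ?G z)) \<partial>(N \<Otimes>\<^sub>M (M \<Otimes>\<^sub>M M))) < \<infinity>" .
  qed
  have in1: "(LINT p|(M \<Otimes>\<^sub>M M). ?G x p) = of_real ((norm (LINT t|M. F x t))\<^sup>2)" if "x \<in> space N" for x
    using prod(2)[OF Fi[OF that] integrable_cnj[OF Fi[OF that]]]
    by (simp add: complex_norm_square del: of_real_power)
  have "integrable N (\<lambda>x. LINT p|(M \<Otimes>\<^sub>M M). ?G x p)"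
    using NMM.integrable_fst[OF G] .
  then have "integrable N (\<lambda>x. complex_of_real ((norm (LINT t|M. F x t))\<^sup>2))"
    by (subst (asm) Bochner_Integration.integrable_cong[OF refl in1]) auto
  then show "integrable N (\<lambda>x. (norm (LINT t|M. F x t))\<^sup>2)"
    by (simp only: complex_of_real_integrable_eq)
  have "of_real (LINT x|N. (norm (LINT t|M. F x t))\<^sup>2) = (LINT x|N. complex_of_real ((norm (LINT t|M. F x t))\<^sup>2))"
    by (simp only: integral_complex_of_real)
  also have "\<dots> = (LINT x|N. LINT p|(M \<Otimes>\<^sub>M M). ?G x p)"
    by (intro Bochner_Integration.integral_cong refl) (simp add: in1)
  also have "\<dots> = (LINT p|(M \<Otimes>\<^sub>M M). LINT x|N. ?G x p)"
    using NMM.Fubini_integral[OF G] by simp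
  finally show "of_real (LINT x|N. (norm (LINT t|M. F x t))\<^sup>2)
       = (LINT p|(M \<Otimes>\<^sub>M M). LINT x|N. F x (fst p) * cnj (F x (snd p)))" .
qed

section \<open>The transform as a weighted Mellin transform\<close>

lemma measurable_id_Rpos [measurable (raw)]: "(\<lambda>x::real. x) \<in> borel_measurable Rpos"
  by (intro measurable_restrict_space1 measurable_completion) simp

lemma measurable_fst_Rpos [measurable]: "fst \<in> borel_measurable (Rpos \<Otimes>\<^sub>M N)"
  by (rule measurable_compose[OF measurable_fst measurable_id_Rpos])

lemma measurable_snd_Rpos [measurable]: "snd \<in> borel_measurable (N \<Otimes>\<^sub>M Rpos)"
  by (rule measurable_compose[OF measurable_snd measurable_id_Rpos])

text \<open>The point 0 is null; the closed half-line is the form to which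
  \<open>nn_integral_FTC_atLeast\<close> applies.\<close>

lemma nn_integral_Rpos:
  fixes f :: "real \<Rightarrow> ennreal"
  assumes "f \<in> borel_measurable borel"
  shows "(\<integral>\<^sup>+x. f x \<partial>Rpos) = (\<integral>\<^sup>+x. f x * indicator {0..} x \<partial>lborel)"
proof -
  have "(\<integral>\<^sup>+x. f x \<partial>Rpos) = (\<integral>\<^sup>+x. f x * indicator {0<..} x \<partial>lborel)"
    using assms by (simp add: nn_integral_restrict_space nn_integral_completion)
  also have "\<dots> = (\<integral>\<^sup>+x. f x * indicator {0..} x \<partial>lborel)"
    using AE_lborel_singleton[of 0] by (intro nn_integral_cong_AE) (auto simp: indicator_def)
  finally show ?thesis .
qed

lemma nn_integral_exp_Rpos:
  assumes "0 < c"
  shows "(\<integral>\<^sup>+\<rho>. ennreal (exp (- (c * \<rho>))) \<partial>Rpos) = ennreal (1 / c)"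
proof -
  have "(\<integral>\<^sup>+\<rho>. ennreal (exp (- (c * \<rho>))) \<partial>Rpos)
      = (\<integral>\<^sup>+\<rho>. ennreal (exp (- (c * \<rho>))) * indicator {0..} \<rho> \<partial>lborel)"
    by (rule nn_integral_Rpos) measurable
  also have "\<dots> = 0 - (- (exp (- (c * 0)) / c))"
  proof (rule nn_integral_FTC_atLeast)
    show "((\<lambda>x. - (exp (- (c * x)) / c)) \<longlongrightarrow> 0) at_top" using assms by real_asymp
    show "DERIV (\<lambda>x. - (exp (- (c * x)) / c)) x :> exp (- (c * x))" for x
      using assms by (auto intro!: derivative_eq_intros)
  qed auto
  finally show ?thesis by simp
qed

lemma exp_integral_Rpos:
  fixes c :: complex
  assumes c: "0 < Re c"
  shows "integrable Rpos (\<lambda>\<rho>. exp (- (of_real \<rho> * c)))"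
    and "(LINT \<rho>|Rpos. exp (- (of_real \<rho> * c))) = 1 / c"
proof -
  let ?f = "\<lambda>\<rho>::real. exp (- (of_real \<rho> * c))"
  show i: "integrable Rpos ?f"
  proof (rule integrableI_bounded)
    have "(\<integral>\<^sup>+\<rho>. ennreal (norm (?f \<rho>)) \<partial>Rpos) = (\<integral>\<^sup>+\<rho>. ennreal (exp (- (Re c * \<rho>))) \<partial>Rpos)"
      by (simp add: norm_exp_eq_Re mult.commute)
    then show "(\<integral>\<^sup>+\<rho>. ennreal (norm (?f \<rho>)) \<partial>Rpos) < \<infinity>"
      by (simp add: nn_integral_exp_Rpos[OF c])
  qed measurable
  have m: "?f \<in> borel_measurable borel" by measurable
  have "c \<noteq> 0" using c by auto
  have ei: "einterval 0 \<infinity> = {0<..}" by (auto simp: einterval_def)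
  have si: "set_integrable lborel {0<..} ?f"
    using i m by (simp add: set_integrable_def integrable_restrict_space integrable_completion)
  have "(LBINT x=0..\<infinity>. ?f x) = 0 - (- (1 / c))"
  proof (rule interval_integral_FTC_integrable)
    show "((\<lambda>x. - (?f x / c)) has_vector_derivative ?f x) (at x)" for x
    proof -
      have "((\<lambda>z. - (exp (- (z * c)) / c)) has_field_derivative ?f x) (at (of_real x))"
        using \<open>c \<noteq> 0\<close> by (auto intro!: derivative_eq_intros)
      then show ?thesis by (rule has_vector_derivative_real_field)
    qed
    show "isCont ?f x" for x by (intro continuous_intros)
    show "set_integrable lborel (einterval 0 \<infinity>) ?f" using si by (simp add: ei)
    show "(((\<lambda>x. - (?f x / c)) \<circ> real_of_ereal) \<longlongrightarrow> - (1 / c)) (at_right 0)"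
    proof -
      have "((\<lambda>x. - (?f x / c)) \<longlongrightarrow> - (?f 0 / c)) (at_right 0)"
        by (intro tendsto_intros) (use \<open>c \<noteq> 0\<close> in auto)
      then show ?thesis
        unfolding zero_ereal_def by (simp add: ereal_tendsto_simps)
    qed
    have "((\<lambda>x::real. exp (- (x * Re c))) \<longlongrightarrow> 0) at_top" using c by real_asymp
    then have "((\<lambda>x::real. norm (?f x)) \<longlongrightarrow> 0) at_top" by (simp add: norm_exp_eq_Re)
    then have "((\<lambda>x::real. ?f x) \<longlongrightarrow> 0) at_top" by (rule tendsto_norm_zero_cancel)
    then have "((\<lambda>x::real. - (?f x / c)) \<longlongrightarrow> - (0 / c)) at_top"
      by (intro tendsto_intros) (use \<open>c \<noteq> 0\<close> in auto)
    then show "(((\<lambda>x. - (?f x / c)) \<circ> real_of_ereal) \<longlongrightarrow> 0) (at_left \<infinity>)"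
      by (simp add: ereal_tendsto_simps)
  qed auto
  moreover have "(LINT \<rho>|Rpos. ?f \<rho>) = (LBINT x=0..\<infinity>. ?f x)"
    using m by (simp add: interval_lebesgue_integral_def ei set_lebesgue_integral_def
        integral_restrict_space integral_completion)
  ultimately show "(LINT \<rho>|Rpos. ?f \<rho>) = 1 / c" by simp
qed

text \<open>The classical Mellin transform at 1 / 2 - \<i> y, or equally the Fourier transform of
  the function \<open>exp (x / 2) * f (exp x)\<close> of x; hence the Plancherel constant 2 *
  pi.\<close>

definition mellin :: "(real \<Rightarrow> complex) \<Rightarrow> real \<Rightarrow> complex" where
  "mellin f y = (LINT t|Rpos. f t / of_real (sqrt t) * cis (- (y * ln t)))"

lemma measurable_cis_compose [measurable (raw)]:
  "g \<in> borel_measurable M \<Longrightarrow> (\<lambda>x. cis (g x)) \<in> borel_measurable M"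
  by (rule measurable_compose[where g = cis]) (auto intro!: borel_measurable_continuous_onI continuous_intros)

text \<open>Absorbing \<open>sqrt (W y)\<close> into the integrand makes
  \<open>square_integral_Fubini\<close> applicable; the weight then enters through its Fourier
  transform at ln s - ln t. W will be \<open>mellin_weight \<theta>\<close> or a Gaussian.\<close>

lemma weighted_mellin_square:
  assumes [measurable]: "W \<in> borel_measurable borel" and W: "\<And>y. 0 \<le> W y" "integrable lborel W"
    and fm[measurable]: "f \<in> borel_measurable Rpos"
    and fi: "integrable Rpos (\<lambda>t. f t / of_real (sqrt t))"
  shows "integrable lborel (\<lambda>y. W y * (norm (mellin f y))\<^sup>2)"
    and "of_real (LINT y|lborel. W y * (norm (mellin f y))\<^sup>2)
       = (LINT p|(Rpos \<Otimes>\<^sub>M Rpos). f (fst p) / of_real (sqrt (fst p)) * cnj (f (snd p) / of_real (sqrt (snd p))) *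
            (LINT y|lborel. of_real (W y) * cis ((ln (snd p) - ln (fst p)) * y)))"
proof -
  define F where "F y t = of_real (sqrt (W y)) * (f t / of_real (sqrt t) * cis (- (y * ln t)))" for y t
  have nF: "norm (F y t) = sqrt (W y) * norm (f t / of_real (sqrt t))" for y t
    using W by (simp add: F_def norm_mult norm_divide)
  have Fm: "case_prod F \<in> borel_measurable (lborel \<Otimes>\<^sub>M Rpos)"
    unfolding F_def case_prod_beta' by measurable
  have gi: "integrable Rpos (\<lambda>t. norm (f t / of_real (sqrt t)))"
    using fi by (rule integrable_norm)
  have Fi: "integrable Rpos (F y)" for y
  proof (rule Bochner_Integration.integrable_bound)
    show "integrable Rpos (\<lambda>t. sqrt (W y) * norm (f t / of_real (sqrt t)))"
      using gi by (rule integrable_mult_right)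
    show "F y \<in> borel_measurable Rpos" unfolding F_def[abs_def] by measurable
    show "AE t in Rpos. norm (F y t) \<le> norm (sqrt (W y) * norm (f t / of_real (sqrt t)))"
      by (intro AE_I2) (simp only: nF real_norm_def abs_ge_self)
  qed
  have k: "(\<integral>\<^sup>+y. ennreal (norm (F y t) * norm (F y s)) \<partial>lborel)
      \<le> ennreal ((LINT y|lborel. W y) * norm (norm (f t / of_real (sqrt t))) * norm (norm (f s / of_real (sqrt s))))" for t s
  proof -
    have "(\<integral>\<^sup>+y. ennreal (norm (F y t) * norm (F y s)) \<partial>lborel)
        = (\<integral>\<^sup>+y. ennreal (W y * (norm (f t / of_real (sqrt t)) * norm (f s / of_real (sqrt s)))) \<partial>lborel)"
    proof (rule nn_integral_cong)
      fix y
      have "norm (F y t) * norm (F y s) = (sqrt (W y) * sqrt (W y)) * (norm (f t / of_real (sqrt t)) * norm (f s / of_real (sqrt s)))"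
        unfolding nF by (simp only: mult_ac)
      then show "ennreal (norm (F y t) * norm (F y s)) = ennreal (W y * (norm (f t / of_real (sqrt t)) * norm (f s / of_real (sqrt s))))"
        using W(1)[of y] by simp
    qed
    also have "\<dots> = ennreal (LINT y|lborel. W y * (norm (f t / of_real (sqrt t)) * norm (f s / of_real (sqrt s))))"
      using W by (intro nn_integral_eq_integral integrable_mult_left) auto
    also have "\<dots> = ennreal ((LINT y|lborel. W y) * (norm (f t / of_real (sqrt t)) * norm (f s / of_real (sqrt s))))"
      by (simp only: integral_mult_left_zero)
    finally show ?thesis by (simp only: real_norm_def abs_norm_cancel mult.assoc order_refl)
  qed
  have in1: "(norm (LINT t|Rpos. F y t))\<^sup>2 = W y * (norm (mellin f y))\<^sup>2" for y
  proof -
    have "(LINT t|Rpos. F y t) = of_real (sqrt (W y)) * mellin f y"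
      by (simp only: F_def mellin_def integral_mult_right_zero)
    then show ?thesis using W(1)[of y] by (simp add: norm_mult power_mult_distrib)
  qed
  note * = square_integral_Fubini[OF sigma_finite_lborel sigma_finite_Rpos Fm Fi gi k]
  show "integrable lborel (\<lambda>y. W y * (norm (mellin f y))\<^sup>2)"
    using *(1) by (simp only: in1)
  have "F y t * cnj (F y s) = f t / of_real (sqrt t) * cnj (f s / of_real (sqrt s)) * (of_real (W y) * cis ((ln s - ln t) * y))" for y t s
  proof -
    have "of_real (sqrt (W y)) * of_real (sqrt (W y)) = complex_of_real (W y)"
      using W(1)[of y] by (simp flip: of_real_mult)
    moreover have "cis (- (y * ln t)) * cnj (cis (- (y * ln s))) = cis ((ln s - ln t) * y)"
      by (simp add: cis_cnj cis_mult algebra_simps)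
    moreover have "F y t * cnj (F y s) = f t / of_real (sqrt t) * cnj (f s / of_real (sqrt s)) *
        (of_real (sqrt (W y)) * of_real (sqrt (W y)) * (cis (- (y * ln t)) * cnj (cis (- (y * ln s)))))"
      by (simp add: F_def mult_ac)
    ultimately show ?thesis by (simp only:)
  qed
  then show "of_real (LINT y|lborel. W y * (norm (mellin f y))\<^sup>2)
       = (LINT p|(Rpos \<Otimes>\<^sub>M Rpos). f (fst p) / of_real (sqrt (fst p)) * cnj (f (snd p) / of_real (sqrt (snd p))) *
            (LINT y|lborel. of_real (W y) * cis ((ln (snd p) - ln (fst p)) * y)))"
    using *(2) by (simp only: in1 integral_mult_right_zero)
qed

lemma mellin_weight_pos: "0 < mellin_weight \<theta> y"
  by (simp add: mellin_weight_def add_pos_pos)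

lemma measurable_mellin_weight [measurable]: "mellin_weight \<theta> \<in> borel_measurable borel"
  unfolding mellin_weight_def[abs_def] by measurable

lemma integrable_mellin_weight: "\<bar>\<theta>\<bar> < pi / 2 \<Longrightarrow> integrable lborel (mellin_weight \<theta>)"
  using integrable_norm[OF mellin_weight_Fourier(1)[of \<theta> 0]] mellin_weight_pos[of \<theta>]
  by (simp add: norm_mult less_imp_le)

lemma Re_kernel_pos:
  assumes "\<bar>\<theta>\<bar> < pi / 2" "0 < t" "0 < s"
  shows "0 < Re (of_real t * cis \<theta> + of_real s * cis (- \<theta>))"
  using assms cos_gt_zero_pi[of \<theta>] by (auto simp: abs_less_iff intro!: add_pos_pos)

text \<open>Integrability of f / sqrt t makes both applications of Fubini absolute.
  \<open>laplace_square_le_aux\<close> removes this restriction by truncating f near 0.\<close>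

lemma laplace_square_eq_mellin:
  assumes th: "\<bar>\<theta>\<bar> < pi / 2"
    and f: "integrable Rpos f"
    and fi: "integrable Rpos (\<lambda>t. f t / of_real (sqrt t))"
  shows "integrable Rpos (\<lambda>\<rho>. (norm (laplace \<theta> f \<rho>))\<^sup>2)"
    and "(LINT \<rho>|Rpos. (norm (laplace \<theta> f \<rho>))\<^sup>2) = (LINT y|lborel. mellin_weight \<theta> y * (norm (mellin f y))\<^sup>2)"
proof -
  have [measurable]: "f \<in> borel_measurable Rpos" using f by auto
  have cp: "0 < cos \<theta>" using th by (intro cos_gt_zero_pi) auto
  define F where "F \<rho> t = f t * exp (- (of_real \<rho> * of_real t * cis \<theta>))" for \<rho> t
  have nF: "norm (F \<rho> t) = norm (f t) * exp (- (\<rho> * t * cos \<theta>))" for \<rho> t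
    by (simp add: F_def norm_mult norm_exp_eq_Re)
  have Fm: "case_prod F \<in> borel_measurable (Rpos \<Otimes>\<^sub>M Rpos)"
    unfolding F_def case_prod_beta' by measurable
  have gi: "integrable Rpos (\<lambda>t. norm (f t / of_real (sqrt t)))"
    using fi by (rule integrable_norm)
  have Fi: "integrable Rpos (F \<rho>)" if "\<rho> \<in> space Rpos" for \<rho>
  proof (rule Bochner_Integration.integrable_bound[OF f])
    have "0 \<le> \<rho> * t * cos \<theta>" if "0 < t" for t
      using \<open>\<rho> \<in> space Rpos\<close> that cp by (simp add: space_restrict_space)
    then show "AE t in Rpos. norm (F \<rho> t) \<le> norm (f t)"
      by (intro AE_I2) (simp add: nF mult_left_le space_restrict_space)
  qed (simp add: F_def[abs_def])
  have k: "(\<integral>\<^sup>+\<rho>. ennreal (norm (F \<rho> t) * norm (F \<rho> s)) \<partial>Rpos)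
      \<le> ennreal (1 / (2 * cos \<theta>) * norm (norm (f t / of_real (sqrt t))) * norm (norm (f s / of_real (sqrt s))))" 
    if "t \<in> space Rpos" "s \<in> space Rpos" for t s
  proof -
    have ts: "0 < t" "0 < s" using that by (auto simp: space_restrict_space)
    have "(\<integral>\<^sup>+\<rho>. ennreal (norm (F \<rho> t) * norm (F \<rho> s)) \<partial>Rpos)
        = (\<integral>\<^sup>+\<rho>. ennreal (norm (f t) * norm (f s)) * ennreal (exp (- ((t + s) * cos \<theta> * \<rho>))) \<partial>Rpos)"
      by (intro nn_integral_cong)
         (simp add: nF ennreal_mult[symmetric] algebra_simps flip: exp_add)
    also have "\<dots> = ennreal (norm (f t) * norm (f s)) * ennreal (1 / ((t + s) * cos \<theta>))"
      using ts cp by (subst nn_integral_cmult) (auto simp: nn_integral_exp_Rpos add_pos_pos)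
    also have "\<dots> = ennreal (norm (f t) * norm (f s) * (1 / ((t + s) * cos \<theta>)))"
      using ts cp by (subst ennreal_mult) auto
    \<comment> \<open>AM-GM, t + s \<ge> 2 * sqrt t * sqrt s, splits the kernel into a function of t
      times a function of s. Strict positivity of cos \<theta> is essential.\<close>
    also have "\<dots> \<le> ennreal (norm (f t) * norm (f s) * (1 / (2 * (sqrt t * sqrt s) * cos \<theta>)))"
    proof (intro ennreal_leI mult_left_mono divide_left_mono mult_right_mono)
      show "2 * (sqrt t * sqrt s) \<le> t + s"
        using sum_squares_bound[of "sqrt t" "sqrt s"] ts by simp
    qed (use ts cp in \<open>auto intro!: mult_pos_pos\<close>)
    also have "norm (f t) * norm (f s) * (1 / (2 * (sqrt t * sqrt s) * cos \<theta>))
       = 1 / (2 * cos \<theta>) * norm (norm (f t / of_real (sqrt t))) * norm (norm (f s / of_real (sqrt s)))"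
      using ts by (simp add: norm_divide field_simps)
    finally show ?thesis .
  qed
  note * = square_integral_Fubini[OF sigma_finite_Rpos sigma_finite_Rpos Fm Fi gi k]
  show "integrable Rpos (\<lambda>\<rho>. (norm (laplace \<theta> f \<rho>))\<^sup>2)"
    using *(1) by (simp add: F_def[abs_def] laplace_def)
  have "of_real (LINT \<rho>|Rpos. (norm (laplace \<theta> f \<rho>))\<^sup>2)
      = (LINT p|(Rpos \<Otimes>\<^sub>M Rpos). LINT \<rho>|Rpos. F \<rho> (fst p) * cnj (F \<rho> (snd p)))"
    using *(2) by (simp add: F_def[abs_def] laplace_def)
  also have "\<dots> = (LINT p|(Rpos \<Otimes>\<^sub>M Rpos). f (fst p) / of_real (sqrt (fst p)) * cnj (f (snd p) / of_real (sqrt (snd p))) *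
            (LINT y|lborel. of_real (mellin_weight \<theta> y) * cis ((ln (snd p) - ln (fst p)) * y)))"
  proof (intro Bochner_Integration.integral_cong refl)
    fix p assume "p \<in> space (Rpos \<Otimes>\<^sub>M Rpos)"
    then obtain t s where p: "p = (t, s)" and ts: "0 < t" "0 < s"
      by (auto simp: space_pair_measure space_restrict_space)
    let ?c = "of_real t * cis \<theta> + of_real s * cis (- \<theta>)"
    have "F \<rho> t * cnj (F \<rho> s) = f t * cnj (f s) * exp (- (of_real \<rho> * ?c))" for \<rho>
      by (simp add: F_def exp_cnj cis_cnj algebra_simps flip: exp_add)
    then have "(LINT \<rho>|Rpos. F \<rho> t * cnj (F \<rho> s)) = f t * cnj (f s) / ?c"
      using exp_integral_Rpos(2)[OF Re_kernel_pos[OF th ts]] by simp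
    also have "\<dots> = f t / of_real (sqrt t) * cnj (f s / of_real (sqrt s)) * (of_real (sqrt t * sqrt s) / ?c)"
      using ts by simp
    finally show "(LINT \<rho>|Rpos. F \<rho> (fst p) * cnj (F \<rho> (snd p))) = f (fst p) / of_real (sqrt (fst p)) * cnj (f (snd p) / of_real (sqrt (snd p))) *
            (LINT y|lborel. of_real (mellin_weight \<theta> y) * cis ((ln (snd p) - ln (fst p)) * y))"
      by (simp only: p fst_conv snd_conv mellin_weight_kernel[OF th ts])
  qed
  also have "\<dots> = of_real (LINT y|lborel. mellin_weight \<theta> y * (norm (mellin f y))\<^sup>2)"
    using fi by (intro weighted_mellin_square(2)[symmetric])
      (auto simp: integrable_mellin_weight[OF th] mellin_weight_pos[THEN less_imp_le])
  finally show "(LINT \<rho>|Rpos. (norm (laplace \<theta> f \<rho>))\<^sup>2) = (LINT y|lborel. mellin_weight \<theta> y * (norm (mellin f y))\<^sup>2)"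
    by (simp only: of_real_eq_iff)
qed

section \<open>Upper bound for the Mellin transform\<close>

text \<open>Obtained by scaling from the characteristic function of the standard normal law. The
  result is written as a normal density because its unit mass is what the Schur test needs.\<close>

lemma gaussian_Fourier:
  assumes s: "0 < \<sigma>"
  shows "(LINT y|lborel. of_real (exp (- (y\<^sup>2) / (2 * \<sigma>\<^sup>2))) * cis (x * y))
     = of_real (2 * pi * normal_density 0 (1 / \<sigma>) x)"
proof -
  let ?g = "\<lambda>y. of_real (exp (- (y\<^sup>2) / (2 * \<sigma>\<^sup>2))) * cis (x * y)"
  have "char std_normal_distribution (x * \<sigma>) = (LINT z|lborel. of_real (std_normal_density z) * cis (x * \<sigma> * z))"
    unfolding char_def cis_conv_exp
    by (subst integral_density) (auto simp: scaleR_conv_of_real mult_ac)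
  also have "\<dots> = (LINT z|lborel. of_real (1 / sqrt (2 * pi)) * (of_real (exp (- z\<^sup>2 / 2)) * cis (x * \<sigma> * z)))"
    unfolding std_normal_density_def of_real_mult by (simp only: mult.assoc)
  also have "\<dots> = of_real (1 / sqrt (2 * pi)) * (LINT z|lborel. of_real (exp (- z\<^sup>2 / 2)) * cis (x * \<sigma> * z))"
    by (rule integral_mult_right_zero)
  finally have "of_real (exp (- ((x * \<sigma>)\<^sup>2) / 2)) = of_real (1 / sqrt (2 * pi)) * (LINT z|lborel. of_real (exp (- z\<^sup>2 / 2)) * cis (x * \<sigma> * z))"
    by (simp only: char_std_normal_distribution)
  then have 1: "(LINT z|lborel. of_real (exp (- z\<^sup>2 / 2)) * cis (x * \<sigma> * z)) = of_real (sqrt (2 * pi) * exp (- ((x * \<sigma>)\<^sup>2) / 2))"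
    by (simp add: field_simps)
  have "(LINT y|lborel. ?g y) = \<bar>\<sigma>\<bar> *\<^sub>R (LINT z|lborel. ?g (0 + \<sigma> * z))"
    using s by (intro lborel_integral_real_affine) auto
  also have "(\<lambda>z. ?g (0 + \<sigma> * z)) = (\<lambda>z. of_real (exp (- z\<^sup>2 / 2)) * cis (x * \<sigma> * z))"
    using s by (auto simp: power_mult_distrib mult_ac)
  finally have "(LINT y|lborel. ?g y) = of_real (\<sigma> * (sqrt (2 * pi) * exp (- ((x * \<sigma>)\<^sup>2) / 2)))"
    using s unfolding 1 by (simp add: scaleR_conv_of_real)
  also have "\<sigma> * (sqrt (2 * pi) * exp (- ((x * \<sigma>)\<^sup>2) / 2)) = 2 * pi * normal_density 0 (1 / \<sigma>) x"
  proof -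
    have "sqrt (2 * pi * (1 / \<sigma>)\<^sup>2) = sqrt (2 * pi) / \<sigma>"
      using s by (simp add: real_sqrt_mult real_sqrt_divide power_divide)
    moreover have "2 * pi / sqrt (2 * pi) = sqrt (2 * pi)"
      by (simp add: real_div_sqrt)
    moreover have "(x - 0)\<^sup>2 / (2 * (1 / \<sigma>)\<^sup>2) = (x * \<sigma>)\<^sup>2 / 2"
      using s by (simp add: power_divide power_mult_distrib)
    ultimately have "normal_density 0 (1 / \<sigma>) x = \<sigma> / sqrt (2 * pi) * exp (- ((x * \<sigma>)\<^sup>2 / 2))"
      unfolding normal_density_def by (simp only: minus_divide_left[symmetric] divide_divide_eq_right mult_1)
    then have "2 * pi * normal_density 0 (1 / \<sigma>) x = (2 * pi / sqrt (2 * pi)) * \<sigma> * exp (- ((x * \<sigma>)\<^sup>2 / 2))"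
      by simp
    then show ?thesis
      unfolding \<open>2 * pi / sqrt (2 * pi) = sqrt (2 * pi)\<close> by simp
  qed
  finally show ?thesis .
qed

text \<open>Under t = exp x this is the total mass of the normal law with mean c. It supplies the
  row and column sums of the Schur test.\<close>

lemma nn_integral_log_normal_Rpos:
  assumes s: "0 < \<sigma>"
  shows "(\<integral>\<^sup>+t. ennreal (normal_density 0 \<sigma> (ln t - c) / t) \<partial>Rpos) = 1"
proof -
  have eq: "exp x *\<^sub>R (normal_density 0 \<sigma> (ln (exp x) - c) / exp x) = normal_density c \<sigma> x" for x
    by (simp add: normal_density_def)
  have m: "normal_density c \<sigma> \<in> borel_measurable borel" by measurable
  have "integrable Rpos (\<lambda>t. normal_density 0 \<sigma> (ln t - c) / t)"
    using integral_exp_substitution(1)[of "\<lambda>t. normal_density 0 \<sigma> (ln t - c) / t", unfolded eq]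
    by (simp only: integrable_lborel_iff_lebesgue[OF m] integrable_normal_density[OF s])
  moreover from integral_exp_substitution(2)[OF this, unfolded eq]
  have "(LINT t|Rpos. normal_density 0 \<sigma> (ln t - c) / t) = 1"
    using s by (simp add: integral_completion)
  ultimately show ?thesis
    by (subst nn_integral_eq_integral) (auto intro!: AE_I2 divide_nonneg_nonneg simp: space_restrict_space)
qed

text \<open>One half of Plancherel's formula, with a bound that does not depend on \<sigma>: the
  Gaussian weight becomes a normal density in ln s - ln t, and only its unit mass enters.\<close>

lemma gaussian_mellin_square_le:
  assumes s: "0 < \<sigma>" 
    and fm[measurable]: "f \<in> borel_measurable Rpos"
    and fi: "integrable Rpos (\<lambda>t. f t / of_real (sqrt t))"
    and f2: "integrable Rpos (\<lambda>t. (norm (f t))\<^sup>2)"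
  shows "(LINT y|lborel. exp (- (y\<^sup>2) / (2 * \<sigma>\<^sup>2)) * (norm (mellin f y))\<^sup>2)
     \<le> 2 * pi * (LINT t|Rpos. (norm (f t))\<^sup>2)"
proof -
  interpret R: sigma_finite_measure Rpos by (rule sigma_finite_Rpos)
  interpret RR: pair_sigma_finite Rpos Rpos by unfold_locales
  let ?W = "\<lambda>y. exp (- (y\<^sup>2) / (2 * \<sigma>\<^sup>2))"
  let ?d = "\<lambda>x. normal_density 0 (1 / \<sigma>) x"
  let ?A = "\<lambda>p. f (fst p) / of_real (sqrt (fst p)) * cnj (f (snd p) / of_real (sqrt (snd p))) *
            complex_of_real (2 * pi * ?d (ln (snd p) - ln (fst p)))"
  have W: "integrable lborel ?W"
  proof -
    have "?W = (\<lambda>y. sqrt (2 * pi * \<sigma>\<^sup>2) * normal_density 0 \<sigma> y)"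
      using s by (auto simp: normal_density_def)
    then show ?thesis using s by simp
  qed
  have d_even: "?d (- x) = ?d x" for x by (simp add: normal_density_def)
  have "of_real (LINT y|lborel. ?W y * (norm (mellin f y))\<^sup>2) = (LINT p|(Rpos \<Otimes>\<^sub>M Rpos). ?A p)"
    using weighted_mellin_square(2)[OF _ _ W fm fi] by (simp only: gaussian_Fourier[OF s]) simp
  then have "norm (complex_of_real (LINT y|lborel. ?W y * (norm (mellin f y))\<^sup>2)) = norm (LINT p|(Rpos \<Otimes>\<^sub>M Rpos). ?A p)"
    by (rule arg_cong)
  moreover have "0 \<le> (LINT y|lborel. ?W y * (norm (mellin f y))\<^sup>2)"
    by (intro Bochner_Integration.integral_nonneg) auto
  ultimately have "ennreal (LINT y|lborel. ?W y * (norm (mellin f y))\<^sup>2) = ennreal (norm (LINT p|(Rpos \<Otimes>\<^sub>M Rpos). ?A p))"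
    by simp
  also have "\<dots> \<le> (\<integral>\<^sup>+p. ennreal (norm (?A p)) \<partial>(Rpos \<Otimes>\<^sub>M Rpos))"
  \<comment> \<open>Without integrability the Bochner integral has the default value 0 and the bound
    is trivial.\<close>
  proof (cases "integrable (Rpos \<Otimes>\<^sub>M Rpos) ?A")
    case True
    then show ?thesis by (rule integral_norm_bound_ennreal)
  next
    case False
    then have "(LINT p|(Rpos \<Otimes>\<^sub>M Rpos). ?A p) = 0" by (rule not_integrable_integral_eq)
    then show ?thesis by (simp only: norm_zero ennreal_0 zero_le)
  qed
  also have "\<dots> \<le> (\<integral>\<^sup>+p. ennreal (pi * (norm (f (fst p)))\<^sup>2) * ennreal (?d (ln (snd p) - ln (fst p)) / snd p)
        + ennreal (pi * (norm (f (snd p)))\<^sup>2) * ennreal (?d (ln (fst p) - ln (snd p)) / fst p) \<partial>(Rpos \<Otimes>\<^sub>M Rpos))"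
  proof (rule nn_integral_mono)
    fix p assume "p \<in> space (Rpos \<Otimes>\<^sub>M Rpos)"
    then obtain t s where p: "p = (t, s)" and ts: "0 < t" "0 < s"
      by (auto simp: space_pair_measure space_restrict_space)
    define d where "d = ?d (ln s - ln t)"
    have d: "0 \<le> d" "?d (ln t - ln s) = d"
      unfolding d_def using d_even[of "ln s - ln t"] by auto
    \<comment> \<open>The Schur test: sqrt t and sqrt s are exchanged between the two values of f,
      so that after AM-GM each square is multiplied by a log-normal density in the other
      variable.\<close>
    have "norm (?A p) = (norm (f t) / sqrt s * (norm (f s) / sqrt t)) * (2 * pi * d)"
      using d(1) ts unfolding p fst_conv snd_conv d_def[symmetric]
      by (simp add: norm_mult norm_divide)
    also have "\<dots> \<le> (((norm (f t) / sqrt s)\<^sup>2 + (norm (f s) / sqrt t)\<^sup>2) / 2) * (2 * pi * d)"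
    proof (intro mult_right_mono)
      have "x * y \<le> (x\<^sup>2 + y\<^sup>2) / 2" for x y :: real
        using sum_squares_bound[of x y] by simp
      then show "norm (f t) / sqrt s * (norm (f s) / sqrt t) \<le> ((norm (f t) / sqrt s)\<^sup>2 + (norm (f s) / sqrt t)\<^sup>2) / 2" .
    qed (use d in auto)
    also have "\<dots> = pi * (norm (f t))\<^sup>2 * (d / s) + pi * (norm (f s))\<^sup>2 * (d / t)"
      using ts by (simp add: power_divide field_simps)
    finally have "ennreal (norm (?A p)) \<le> ennreal (pi * (norm (f t))\<^sup>2 * (d / s) + pi * (norm (f s))\<^sup>2 * (d / t))"
      by (rule ennreal_leI)
    also have "\<dots> = ennreal (pi * (norm (f t))\<^sup>2) * ennreal (d / s) + ennreal (pi * (norm (f s))\<^sup>2) * ennreal (d / t)"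
      using d ts by (simp add: ennreal_mult[symmetric] ennreal_plus[symmetric] del: ennreal_plus)
    finally show "ennreal (norm (?A p)) \<le> ennreal (pi * (norm (f (fst p)))\<^sup>2) * ennreal (?d (ln (snd p) - ln (fst p)) / snd p)
        + ennreal (pi * (norm (f (snd p)))\<^sup>2) * ennreal (?d (ln (fst p) - ln (snd p)) / fst p)"
      by (simp only: p fst_conv snd_conv d d_def[symmetric])
  qed
  also have "\<dots> = (\<integral>\<^sup>+p. ennreal (pi * (norm (f (fst p)))\<^sup>2) * ennreal (?d (ln (snd p) - ln (fst p)) / snd p) \<partial>(Rpos \<Otimes>\<^sub>M Rpos))
      + (\<integral>\<^sup>+p. ennreal (pi * (norm (f (snd p)))\<^sup>2) * ennreal (?d (ln (fst p) - ln (snd p)) / fst p) \<partial>(Rpos \<Otimes>\<^sub>M Rpos))"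
    by (rule nn_integral_add) measurable
  also have "(\<integral>\<^sup>+p. ennreal (pi * (norm (f (fst p)))\<^sup>2) * ennreal (?d (ln (snd p) - ln (fst p)) / snd p) \<partial>(Rpos \<Otimes>\<^sub>M Rpos))
      = (\<integral>\<^sup>+t. ennreal (pi * (norm (f t))\<^sup>2) * (\<integral>\<^sup>+s. ennreal (?d (ln s - ln t) / s) \<partial>Rpos) \<partial>Rpos)"
    by (subst R.nn_integral_fst[symmetric]) (simp_all add: nn_integral_cmult)
  also have "(\<integral>\<^sup>+p. ennreal (pi * (norm (f (snd p)))\<^sup>2) * ennreal (?d (ln (fst p) - ln (snd p)) / fst p) \<partial>(Rpos \<Otimes>\<^sub>M Rpos))
      = (\<integral>\<^sup>+s. ennreal (pi * (norm (f s))\<^sup>2) * (\<integral>\<^sup>+t. ennreal (?d (ln t - ln s) / t) \<partial>Rpos) \<partial>Rpos)"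
    by (subst RR.nn_integral_snd[symmetric]) (simp_all add: nn_integral_cmult case_prod_beta')
  also have "(\<integral>\<^sup>+t. ennreal (pi * (norm (f t))\<^sup>2) * (\<integral>\<^sup>+s. ennreal (?d (ln s - ln t) / s) \<partial>Rpos) \<partial>Rpos)
      = ennreal (pi * (LINT t|Rpos. (norm (f t))\<^sup>2))"
    using s f2 by (simp add: nn_integral_log_normal_Rpos nn_integral_eq_integral)
  also have "\<dots> + \<dots> = ennreal (2 * pi * (LINT t|Rpos. (norm (f t))\<^sup>2))"
    by (simp add: ennreal_plus[symmetric] Bochner_Integration.integral_nonneg del: ennreal_plus)
  finally show ?thesis
    by (subst (asm) ennreal_le_iff) (auto intro!: mult_nonneg_nonneg Bochner_Integration.integral_nonneg)
qed

text \<open>The bound w \<le> \<kappa> is applied under an extra Gaussian factor, since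
  square-integrability of the Mellin transform has been established only with such a weight.
  Dominated convergence then lets the Gaussian tend to 1.\<close>

lemma weighted_mellin_square_le:
  assumes \<kappa>: "\<And>y. mellin_weight \<theta> y \<le> \<kappa>" and th: "\<bar>\<theta>\<bar> < pi / 2"
    and fm[measurable]: "f \<in> borel_measurable Rpos"
    and fi: "integrable Rpos (\<lambda>t. f t / of_real (sqrt t))"
    and f2: "integrable Rpos (\<lambda>t. (norm (f t))\<^sup>2)"
  shows "(LINT y|lborel. mellin_weight \<theta> y * (norm (mellin f y))\<^sup>2)
     \<le> 2 * pi * \<kappa> * (LINT t|Rpos. (norm (f t))\<^sup>2)"
proof -
  let ?w = "mellin_weight \<theta>"
  let ?W = "\<lambda>\<sigma> y::real. exp (- (y\<^sup>2) / (2 * \<sigma>\<^sup>2))"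
  have \<kappa>0: "0 \<le> \<kappa>" using \<kappa>[of 0] mellin_weight_pos[of \<theta> 0] by linarith
  have wi: "integrable lborel (\<lambda>y. ?w y * (norm (mellin f y))\<^sup>2)"
    by (rule weighted_mellin_square(1)[OF _ _ integrable_mellin_weight[OF th] fm fi])
       (auto simp: mellin_weight_pos less_imp_le)
  have Wi: "integrable lborel (\<lambda>y. ?W \<sigma> y * (norm (mellin f y))\<^sup>2)" if "0 < \<sigma>" for \<sigma>
  proof (rule weighted_mellin_square(1)[OF _ _ _ fm fi])
    have "?W \<sigma> = (\<lambda>y. sqrt (2 * pi * \<sigma>\<^sup>2) * normal_density 0 \<sigma> y)"
      using that by (auto simp: normal_density_def)
    then show "integrable lborel (?W \<sigma>)" using that by simp
  qed auto
  have mm: "(\<lambda>y. (norm (mellin f y))\<^sup>2) \<in> borel_measurable lborel"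
  proof -
    have "(\<lambda>y. inverse (?w y) * (?w y * (norm (mellin f y))\<^sup>2)) \<in> borel_measurable lborel"
      using borel_measurable_integrable[OF wi] by (rule borel_measurable_times[rotated]) auto
    moreover have "inverse (?w y) * (?w y * z) = z" for y z
      using mellin_weight_pos[of \<theta> y] by simp
    ultimately show ?thesis by (simp only:)
  qed
  have "(\<lambda>n. LINT y|lborel. ?W (real (Suc n)) y * (?w y * (norm (mellin f y))\<^sup>2)) \<longlonglongrightarrow> (LINT y|lborel. ?w y * (norm (mellin f y))\<^sup>2)"
  proof (rule integral_dominated_convergence[OF _ _ wi])
    show "AE y in lborel. (\<lambda>n. ?W (real (Suc n)) y * (?w y * (norm (mellin f y))\<^sup>2)) \<longlonglongrightarrow> ?w y * (norm (mellin f y))\<^sup>2"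
    proof (rule AE_I2)
      fix y :: real
      have "(\<lambda>n. ?W (real (Suc n)) y) \<longlonglongrightarrow> 1" by real_asymp
      then have "(\<lambda>n. ?W (real (Suc n)) y * (?w y * (norm (mellin f y))\<^sup>2)) \<longlonglongrightarrow> 1 * (?w y * (norm (mellin f y))\<^sup>2)"
        by (rule tendsto_mult_right)
      then show "(\<lambda>n. ?W (real (Suc n)) y * (?w y * (norm (mellin f y))\<^sup>2)) \<longlonglongrightarrow> ?w y * (norm (mellin f y))\<^sup>2" by simp
    qed
    show "AE y in lborel. norm (?W (real (Suc n)) y * (?w y * (norm (mellin f y))\<^sup>2)) \<le> ?w y * (norm (mellin f y))\<^sup>2" for n
      using mellin_weight_pos[of \<theta>] by (intro AE_I2) (auto simp: abs_mult less_imp_le intro!: mult_left_le_one_le)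
    show "(\<lambda>y. ?w y * (norm (mellin f y))\<^sup>2) \<in> borel_measurable lborel" using wi by auto
    then show "(\<lambda>y. ?W (real (Suc n)) y * (?w y * (norm (mellin f y))\<^sup>2)) \<in> borel_measurable lborel" for n
      by (rule borel_measurable_times[rotated]) auto
  qed
  then show ?thesis
  proof (rule LIMSEQ_le_const2, intro exI allI impI)
    fix n
    have "(LINT y|lborel. ?W (real (Suc n)) y * (?w y * (norm (mellin f y))\<^sup>2)) \<le> (LINT y|lborel. \<kappa> * (?W (real (Suc n)) y * (norm (mellin f y))\<^sup>2))"
    proof (rule integral_mono)
      show "integrable lborel (\<lambda>y. ?W (real (Suc n)) y * (?w y * (norm (mellin f y))\<^sup>2))"
        by (rule Bochner_Integration.integrable_bound[OF wi])
           (use mellin_weight_pos[of \<theta>] borel_measurable_integrable[OF wi] in \<open>auto simp: abs_mult less_imp_le intro!: mult_left_le_one_le borel_measurable_times AE_I2\<close>)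
      show "integrable lborel (\<lambda>y. \<kappa> * (?W (real (Suc n)) y * (norm (mellin f y))\<^sup>2))"
        by (intro integrable_mult_right Wi) auto
      show "?W (real (Suc n)) y * (?w y * (norm (mellin f y))\<^sup>2) \<le> \<kappa> * (?W (real (Suc n)) y * (norm (mellin f y))\<^sup>2)" for y
        using mult_right_mono[OF \<kappa>[of y], of "?W (real (Suc n)) y * (norm (mellin f y))\<^sup>2"] by (simp add: mult_ac)
    qed
    also have "\<dots> = \<kappa> * (LINT y|lborel. ?W (real (Suc n)) y * (norm (mellin f y))\<^sup>2)"
      by (rule integral_mult_right_zero)
    also have "\<dots> \<le> \<kappa> * (2 * pi * (LINT t|Rpos. (norm (f t))\<^sup>2))"
      by (intro mult_left_mono gaussian_mellin_square_le fm fi f2 \<kappa>0) auto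
    finally show "(LINT y|lborel. ?W (real (Suc n)) y * (?w y * (norm (mellin f y))\<^sup>2)) \<le> 2 * pi * \<kappa> * (LINT t|Rpos. (norm (f t))\<^sup>2)"
      by (simp add: mult_ac)
  qed
qed

section \<open>The maximum of the weight and its relation to \<open>K1\<close>\<close>

lemma K1_pos: "0 < K1 \<theta>"
  by (auto simp: K1_def Let_def field_simps)

text \<open>Since 1 + \<mu> = 2 * A and 1 - \<mu> = 2 * B, the powers of 2 combine through A + B =
  1. The value is 2 * pi times the exponential of minus the entropy of (A, B).\<close>

lemma K1_square:
  assumes "\<bar>\<theta>\<bar> < pi / 2"
  defines "A \<equiv> (1 + 2 * \<bar>\<theta>\<bar> / pi) / 2" and "B \<equiv> (1 - 2 * \<bar>\<theta>\<bar> / pi) / 2"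
  shows "(K1 \<theta>)\<^sup>2 = 2 * pi * (A powr A * B powr B)" "0 < A" "0 < B" "A + B = 1"
proof -
  show AB: "0 < A" "0 < B" "A + B = 1"
    using assms(1) by (auto simp: A_def B_def field_simps intro!: add_pos_nonneg)
  have sq: "(x powr (y / 2))\<^sup>2 = x powr y" for x y :: real
    by (simp add: power2_eq_square flip: powr_add)
  have K: "K1 \<theta> = sqrt pi * (2 * B) powr (B / 2) * (2 * A) powr (A / 2)"
  proof -
    have "2 * B = 1 - 2 * \<bar>\<theta>\<bar> / pi" "B / 2 = (1 - 2 * \<bar>\<theta>\<bar> / pi) / 4"
      "2 * A = 1 + 2 * \<bar>\<theta>\<bar> / pi" "A / 2 = (1 + 2 * \<bar>\<theta>\<bar> / pi) / 4"
      by (simp_all add: A_def B_def)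
    then show ?thesis using assms(1) by (simp only: K1_def Let_def if_True)
  qed
  have "(K1 \<theta>)\<^sup>2 = pi * (2 * B) powr B * (2 * A) powr A"
    unfolding K power_mult_distrib sq by simp
  also have "\<dots> = pi * (2 powr (A + B)) * (A powr A * B powr B)"
    using AB(1,2) by (simp add: powr_mult powr_add mult_ac)
  finally show "(K1 \<theta>)\<^sup>2 = 2 * pi * (A powr A * B powr B)" by (simp add: AB(3))
qed

lemma mellin_weight_abs: "mellin_weight \<theta> y = mellin_weight \<bar>\<theta>\<bar> (if 0 \<le> \<theta> then y else - y)"
  by (simp add: mellin_weight_def add.commute)

text \<open>Weighted AM-GM with weights A and B for the numbers exp x / A and exp (- x) / B, x = pi
  * z: their weighted mean is the denominator of the weight, and since A - B = 2 |\<theta>| / pi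
  their geometric mean contains its numerator.\<close>

lemma mellin_weight_le_K1:
  assumes "\<bar>\<theta>\<bar> < pi / 2"
  shows "2 * pi * mellin_weight \<theta> y \<le> (K1 \<theta>)\<^sup>2"
proof -
  define A B where "A = (1 + 2 * \<bar>\<theta>\<bar> / pi) / 2" and "B = (1 - 2 * \<bar>\<theta>\<bar> / pi) / 2"
  note K = K1_square[OF assms, folded A_def B_def]
  have "mellin_weight \<bar>\<theta>\<bar> z \<le> A powr A * B powr B" for z
  proof -
    let ?x = "pi * z"
    have e: "2 * \<bar>\<theta>\<bar> * z = (A - B) * ?x" by (simp add: A_def B_def field_simps)
    have "(exp ?x / A) powr A * (exp (- ?x) / B) powr B \<le> A * (exp ?x / A) + B * (exp (- ?x) / B)"
      using K by (intro Youngs_inequality_0) auto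
    also have "\<dots> = exp ?x + exp (- ?x)" using K by simp
    also have "(exp ?x / A) powr A * (exp (- ?x) / B) powr B = exp ((A - B) * ?x) / (A powr A * B powr B)"
    proof -
      have "(exp ?x / A) powr A = exp (A * ?x) / A powr A" "(exp (- ?x) / B) powr B = exp (- (B * ?x)) / B powr B"
        using K by (simp_all add: powr_divide exp_powr_real mult.commute)
      moreover have "exp (A * ?x) * exp (- (B * ?x)) = exp ((A - B) * ?x)"
        by (simp only: mult_exp_exp left_diff_distrib add_uminus_conv_diff)
      ultimately show ?thesis by (simp only: times_divide_times_eq)
    qed
    finally show ?thesis
      using K unfolding mellin_weight_def e by (simp add: field_simps add_pos_pos)
  qed
  then show ?thesis
    unfolding K(1) mellin_weight_abs[of \<theta> y] by (intro mult_left_mono) auto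
qed

text \<open>Equality in the weighted AM-GM requires exp x / A = exp (- x) / B, that is, x = (ln A -
  ln B) / 2 with x = pi * y. For negative \<theta> the point is reflected.\<close>

lemma mellin_weight_eq_K1:
  assumes "\<bar>\<theta>\<bar> < pi / 2"
  obtains y where "2 * pi * mellin_weight \<theta> y = (K1 \<theta>)\<^sup>2"
proof -
  define A B where "A = (1 + 2 * \<bar>\<theta>\<bar> / pi) / 2" and "B = (1 - 2 * \<bar>\<theta>\<bar> / pi) / 2"
  note K = K1_square[OF assms, folded A_def B_def]
  define x where "x = (ln A - ln B) / 2"
  have e: "2 * \<bar>\<theta>\<bar> * (x / pi) = (A - B) * x" by (simp add: A_def B_def field_simps)
  have B: "B = 1 - A" using K by simp
  have 1: "exp x = A * exp (- (ln A + ln B) / 2)" "exp (- x) = B * exp (- (ln A + ln B) / 2)"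
  proof -
    have eqs: "x = ln A + (- (ln A + ln B) / 2)" "- x = ln B + (- (ln A + ln B) / 2)"
      by (simp_all add: x_def field_simps)
    show "exp x = A * exp (- (ln A + ln B) / 2)" "exp (- x) = B * exp (- (ln A + ln B) / 2)"
      using K(2,3) arg_cong[OF eqs(1), of exp] arg_cong[OF eqs(2), of exp] by (simp_all only: exp_add exp_ln)
  qed
  have "exp x + exp (- x) = (A + B) * exp (- (ln A + ln B) / 2)"
    unfolding 1 by (rule distrib_right[symmetric])
  then have s: "exp x + exp (- x) = exp (- ((ln A + ln B) / 2))"
    unfolding K(4) mult_1 minus_divide_left .
  have "pi * (x / pi) = x" by simp
  then have "mellin_weight \<bar>\<theta>\<bar> (x / pi) = exp ((A - B) * x) / exp (- ((ln A + ln B) / 2))"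
    by (simp only: mellin_weight_def e s)
  also have "\<dots> = exp ((A - B) * x) * exp ((ln A + ln B) / 2)"
    by (simp only: exp_minus divide_inverse inverse_inverse_eq)
  also have "\<dots> = exp (A * ln A + B * ln B)"
    unfolding mult_exp_exp x_def B by (simp add: field_simps)
  also have "\<dots> = A powr A * B powr B"
    using K by (simp add: powr_def exp_add)
  finally have "2 * pi * mellin_weight \<bar>\<theta>\<bar> (x / pi) = (K1 \<theta>)\<^sup>2" by (simp add: K(1))
  then have *: "2 * pi * mellin_weight \<theta> (if 0 \<le> \<theta> then x / pi else - (x / pi)) = (K1 \<theta>)\<^sup>2"
    unfolding mellin_weight_abs[of \<theta> "if 0 \<le> \<theta> then x / pi else - (x / pi)"]
    by (cases "0 \<le> \<theta>") (simp_all only: if_True if_False minus_minus)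
  show thesis by (rule that[OF *])
qed

lemma K1_square_le: "(K1 \<theta>)\<^sup>2 \<le> 2 * pi"
proof (cases "\<bar>\<theta>\<bar> < pi / 2")
  case True
  note K = K1_square[OF True]
  have "x powr x \<le> 1" if "0 < x" "x \<le> 1" for x :: real
    using that powr_mono2[of x x 1] by simp
  then show ?thesis
    unfolding K(1) using K(2-4) by (intro order_trans[OF mult_left_mono[OF mult_le_one]]) auto
qed (simp add: K1_def)

section \<open>The square-integral bound\<close>

text \<open>Passing through nonnegative integrals yields integrability of the limit and the bound
  together, without a dominating function.\<close>

lemma Fatou_real:
  fixes g :: "nat \<Rightarrow> 'a \<Rightarrow> real"
  assumes i: "\<And>n. integrable M (g n)" and nn: "\<And>n x. 0 \<le> g n x"
    and [measurable]: "h \<in> borel_measurable M" and h: "\<And>x. 0 \<le> h x"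
    and lim: "AE x in M. (\<lambda>n. g n x) \<longlonglongrightarrow> h x"
    and le: "\<And>n. (LINT x|M. g n x) \<le> b n" and b: "b \<longlonglongrightarrow> B"
  shows "integrable M h" "(LINT x|M. h x) \<le> B"
proof -
  have [measurable]: "g n \<in> borel_measurable M" for n using i by auto
  have "(\<integral>\<^sup>+x. ennreal (h x) \<partial>M) = (\<integral>\<^sup>+x. liminf (\<lambda>n. ennreal (g n x)) \<partial>M)"
  proof (rule nn_integral_cong_AE)
    show "AE x in M. ennreal (h x) = liminf (\<lambda>n. ennreal (g n x))"
      using lim by eventually_elim (intro lim_imp_Liminf[symmetric] tendsto_ennrealI; simp)
  qed
  also have "\<dots> \<le> liminf (\<lambda>n. \<integral>\<^sup>+x. ennreal (g n x) \<partial>M)"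
    by (rule nn_integral_liminf) measurable
  also have "\<dots> \<le> liminf (\<lambda>n. ennreal (b n))"
    by (intro Liminf_mono always_eventually allI)
       (use i nn le in \<open>auto simp: nn_integral_eq_integral intro!: ennreal_leI\<close>)
  also have "\<dots> = ennreal B"
    using b by (intro lim_imp_Liminf tendsto_ennrealI) auto
  finally have le: "(\<integral>\<^sup>+x. ennreal (h x) \<partial>M) \<le> ennreal B" .
  have "0 \<le> (LINT x|M. g n x)" for n by (intro Bochner_Integration.integral_nonneg nn)
  then have "0 \<le> b n" for n using assms(6)[of n] by (meson order_trans)
  then have B: "0 \<le> B" using b by (intro LIMSEQ_le_const) auto
  show hi: "integrable M h"
  proof (rule integrableI_bounded)
    show "(\<integral>\<^sup>+x. ennreal (norm (h x)) \<partial>M) < \<infinity>"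
      using le h by (auto simp: less_top[symmetric] top_unique)
  qed measurable
  show "(LINT x|M. h x) \<le> B"
    using le h B by (simp add: nn_integral_eq_integral[OF hi])
qed

lemma measurable_laplace [measurable]:
  assumes [measurable]: "f \<in> borel_measurable Rpos"
  shows "laplace \<theta> f \<in> borel_measurable Rpos"
proof -
  interpret R: sigma_finite_measure Rpos by (rule sigma_finite_Rpos)
  show ?thesis unfolding laplace_def[abs_def] by measurable
qed

lemma norm_laplace_integrand_le:
  assumes "0 \<le> cos \<theta>" "0 < \<rho>" "0 < t"
  shows "norm (z * exp (- (of_real \<rho> * of_real t * cis \<theta>))) \<le> norm z"
  using assms by (simp add: norm_mult norm_exp_eq_Re mult_left_le mult_nonneg_nonneg)

lemma cos_nonneg_halfpi: "\<theta> \<in> {- pi / 2 .. pi / 2} \<Longrightarrow> 0 \<le> cos \<theta>"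
  by (auto intro!: cos_ge_zero)

lemma integrable_laplace_integrand:
  assumes c: "0 \<le> cos \<theta>" "0 < \<rho>" and f: "integrable Rpos f"
  shows "integrable Rpos (\<lambda>t. f t * exp (- (of_real \<rho> * of_real t * cis \<theta>)))"
proof (rule Bochner_Integration.integrable_bound[OF f])
  have [measurable]: "f \<in> borel_measurable Rpos" using f by auto
  show "(\<lambda>t. f t * exp (- (of_real \<rho> * of_real t * cis \<theta>))) \<in> borel_measurable Rpos" by measurable
  show "AE t in Rpos. norm (f t * exp (- (of_real \<rho> * of_real t * cis \<theta>))) \<le> norm (f t)"
    by (intro AE_I2 norm_laplace_integrand_le c) (simp add: space_restrict_space)
qed

lemma norm_laplace_le:
  assumes c: "0 \<le> cos \<theta>" "0 < \<rho>" and f: "integrable Rpos f"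
  shows "norm (laplace \<theta> f \<rho>) \<le> (LINT t|Rpos. norm (f t))"
  unfolding laplace_def
  by (intro order_trans[OF integral_norm_bound] integral_mono integrable_norm integrable_laplace_integrand
      norm_laplace_integrand_le c f) (simp add: space_restrict_space)

text \<open>Angle and function vary together, so that one statement covers truncation, simple
  approximation and the passage to \<theta> = \<plusminus> pi / 2. As long as the cosines are
  nonnegative, F dominates the integrands for all angles.\<close>

lemma laplace_tendsto:
  assumes c: "\<And>n. 0 \<le> cos (\<Theta> n)" "0 < \<rho>" and F: "integrable Rpos F"
    and [measurable]: "\<And>n. f n \<in> borel_measurable Rpos" "g \<in> borel_measurable Rpos"
    and le: "\<And>n t. 0 < t \<Longrightarrow> norm (f n t) \<le> F t"
    and lim: "\<And>t. 0 < t \<Longrightarrow> (\<lambda>n. f n t) \<longlonglongrightarrow> g t" "\<Theta> \<longlonglongrightarrow> \<theta>"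
  shows "(\<lambda>n. laplace (\<Theta> n) (f n) \<rho>) \<longlonglongrightarrow> laplace \<theta> g \<rho>"
  unfolding laplace_def
proof (rule integral_dominated_convergence[OF _ _ F])
  have "((\<lambda>n. cis (\<Theta> n)) \<longlongrightarrow> cis \<theta>) sequentially"
    unfolding cis_conv_exp using lim(2) by (intro tendsto_intros)
  then show "AE t in Rpos. (\<lambda>n. f n t * exp (- (of_real \<rho> * of_real t * cis (\<Theta> n))))
      \<longlonglongrightarrow> g t * exp (- (of_real \<rho> * of_real t * cis \<theta>))"
    by (intro AE_I2 tendsto_intros lim) (simp add: space_restrict_space)
  show "AE t in Rpos. norm (f n t * exp (- (of_real \<rho> * of_real t * cis (\<Theta> n)))) \<le> F t" for n
    by (intro AE_I2 order_trans[OF norm_laplace_integrand_le[OF c(1) c(2)] le]) (simp_all add: space_restrict_space)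
qed measurable

text \<open>Restricting f to t \<ge> 1 / (n + 1) makes f / sqrt t integrable, so that the Mellin
  identity applies. The transforms converge pointwise, and Fatou's lemma removes the
  cut-off.\<close>

lemma laplace_square_le_aux:
  assumes th: "\<bar>\<theta>\<bar> < pi / 2"
    and f: "integrable Rpos f" and f2: "integrable Rpos (\<lambda>t. (norm (f t))\<^sup>2)"
  shows "integrable Rpos (\<lambda>\<rho>. (norm (laplace \<theta> f \<rho>))\<^sup>2)"
    and "(LINT \<rho>|Rpos. (norm (laplace \<theta> f \<rho>))\<^sup>2) \<le> (K1 \<theta>)\<^sup>2 * (LINT t|Rpos. (norm (f t))\<^sup>2)"
proof -
  have [measurable]: "f \<in> borel_measurable Rpos" using f by auto
  have c: "0 \<le> cos \<theta>" using th by (intro cos_nonneg_halfpi) auto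
  define fn where "fn n t = (if 1 / real (Suc n) \<le> t then f t else 0)" for n t
  have [measurable]: "fn n \<in> borel_measurable Rpos" for n
    unfolding fn_def[abs_def] by measurable
  have fn_le: "norm (fn n t) \<le> norm (f t)" for n t by (simp add: fn_def)
  have fni: "integrable Rpos (fn n)" for n
    by (rule Bochner_Integration.integrable_bound[OF f]) (auto simp: fn_le)
  have fn2: "integrable Rpos (\<lambda>t. (norm (fn n t))\<^sup>2)" for n
    by (rule Bochner_Integration.integrable_bound[OF f2]) (auto intro!: power_mono simp: fn_le)
  have fns: "integrable Rpos (\<lambda>t. fn n t / of_real (sqrt t))" for n
  proof (rule Bochner_Integration.integrable_bound[OF integrable_mult_right[of "sqrt (real (Suc n))", OF integrable_norm[OF f]]])
    show "AE t in Rpos. norm (fn n t / of_real (sqrt t)) \<le> norm (sqrt (real (Suc n)) * norm (f t))"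
    proof (rule AE_I2)
      fix t assume "t \<in> space Rpos"
      then have t: "0 < t" by (simp add: space_restrict_space)
      show "norm (fn n t / of_real (sqrt t)) \<le> norm (sqrt (real (Suc n)) * norm (f t))"
      proof (cases "1 / real (Suc n) \<le> t")
        case True
        have "1 / sqrt t \<le> 1 / sqrt (1 / real (Suc n))"
          using True t by (intro divide_left_mono) auto
        then have "1 / sqrt t * norm (f t) \<le> sqrt (real (Suc n)) * norm (f t)"
          by (intro mult_right_mono) (auto simp: real_sqrt_divide)
        then show ?thesis using True t by (simp add: fn_def norm_divide)
      qed (simp add: fn_def)
    qed
  qed measurable
  have bound: "(LINT \<rho>|Rpos. (norm (laplace \<theta> (fn n) \<rho>))\<^sup>2) \<le> (K1 \<theta>)\<^sup>2 * (LINT t|Rpos. (norm (f t))\<^sup>2)" for n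
  proof -
    have "(LINT \<rho>|Rpos. (norm (laplace \<theta> (fn n) \<rho>))\<^sup>2) \<le> 2 * pi * ((K1 \<theta>)\<^sup>2 / (2 * pi)) * (LINT t|Rpos. (norm (fn n t))\<^sup>2)"
      unfolding laplace_square_eq_mellin(2)[OF th fni fns]
      using mellin_weight_le_K1[OF th]
      by (intro weighted_mellin_square_le th fns fn2) (auto simp: field_simps)
    also have "\<dots> \<le> 2 * pi * ((K1 \<theta>)\<^sup>2 / (2 * pi)) * (LINT t|Rpos. (norm (f t))\<^sup>2)"
      by (intro mult_left_mono integral_mono fn2 f2 power_mono fn_le) auto
    finally show ?thesis by simp
  qed
  have lim: "AE \<rho> in Rpos. (\<lambda>n. (norm (laplace \<theta> (fn n) \<rho>))\<^sup>2) \<longlonglongrightarrow> (norm (laplace \<theta> f \<rho>))\<^sup>2"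
  proof (rule AE_I2)
    fix \<rho> assume "\<rho> \<in> space Rpos"
    then have "0 < \<rho>" by (simp add: space_restrict_space)
    then show "(\<lambda>n. (norm (laplace \<theta> (fn n) \<rho>))\<^sup>2) \<longlonglongrightarrow> (norm (laplace \<theta> f \<rho>))\<^sup>2"
    proof (intro tendsto_intros laplace_tendsto[where F = "\<lambda>t. norm (f t)"] c integrable_norm f fn_le)
      fix t :: real assume t: "0 < t"
      have "eventually (\<lambda>n. 1 / real (Suc n) < t) sequentially"
        using t LIMSEQ_inverse_real_of_nat[THEN order_tendstoD(2), of t] by (simp add: divide_inverse)
      then have "eventually (\<lambda>n. fn n t = f t) sequentially"
        by eventually_elim (simp add: fn_def)
      then show "(\<lambda>n. fn n t) \<longlonglongrightarrow> f t" by (rule tendsto_eventually)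
    qed auto
  qed
  show "integrable Rpos (\<lambda>\<rho>. (norm (laplace \<theta> f \<rho>))\<^sup>2)"
    and "(LINT \<rho>|Rpos. (norm (laplace \<theta> f \<rho>))\<^sup>2) \<le> (K1 \<theta>)\<^sup>2 * (LINT t|Rpos. (norm (f t))\<^sup>2)"
    by (rule Fatou_real[OF laplace_square_eq_mellin(1)[OF th fni fns] _ _ _ lim bound tendsto_const]; simp)+
qed

text \<open>At the two extreme angles \<theta> is approached from inside.
  \<open>K1_square_le\<close> bounds the constants there by 2 * pi, which is already the value at
  the end, so Fatou's lemma loses nothing.\<close>

lemma laplace_square_le:
  assumes th: "\<theta> \<in> {- pi / 2 .. pi / 2}"
    and f: "integrable Rpos f" and f2: "integrable Rpos (\<lambda>t. (norm (f t))\<^sup>2)"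
  shows "integrable Rpos (\<lambda>\<rho>. (norm (laplace \<theta> f \<rho>))\<^sup>2)"
    and "(LINT \<rho>|Rpos. (norm (laplace \<theta> f \<rho>))\<^sup>2) \<le> (K1 \<theta>)\<^sup>2 * (LINT t|Rpos. (norm (f t))\<^sup>2)"
proof -
  have [measurable]: "f \<in> borel_measurable Rpos" using f by auto
  have "integrable Rpos (\<lambda>\<rho>. (norm (laplace \<theta> f \<rho>))\<^sup>2) \<and>
    (LINT \<rho>|Rpos. (norm (laplace \<theta> f \<rho>))\<^sup>2) \<le> (K1 \<theta>)\<^sup>2 * (LINT t|Rpos. (norm (f t))\<^sup>2)"
  proof (cases "\<bar>\<theta>\<bar> < pi / 2")
    case True
    then show ?thesis using laplace_square_le_aux f f2 by blast
  next
    case False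
    then have K: "(K1 \<theta>)\<^sup>2 = 2 * pi" by (simp add: K1_def)
    have th': "\<bar>\<theta>\<bar> = pi / 2" using False th by auto
    define \<Theta> where "\<Theta> n = \<theta> * (1 - 1 / real (Suc (Suc n)))" for n
    have \<Theta>: "\<bar>\<Theta> n\<bar> < pi / 2" for n
      unfolding \<Theta>_def abs_mult th' by (simp add: field_simps)
    have c: "0 \<le> cos (\<Theta> n)" for n using \<Theta>[of n] by (intro cos_nonneg_halfpi) auto
    have "\<Theta> \<longlonglongrightarrow> \<theta> * (1 - 0)" unfolding \<Theta>_def[abs_def]
      by (intro tendsto_intros LIMSEQ_Suc[OF LIMSEQ_Suc[OF lim_1_over_n]])
    then have \<Theta>lim: "\<Theta> \<longlonglongrightarrow> \<theta>" by simp
    have bound: "(LINT \<rho>|Rpos. (norm (laplace (\<Theta> n) f \<rho>))\<^sup>2) \<le> (K1 \<theta>)\<^sup>2 * (LINT t|Rpos. (norm (f t))\<^sup>2)" for n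
      unfolding K
      by (intro order_trans[OF laplace_square_le_aux(2)[OF \<Theta> f f2]] mult_right_mono K1_square_le Bochner_Integration.integral_nonneg) auto
    have lim: "AE \<rho> in Rpos. (\<lambda>n. (norm (laplace (\<Theta> n) f \<rho>))\<^sup>2) \<longlonglongrightarrow> (norm (laplace \<theta> f \<rho>))\<^sup>2"
      by (intro AE_I2 tendsto_intros laplace_tendsto[where F = "\<lambda>t. norm (f t)"] c integrable_norm f \<Theta>lim)
         (auto simp: space_restrict_space)
    show ?thesis
      by (intro conjI; rule Fatou_real[OF laplace_square_le_aux(1)[OF \<Theta> f f2] _ _ _ lim bound tendsto_const]; simp)
  qed
  then show "integrable Rpos (\<lambda>\<rho>. (norm (laplace \<theta> f \<rho>))\<^sup>2)"
    "(LINT \<rho>|Rpos. (norm (laplace \<theta> f \<rho>))\<^sup>2) \<le> (K1 \<theta>)\<^sup>2 * (LINT t|Rpos. (norm (f t))\<^sup>2)" by auto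
qed

section \<open>Sharpness of the square-integral bound\<close>

lemma integral_Rpos_exp:
  fixes f :: "real \<Rightarrow> 'a :: euclidean_space"
  assumes eq: "\<And>x. exp x *\<^sub>R f (exp x) = h x" and h: "integrable lborel h"
  shows "integrable Rpos f" "(LINT t|Rpos. f t) = (LINT x|lborel. h x)"
proof -
  have m: "h \<in> borel_measurable borel" using h by auto
  have hi: "integrable lebesgue h" using h by (simp add: integrable_lborel_iff_lebesgue[OF m])
  show fi: "integrable Rpos f" unfolding integral_exp_substitution(1) eq by (rule hi)
  show "(LINT t|Rpos. f t) = (LINT x|lborel. h x)"
    using integral_exp_substitution(2)[OF fi] m by (simp add: eq integral_completion)
qed

lemma gaussian_eq_normal_density:
  "0 < \<sigma> \<Longrightarrow> exp (- (x - \<mu>)\<^sup>2 / (2 * \<sigma>\<^sup>2)) = sqrt (2 * pi * \<sigma>\<^sup>2) * normal_density \<mu> \<sigma> x"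
  by (simp add: normal_density_def)

lemma integral_exp_minus_square:
  assumes "0 < \<sigma>"
  shows "integrable lborel (\<lambda>x::real. exp (- (x\<^sup>2) / \<sigma>\<^sup>2))" "(LINT x|lborel. exp (- (x\<^sup>2) / \<sigma>\<^sup>2)) = \<sigma> * sqrt pi"
proof -
  have "exp (- (x\<^sup>2) / \<sigma>\<^sup>2) = \<sigma> * sqrt pi * normal_density 0 (\<sigma> / sqrt 2) x" for x
    using gaussian_eq_normal_density[of "\<sigma> / sqrt 2" x 0] assms by (simp add: power_divide real_sqrt_mult)
  then show "integrable lborel (\<lambda>x::real. exp (- (x\<^sup>2) / \<sigma>\<^sup>2))" "(LINT x|lborel. exp (- (x\<^sup>2) / \<sigma>\<^sup>2)) = \<sigma> * sqrt pi"
    using assms by simp_all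
qed

text \<open>Test functions for which \<open>exp (x / 2) * f (exp x)\<close> is a Gaussian of width
  \<sigma> modulated by \<open>cis (y0 * x)\<close>: their Mellin transform is a Gaussian of width 1
  / \<sigma> about y0. As \<sigma> grows, the weighted average of w tends to w y0 by
  continuity.\<close>

lemma mellin_weight_le_of_bound:
  assumes th: "\<bar>\<theta>\<bar> < pi / 2"
    and D: "\<And>f. integrable Rpos f \<Longrightarrow> integrable Rpos (\<lambda>t. (norm (f t))\<^sup>2) \<Longrightarrow>
       (LINT \<rho>|Rpos. (norm (laplace \<theta> f \<rho>))\<^sup>2) \<le> D * (LINT t|Rpos. (norm (f t))\<^sup>2)"
  shows "2 * pi * mellin_weight \<theta> y0 \<le> D"
proof -
  have main: "2 * pi * (LINT z|lborel. mellin_weight \<theta> (y0 + z / \<sigma>) * exp (- (z\<^sup>2))) \<le> D * sqrt pi" if s: "0 < \<sigma>" for \<sigma>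
  proof -
    let ?E = "\<lambda>x. exp (- (x\<^sup>2) / (2 * \<sigma>\<^sup>2)) :: real"
    define f where "f t = complex_of_real (?E (ln t) / sqrt t) * cis (y0 * ln t)" for t
    have sq: "sqrt (exp x) * sqrt (exp x) = exp x" for x :: real by simp
    have sq2: "exp x / sqrt (exp x) = sqrt (exp x)" for x :: real by (simp add: real_div_sqrt)
    have Ei: "integrable lborel ?E"
      using gaussian_eq_normal_density[OF s, of _ 0] s by simp
    have "integrable lborel (\<lambda>x. complex_of_real (exp (x / 2) * ?E x) * cis (y0 * x))"
    proof (rule Bochner_Integration.integrable_bound)
      \<comment> \<open>Integrability of f itself leaves a growing factor exp (x / 2), which
        completing the square absorbs into a Gaussian centred at
        \<open>\<sigma>\<^sup>2 / 2\<close>.\<close>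
      have "exp (x / 2) * ?E x = exp (\<sigma>\<^sup>2 / 8) * exp (- (x - \<sigma>\<^sup>2 / 2)\<^sup>2 / (2 * \<sigma>\<^sup>2))" for x
        unfolding mult_exp_exp using s by (intro arg_cong[where f = exp]) (simp add: field_simps power2_eq_square)
      then show "integrable lborel (\<lambda>x. exp (x / 2) * ?E x)"
        using s by (simp only: gaussian_eq_normal_density[OF s]) simp
      show "AE x in lborel. norm (complex_of_real (exp (x / 2) * ?E x) * cis (y0 * x)) \<le> norm (exp (x / 2) * ?E x)"
        by (intro AE_I2) (simp only: norm_mult norm_cis norm_of_real real_norm_def mult_1_right order_refl)
    qed measurable
    moreover have "exp x *\<^sub>R f (exp x) = complex_of_real (exp (x / 2) * ?E x) * cis (y0 * x)" for x
    proof -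
      have "exp x / sqrt (exp x) = exp (x / 2)"
        unfolding sq2 by (intro real_sqrt_unique) (simp_all add: power2_eq_square flip: exp_add)
      then have "exp x * (?E x / sqrt (exp x)) = exp (x / 2) * ?E x"
        by (metis mult.commute times_divide_eq_left times_divide_eq_right)
      then show ?thesis
        unfolding f_def ln_exp scaleR_conv_of_real by (simp only: mult.assoc[symmetric] of_real_mult[symmetric])
    qed
    ultimately have fi: "integrable Rpos f" by (intro integral_Rpos_exp(1))
    have "exp x *\<^sub>R (norm (f (exp x)))\<^sup>2 = exp (- (x\<^sup>2) / \<sigma>\<^sup>2)" for x
      by (simp add: f_def norm_mult power_divide norm_divide flip: exp_of_nat_mult)
    note f2 = integral_Rpos_exp[OF this integral_exp_minus_square(1)[OF s], unfolded integral_exp_minus_square(2)[OF s]]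
    have Mx: "exp x *\<^sub>R (f (exp x) / of_real (sqrt (exp x)) * cis (- (y * ln (exp x)))) = of_real (?E x) * cis ((y0 - y) * x)" for x y
    proof -
      have "exp x *\<^sub>R (f (exp x) / of_real (sqrt (exp x)) * cis (- (y * ln (exp x))))
          = of_real (exp x / (sqrt (exp x) * sqrt (exp x)) * ?E x) * (cis (y0 * x) * cis (- (y * x)))"
        by (simp add: f_def scaleR_conv_of_real mult_ac del: real_sqrt_mult_self)
      then show ?thesis unfolding sq cis_mult by (simp add: left_diff_distrib)
    qed
    have Mi: "integrable lborel (\<lambda>x. of_real (?E x) * cis ((y0 - y) * x))" for y
      by (rule Bochner_Integration.integrable_bound[OF Ei]) (auto simp: norm_mult)
    have fs: "integrable Rpos (\<lambda>t. f t / of_real (sqrt t))"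
      using integral_Rpos_exp(1)[OF Mx[of _ 0] Mi] by simp
    have "mellin f y = of_real (2 * pi * normal_density 0 (1 / \<sigma>) (y0 - y))" for y
      using integral_Rpos_exp(2)[OF Mx Mi, of y] by (simp only: mellin_def gaussian_Fourier[OF s])
    then have M: "(norm (mellin f y))\<^sup>2 = 2 * pi * \<sigma>\<^sup>2 * exp (- ((y - y0)\<^sup>2 * \<sigma>\<^sup>2))" for y
    proof -
      have "(normal_density 0 (1 / \<sigma>) (y0 - y))\<^sup>2 = \<sigma>\<^sup>2 / (2 * pi) * exp (- ((y - y0)\<^sup>2 * \<sigma>\<^sup>2))"
        using s by (simp add: normal_density_def power_mult_distrib power_divide power2_commute[of y0 y] flip: exp_of_nat_mult)
      then show ?thesis
        using \<open>\<And>y. mellin f y = _\<close>[of y] by (simp add: norm_mult power_mult_distrib power2_eq_square)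
    qed
    have "(LINT y|lborel. mellin_weight \<theta> y * (norm (mellin f y))\<^sup>2) \<le> D * (\<sigma> * sqrt pi)"
      using D[OF fi f2(1)] unfolding laplace_square_eq_mellin(2)[OF th fi fs] f2(2) .
    \<comment> \<open>Rescaling by y = y0 + z / \<sigma> fixes the Gaussian; apart from constants,
      \<sigma> remains only in the argument of the weight.\<close>
    moreover have "(LINT y|lborel. mellin_weight \<theta> y * (norm (mellin f y))\<^sup>2)
        = (LINT z|lborel. mellin_weight \<theta> (y0 + 1 / \<sigma> * z) * (norm (mellin f (y0 + 1 / \<sigma> * z)))\<^sup>2) / \<sigma>"
      using s by (subst lborel_integral_real_affine[of "1 / \<sigma>" _ y0]) auto
    also have "(\<lambda>z. mellin_weight \<theta> (y0 + 1 / \<sigma> * z) * (norm (mellin f (y0 + 1 / \<sigma> * z)))\<^sup>2)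
        = (\<lambda>z. 2 * pi * \<sigma>\<^sup>2 * (mellin_weight \<theta> (y0 + z / \<sigma>) * exp (- (z\<^sup>2))))"
      unfolding M using s by (auto simp: power_divide)
    finally have "2 * pi * \<sigma>\<^sup>2 * (LINT z|lborel. mellin_weight \<theta> (y0 + z / \<sigma>) * exp (- (z\<^sup>2))) / \<sigma> \<le> D * (\<sigma> * sqrt pi)"
      by (simp only: integral_mult_right_zero)
    then have "\<sigma> * (2 * pi * (LINT z|lborel. mellin_weight \<theta> (y0 + z / \<sigma>) * exp (- (z\<^sup>2)))) \<le> \<sigma> * (D * sqrt pi)"
      using s by (simp add: power2_eq_square mult_ac)
    then show ?thesis using s by (subst (asm) mult_le_cancel_left_pos)
  qed
  define \<kappa> where "\<kappa> = (K1 \<theta>)\<^sup>2 / (2 * pi)"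
  have \<kappa>: "mellin_weight \<theta> y \<le> \<kappa>" for y
    using mellin_weight_le_K1[OF th, of y] by (simp add: \<kappa>_def field_simps)
  have Gi: "integrable lborel (\<lambda>z::real. exp (- (z\<^sup>2)))" "(LINT z|lborel. exp (- (z\<^sup>2))) = sqrt pi"
    using integral_exp_minus_square[of 1] by simp_all
  have "(\<lambda>n. LINT z|lborel. mellin_weight \<theta> (y0 + z / real (Suc n)) * exp (- (z\<^sup>2))) \<longlonglongrightarrow> (LINT z|lborel. mellin_weight \<theta> y0 * exp (- (z\<^sup>2)))"
  proof (rule integral_dominated_convergence)
    show "integrable lborel (\<lambda>z. \<kappa> * exp (- (z\<^sup>2)))" using Gi(1) by (rule integrable_mult_right)
    show "AE z in lborel. (\<lambda>n. mellin_weight \<theta> (y0 + z / real (Suc n)) * exp (- (z\<^sup>2))) \<longlonglongrightarrow> mellin_weight \<theta> y0 * exp (- (z\<^sup>2))"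
    proof (rule AE_I2)
      fix z :: real
      have c: "isCont (mellin_weight \<theta>) y0"
        unfolding mellin_weight_def[abs_def]
        by (intro continuous_intros) (metis add_pos_pos exp_gt_zero less_irrefl)
      have "(\<lambda>n. y0 + z / real (Suc n)) \<longlonglongrightarrow> y0" by real_asymp
      then show "(\<lambda>n. mellin_weight \<theta> (y0 + z / real (Suc n)) * exp (- (z\<^sup>2))) \<longlonglongrightarrow> mellin_weight \<theta> y0 * exp (- (z\<^sup>2))"
        by (intro tendsto_mult tendsto_const isCont_tendsto_compose[OF c])
    qed
    show "AE z in lborel. norm (mellin_weight \<theta> (y0 + z / real (Suc n)) * exp (- (z\<^sup>2))) \<le> \<kappa> * exp (- (z\<^sup>2))" for n
      using \<kappa> mellin_weight_pos[of \<theta>] by (intro AE_I2) (simp add: abs_mult less_imp_le)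
  qed measurable
  then have "(\<lambda>n. 2 * pi * (LINT z|lborel. mellin_weight \<theta> (y0 + z / real (Suc n)) * exp (- (z\<^sup>2)))) \<longlonglongrightarrow> 2 * pi * (mellin_weight \<theta> y0 * sqrt pi)"
    by (intro tendsto_mult_left) (simp add: Gi(2))
  then have "2 * pi * (mellin_weight \<theta> y0 * sqrt pi) \<le> D * sqrt pi"
    by (rule LIMSEQ_le_const2) (auto intro!: main)
  then have "(2 * pi * mellin_weight \<theta> y0) * sqrt pi \<le> D * sqrt pi" by (simp add: mult.assoc)
  then show ?thesis by (subst (asm) mult_le_cancel_right_pos) auto
qed

text \<open>At the extreme angles the transform of a modulated exponential has squared modulus 1 /
  (1 + (\<rho> - a)^2), with integral pi / 2 + arctan a over the half-line, while the function has
  squared norm 1 / 2. As a grows the whole bump enters the half-line and the quotient tends to 2 *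
  pi.\<close>

lemma K1_square_le_of_bound:
  assumes th: "\<theta> \<in> {- pi / 2 .. pi / 2}"
    and D: "\<And>f. integrable Rpos f \<Longrightarrow> integrable Rpos (\<lambda>t. (norm (f t))\<^sup>2) \<Longrightarrow>
       (LINT \<rho>|Rpos. (norm (laplace \<theta> f \<rho>))\<^sup>2) \<le> D * (LINT t|Rpos. (norm (f t))\<^sup>2)"
  shows "(K1 \<theta>)\<^sup>2 \<le> D"
proof (cases "\<bar>\<theta>\<bar> < pi / 2")
  case True
  then obtain y0 where "2 * pi * mellin_weight \<theta> y0 = (K1 \<theta>)\<^sup>2" by (rule mellin_weight_eq_K1)
  then show ?thesis using mellin_weight_le_of_bound[OF True D, of y0] by simp
next
  case False
  then have K: "(K1 \<theta>)\<^sup>2 = 2 * pi" by (simp add: K1_def)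
  \<comment> \<open>The sign of \<theta>; modulating by e * a moves the centre of the transform to a
    for both signs.\<close>
  define e :: real where "e = (if 0 \<le> \<theta> then 1 else - 1)"
  have th': "\<theta> = e * (pi / 2)" using False th by (auto simp: e_def)
  have cis: "cis \<theta> = \<i> * of_real e" unfolding th' by (auto simp: e_def complex_eq_iff)
  have main: "2 * (pi / 2 + arctan a) \<le> D" for a
  proof -
    define c where "c = 1 - \<i> * of_real (e * a)"
    have c: "0 < Re c" by (simp add: c_def)
    define f where "f t = exp (- (of_real t * c))" for t
    have fi: "integrable Rpos f" using exp_integral_Rpos(1)[OF c] by (simp add: f_def[abs_def])
    have "complex_of_real ((norm (f t))\<^sup>2) = exp (- (of_real t * 2))" for t
      by (simp add: f_def norm_exp_eq_Re c_def mult.commute flip: exp_of_nat_mult exp_of_real of_real_power)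
    then have "integrable Rpos (\<lambda>t. complex_of_real ((norm (f t))\<^sup>2))" "(LINT t|Rpos. complex_of_real ((norm (f t))\<^sup>2)) = of_real (1 / 2)"
      using exp_integral_Rpos[of 2] by simp_all
    then have f2: "integrable Rpos (\<lambda>t. (norm (f t))\<^sup>2)" "(LINT t|Rpos. (norm (f t))\<^sup>2) = 1 / 2"
      by (simp_all only: complex_of_real_integrable_eq integral_complex_of_real of_real_eq_iff)
    have L: "(norm (laplace \<theta> f \<rho>))\<^sup>2 = 1 / (1 + (\<rho> - a)\<^sup>2)" for \<rho>
    proof -
      have "laplace \<theta> f \<rho> = (LINT t|Rpos. exp (- (of_real t * (c + of_real \<rho> * cis \<theta>))))"
        by (simp add: laplace_def f_def algebra_simps flip: exp_add)
      also have "\<dots> = 1 / (c + of_real \<rho> * cis \<theta>)"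
        by (rule exp_integral_Rpos) (simp add: cis c_def)
      also have "c + of_real \<rho> * cis \<theta> = Complex 1 (e * (\<rho> - a))"
        by (simp add: complex_eq_iff cis c_def algebra_simps)
      finally have "(norm (laplace \<theta> f \<rho>))\<^sup>2 = 1 / (norm (Complex 1 (e * (\<rho> - a))))\<^sup>2"
        by (simp add: norm_divide power_divide)
      then show ?thesis by (simp add: cmod_power2 power_mult_distrib e_def)
    qed
    have "(\<integral>\<^sup>+\<rho>. ennreal (1 / (1 + (\<rho> - a)\<^sup>2)) \<partial>Rpos)
        = (\<integral>\<^sup>+\<rho>. ennreal (1 / (1 + (\<rho> - a)\<^sup>2)) * indicator {0..} \<rho> \<partial>lborel)"
      by (rule nn_integral_Rpos) measurable
    also have "\<dots> = pi / 2 - arctan (0 - a)"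
    proof (rule nn_integral_FTC_atLeast)
      show "DERIV (\<lambda>\<rho>. arctan (\<rho> - a)) x :> 1 / (1 + (x - a)\<^sup>2)" for x
        by (auto intro!: derivative_eq_intros simp: field_simps)
      have "filterlim (\<lambda>\<rho>. \<rho> - a) at_top at_top" by real_asymp
      then show "((\<lambda>\<rho>. arctan (\<rho> - a)) \<longlongrightarrow> pi / 2) at_top"
        by (rule filterlim_compose[OF tendsto_arctan_at_top])
      show "0 \<le> 1 / (1 + (x - a)\<^sup>2)" for x by (simp add: add_nonneg_nonneg)
    qed measurable
    finally have nn: "(\<integral>\<^sup>+\<rho>. ennreal ((norm (laplace \<theta> f \<rho>))\<^sup>2) \<partial>Rpos) = ennreal (pi / 2 + arctan a)"
      by (simp add: L arctan_minus)
    moreover have "0 \<le> pi / 2 + arctan a" using arctan_lbound[of a] by simp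
    ultimately have "(LINT \<rho>|Rpos. (norm (laplace \<theta> f \<rho>))\<^sup>2) = pi / 2 + arctan a"
      using fi by (subst integral_eq_nn_integral) auto
    then show ?thesis using D[OF fi f2(1)] f2(2) by simp
  qed
  have "((\<lambda>a. 2 * (pi / 2 + arctan a)) \<longlongrightarrow> 2 * (pi / 2 + pi / 2)) at_top"
    by (intro tendsto_intros tendsto_arctan_at_top)
  then have "2 * (pi / 2 + pi / 2) \<le> D"
    by (rule tendsto_upperbound) (use main in \<open>auto intro!: always_eventually\<close>)
  then show ?thesis by (simp add: K)
qed

section \<open>Interpolated bound\<close>

text \<open>Chebyshev's inequality: on the level set of y the indicator equals |f|^P / |y|^P. Simple
  functions in one space of exponent P are therefore in all of them.\<close>

lemma simple_function_finite_level:
  fixes f :: "'a \<Rightarrow> complex"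
  assumes f: "simple_function M f" and P: "integrable M (\<lambda>x. norm (f x) powr P)" and "y \<noteq> 0"
  shows "integrable M (\<lambda>x. indicator (f -` {y} \<inter> space M) x :: complex)"
proof (rule Bochner_Integration.integrable_bound)
  have [measurable]: "f \<in> borel_measurable M" using f by (rule borel_measurable_simple_function)
  show "integrable M (\<lambda>x. norm (f x) powr P * inverse (norm y powr P))"
    using P by (rule integrable_mult_left)
  show "(\<lambda>x. indicator (f -` {y} \<inter> space M) x :: complex) \<in> borel_measurable M"
    using f by (intro borel_measurable_indicator simple_functionD)
  show "AE x in M. norm (indicator (f -` {y} \<inter> space M) x :: complex) \<le> norm (norm (f x) powr P * inverse (norm y powr P))"
    using \<open>y \<noteq> 0\<close> by (intro AE_I2) (auto simp: indicator_def)
qed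

text \<open>The value 0 is left out because its level set may have infinite measure;
  \<open>u 0 = 0\<close> makes up for it.\<close>

lemma simple_function_comp_eq_sum:
  fixes f :: "'a \<Rightarrow> complex" and u :: "complex \<Rightarrow> complex"
  assumes f: "simple_function M f" and u: "u 0 = 0" and x: "x \<in> space M"
  shows "u (f x) = (\<Sum>y\<in>f ` space M - {0}. u y * indicator (f -` {y} \<inter> space M) x)"
proof -
  have fin: "finite (f ` space M - {0})" using simple_functionD(1)[OF f] by auto
  have "(\<Sum>y\<in>f ` space M - {0}. u y * indicator (f -` {y} \<inter> space M) x)
      = (\<Sum>y\<in>f ` space M - {0}. if y = f x then u y else 0)"
    using x by (intro sum.cong refl) (auto simp: indicator_def)
  also have "\<dots> = u (f x)" using x fin u by (auto simp: sum.delta')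
  finally show ?thesis by simp
qed

lemma simple_function_comp_integral:
  fixes f :: "'a \<Rightarrow> complex" and u :: "complex \<Rightarrow> real"
  assumes f: "simple_function M f" and P: "integrable M (\<lambda>x. norm (f x) powr P)" and u: "u 0 = 0"
  shows "integrable M (\<lambda>x. u (f x))"
    and "(LINT x|M. u (f x)) = (\<Sum>y\<in>f ` space M - {0}. u y * measure M (f -` {y} \<inter> space M))"
proof -
  let ?A = "\<lambda>y. f -` {y} \<inter> space M"
  have eq: "complex_of_real (u (f x)) = (\<Sum>y\<in>f ` space M - {0}. of_real (u y) * indicator (?A y) x)" if "x \<in> space M" for x
    using simple_function_comp_eq_sum[OF f _ that, of "\<lambda>y. of_real (u y)"] u by simp
  have li: "integrable M (\<lambda>x. of_real (u y) * indicator (?A y) x :: complex)" if "y \<in> f ` space M - {0}" for y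
    using that by (intro integrable_mult_right simple_function_finite_level[OF f P]) auto
  have "integrable M (\<lambda>x. \<Sum>y\<in>f ` space M - {0}. of_real (u y) * indicator (?A y) x :: complex)"
    using li by (rule Bochner_Integration.integrable_sum)
  then have "integrable M (\<lambda>x. complex_of_real (u (f x)))"
    by (subst Bochner_Integration.integrable_cong[OF refl eq]) auto
  then show "integrable M (\<lambda>x. u (f x))" by (simp only: complex_of_real_integrable_eq)
  have "complex_of_real (LINT x|M. u (f x)) = (LINT x|M. (\<Sum>y\<in>f ` space M - {0}. of_real (u y) * indicator (?A y) x))"
    unfolding integral_complex_of_real[symmetric] by (intro Bochner_Integration.integral_cong refl) (simp add: eq)
  also have "\<dots> = (\<Sum>y\<in>f ` space M - {0}. LINT x|M. of_real (u y) * indicator (?A y) x)"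
    using li by (rule Bochner_Integration.integral_sum)
  also have "\<dots> = (\<Sum>y\<in>f ` space M - {0}. of_real (u y * measure M (?A y)))"
  proof (intro sum.cong refl)
    fix y assume "y \<in> f ` space M - {0}"
    have "(LINT x|M. (indicator (?A y) x :: complex)) = (LINT x|M. of_real (indicator (?A y) x))"
      by (intro Bochner_Integration.integral_cong) (auto simp: indicator_def)
    also have "\<dots> = of_real (measure M (?A y))"
      by (simp add: Int_assoc)
    finally show "(LINT x|M. of_real (u y) * indicator (?A y) x) = complex_of_real (u y * measure M (?A y))"
      by simp
  qed
  also have "\<dots> = of_real (\<Sum>y\<in>f ` space M - {0}. u y * measure M (?A y))"
    by (rule of_real_sum[symmetric])
  finally show "(LINT x|M. u (f x)) = (\<Sum>y\<in>f ` space M - {0}. u y * measure M (?A y))"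
    by (simp only: of_real_eq_iff)
qed

lemma Cauchy_Schwarz_integral:
  fixes h g :: "'a \<Rightarrow> complex"
  assumes [measurable]: "h \<in> borel_measurable M" "g \<in> borel_measurable M"
    and h: "integrable M (\<lambda>x. (norm (h x))\<^sup>2)" and g: "integrable M (\<lambda>x. (norm (g x))\<^sup>2)"
  shows "norm (LINT x|M. h x * g x) \<le> sqrt (LINT x|M. (norm (h x))\<^sup>2) * sqrt (LINT x|M. (norm (g x))\<^sup>2)"
proof (cases "integrable M (\<lambda>x. h x * g x)")
  case True
  then have i: "integrable M (\<lambda>x. norm (h x) * norm (g x))"
    using integrable_norm[OF True] by (simp add: norm_mult)
  have "(\<integral>\<^sup>+x. ennreal (norm (h x)) * ennreal (norm (g x)) \<partial>M)\<^sup>2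
     \<le> (\<integral>\<^sup>+x. (ennreal (norm (h x)))\<^sup>2 \<partial>M) * (\<integral>\<^sup>+x. (ennreal (norm (g x)))\<^sup>2 \<partial>M)"
    by (rule Cauchy_Schwarz_nn_integral) measurable
  then have "ennreal ((LINT x|M. norm (h x) * norm (g x))\<^sup>2)
     \<le> ennreal ((LINT x|M. (norm (h x))\<^sup>2) * (LINT x|M. (norm (g x))\<^sup>2))"
    using i h g by (simp add: ennreal_mult[symmetric] ennreal_power nn_integral_eq_integral Bochner_Integration.integral_nonneg)
  then have "(LINT x|M. norm (h x) * norm (g x))\<^sup>2 \<le> (LINT x|M. (norm (h x))\<^sup>2) * (LINT x|M. (norm (g x))\<^sup>2)"
    by (subst (asm) ennreal_le_iff) (auto intro!: mult_nonneg_nonneg Bochner_Integration.integral_nonneg)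
  then have "(LINT x|M. norm (h x) * norm (g x)) \<le> sqrt ((LINT x|M. (norm (h x))\<^sup>2) * (LINT x|M. (norm (g x))\<^sup>2))"
    by (rule real_le_rsqrt)
  moreover have "norm (LINT x|M. h x * g x) \<le> (LINT x|M. norm (h x) * norm (g x))"
    using integral_norm_bound[of M "\<lambda>x. h x * g x"] by (simp add: norm_mult)
  ultimately show ?thesis by (simp add: real_sqrt_mult)
qed (simp add: not_integrable_integral_eq Bochner_Integration.integral_nonneg)

text \<open>Real exponents for 1 < p \<le> 2: given conjugacy, \<open>2 \<le> Q\<close> amounts to P
  \<le> 2. The endpoint p = 1, whose conjugate is infinite, stays outside.\<close>

locale laplace_interpolation =
  fixes \<theta> P Q :: real
  assumes th: "\<theta> \<in> {- pi / 2 .. pi / 2}" and P: "1 < P" and PQ: "1 / P + 1 / Q = 1" and Q: "2 \<le> Q"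
begin

abbreviation "C \<equiv> K1 \<theta> powr (2 / Q)"

text \<open>On fixed level sets the pairing is a finite bilinear form in the values.
  \<open>fu\<close> and \<open>gv\<close> keep the level sets and let the values vary, which gives
  both hypotheses of \<open>riesz_thorin_finite\<close> for all coefficients:
  \<open>norm_laplace_le\<close> the first, Cauchy-Schwarz with \<open>laplace_square_le\<close> the
  second.\<close>

lemma laplace_simple_bilinear_le:
  assumes f: "simple_function Rpos f" and fP: "integrable Rpos (\<lambda>x. norm (f x) powr P)"
    and g: "simple_function Rpos g" and gP: "integrable Rpos (\<lambda>x. norm (g x) powr P)"
  shows "norm (LINT \<rho>|Rpos. laplace \<theta> f \<rho> * g \<rho>)
     \<le> C * (LINT x|Rpos. norm (f x) powr P) powr (1 / P) * (LINT x|Rpos. norm (g x) powr P) powr (1 / P)"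
proof -
  have c0: "0 \<le> cos \<theta>" using th by (rule cos_nonneg_halfpi)
  have [measurable]: "f \<in> borel_measurable Rpos" "g \<in> borel_measurable Rpos"
    using f g by (auto intro: borel_measurable_simple_function)
  let ?I = "f ` space Rpos - {0}" and ?J = "g ` space Rpos - {0}"
  define A B where "A x = f -` {x} \<inter> space Rpos" and "B y = g -` {y} \<inter> space Rpos" for x y
  have [measurable]: "A x \<in> sets Rpos" "B y \<in> sets Rpos" for x y
    unfolding A_def B_def using f g by (auto intro: simple_functionD)
  have Ai: "integrable Rpos (\<lambda>t. indicator (A x) t :: complex)" if "x \<in> ?I" for x
    using that simple_function_finite_level[OF f fP] by (auto simp: A_def)
  have Bi: "integrable Rpos (\<lambda>t. indicator (B y) t :: complex)" if "y \<in> ?J" for y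
    using that simple_function_finite_level[OF g gP] by (auto simp: B_def)
  define c where "c x y = (LINT \<rho>|Rpos. laplace \<theta> (indicator (A x)) \<rho> * indicator (B y) \<rho>)" for x y
  define fu where "fu u t = (\<Sum>x\<in>?I. u x * indicator (A x) t)" for u :: "complex \<Rightarrow> complex" and t
  define gv where "gv v t = (\<Sum>y\<in>?J. v y * indicator (B y) t)" for v :: "complex \<Rightarrow> complex" and t
  have [measurable]: "fu u \<in> borel_measurable Rpos" "gv u \<in> borel_measurable Rpos" for u
    unfolding fu_def[abs_def] gv_def[abs_def] by measurable
  have fu: "fu u t = (if f t = 0 then 0 else u (f t))" if "t \<in> space Rpos" for u t
    using simple_function_comp_eq_sum[OF f _ that, of "\<lambda>x. if x = 0 then 0 else u x"]
    by (simp add: fu_def A_def cong: sum.cong_simp)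
  have gv: "gv v t = (if g t = 0 then 0 else v (g t))" if "t \<in> space Rpos" for v t
    using simple_function_comp_eq_sum[OF g _ that, of "\<lambda>x. if x = 0 then 0 else v x"]
    by (simp add: gv_def B_def cong: sum.cong_simp)
  \<comment> \<open>N will be the identity and the square, for the two endpoint norms.\<close>
  have fu_int: "integrable Rpos (\<lambda>t. N (norm (fu u t)))"
      "(LINT t|Rpos. N (norm (fu u t))) = (\<Sum>x\<in>?I. N (norm (u x)) * measure Rpos (A x))"
    if N: "N 0 = (0::real)" for N u
  proof -
    have eq: "N (norm (fu u t)) = (\<lambda>x. if x = 0 then 0 else N (norm (u x))) (f t)" if "t \<in> space Rpos" for t
      using fu[OF that, of u] N by simp
    note S = simple_function_comp_integral[OF f fP, of "\<lambda>x. if x = 0 then 0 else N (norm (u x))", simplified]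
    show "integrable Rpos (\<lambda>t. N (norm (fu u t)))"
      using S(1) by (subst Bochner_Integration.integrable_cong[OF refl eq]) auto
    show "(LINT t|Rpos. N (norm (fu u t))) = (\<Sum>x\<in>?I. N (norm (u x)) * measure Rpos (A x))"
    proof -
      have "(LINT t|Rpos. N (norm (fu u t))) = (LINT t|Rpos. (\<lambda>x. if x = 0 then 0 else N (norm (u x))) (f t))"
        by (rule Bochner_Integration.integral_cong[OF refl eq])
      then show ?thesis unfolding S(2) by (auto simp: A_def intro!: sum.cong)
    qed
  qed
  have gv_int: "integrable Rpos (\<lambda>t. N (norm (gv u t)))"
      "(LINT t|Rpos. N (norm (gv u t))) = (\<Sum>x\<in>?J. N (norm (u x)) * measure Rpos (B x))"
    if N: "N 0 = (0::real)" for N u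
  proof -
    have eq: "N (norm (gv u t)) = (\<lambda>x. if x = 0 then 0 else N (norm (u x))) (g t)" if "t \<in> space Rpos" for t
      using gv[OF that, of u] N by simp
    note S = simple_function_comp_integral[OF g gP, of "\<lambda>x. if x = 0 then 0 else N (norm (u x))", simplified]
    show "integrable Rpos (\<lambda>t. N (norm (gv u t)))"
      using S(1) by (subst Bochner_Integration.integrable_cong[OF refl eq]) auto
    show "(LINT t|Rpos. N (norm (gv u t))) = (\<Sum>x\<in>?J. N (norm (u x)) * measure Rpos (B x))"
    proof -
      have "(LINT t|Rpos. N (norm (gv u t))) = (LINT t|Rpos. (\<lambda>x. if x = 0 then 0 else N (norm (u x))) (g t))"
        by (rule Bochner_Integration.integral_cong[OF refl eq])
      then show ?thesis unfolding S(2) by (auto simp: B_def intro!: sum.cong)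
    qed
  qed
  have fui: "integrable Rpos (fu u)" for u
    using fu_int(1)[of "\<lambda>x. x" u] by (simp add: integrable_norm_iff)
  have Lfu: "laplace \<theta> (fu u) \<rho> = (\<Sum>x\<in>?I. u x * laplace \<theta> (indicator (A x)) \<rho>)" if "\<rho> \<in> space Rpos" for u \<rho>
  proof -
    have \<rho>: "0 < \<rho>" using that by (simp add: space_restrict_space)
    have "laplace \<theta> (fu u) \<rho> = (LINT t|Rpos. (\<Sum>x\<in>?I. u x * (indicator (A x) t * exp (- (of_real \<rho> * of_real t * cis \<theta>)))))"
      unfolding laplace_def fu_def by (simp only: sum_distrib_right mult.assoc)
    also have "\<dots> = (\<Sum>x\<in>?I. LINT t|Rpos. u x * (indicator (A x) t * exp (- (of_real \<rho> * of_real t * cis \<theta>))))"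
      by (rule Bochner_Integration.integral_sum) (intro integrable_mult_right integrable_laplace_integrand c0 \<rho> Ai)
    finally show ?thesis by (simp only: integral_mult_right_zero laplace_def)
  qed
  have ci: "integrable Rpos (\<lambda>\<rho>. laplace \<theta> (indicator (A x)) \<rho> * indicator (B y) \<rho>)" if "x \<in> ?I" "y \<in> ?J" for x y
  proof (rule Bochner_Integration.integrable_bound[OF integrable_mult_right[OF Bi[OF that(2)]]])
    let ?c = "complex_of_real (LINT t|Rpos. norm (indicator (A x) t :: complex))"
    show "AE \<rho> in Rpos. norm (laplace \<theta> (indicator (A x)) \<rho> * indicator (B y) \<rho>) \<le> norm (?c * indicator (B y) \<rho>)"
    proof (rule AE_I2)
      fix \<rho> assume "\<rho> \<in> space Rpos"
      then have "norm (laplace \<theta> (indicator (A x)) \<rho>) \<le> norm ?c"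
        using norm_laplace_le[OF c0 _ Ai[OF that(1)], of \<rho>]
        by (simp add: space_restrict_space Bochner_Integration.integral_nonneg)
      then show "norm (laplace \<theta> (indicator (A x)) \<rho> * indicator (B y) \<rho>) \<le> norm (?c * indicator (B y) \<rho>)"
        unfolding norm_mult by (intro mult_right_mono) auto
    qed
  qed measurable
  have form: "(LINT \<rho>|Rpos. laplace \<theta> (fu u) \<rho> * gv v \<rho>) = (\<Sum>x\<in>?I. \<Sum>y\<in>?J. u x * v y * c x y)" for u v
  proof -
    have "(LINT \<rho>|Rpos. laplace \<theta> (fu u) \<rho> * gv v \<rho>)
       = (LINT \<rho>|Rpos. (\<Sum>x\<in>?I. \<Sum>y\<in>?J. u x * v y * (laplace \<theta> (indicator (A x)) \<rho> * indicator (B y) \<rho>)))"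
      by (intro Bochner_Integration.integral_cong refl)
         (simp only: Lfu gv_def sum_product, intro sum.cong refl, simp add: mult_ac)
    also have "\<dots> = (\<Sum>x\<in>?I. LINT \<rho>|Rpos. (\<Sum>y\<in>?J. u x * v y * (laplace \<theta> (indicator (A x)) \<rho> * indicator (B y) \<rho>)))"
      by (rule Bochner_Integration.integral_sum) (intro Bochner_Integration.integrable_sum integrable_mult_right ci)
    also have "\<dots> = (\<Sum>x\<in>?I. \<Sum>y\<in>?J. LINT \<rho>|Rpos. u x * v y * (laplace \<theta> (indicator (A x)) \<rho> * indicator (B y) \<rho>))"
      by (intro sum.cong refl Bochner_Integration.integral_sum integrable_mult_right ci)
    finally show ?thesis by (simp only: integral_mult_right_zero c_def)
  qed
  have "norm (\<Sum>x\<in>?I. \<Sum>y\<in>?J. x * y * c x y)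
      \<le> C * (\<Sum>x\<in>?I. norm x powr P * measure Rpos (A x)) powr (1 / P)
                        * (\<Sum>y\<in>?J. norm y powr P * measure Rpos (B y)) powr (1 / P)"
  proof (rule riesz_thorin_finite)
    show "finite ?I" "finite ?J" using f g by (auto simp: simple_function_def)
    show "norm (\<Sum>x\<in>?I. \<Sum>y\<in>?J. u x * v y * c x y)
       \<le> (\<Sum>x\<in>?I. norm (u x) * measure Rpos (A x)) * (\<Sum>y\<in>?J. norm (v y) * measure Rpos (B y))" for u v
    proof -
      let ?F = "LINT t|Rpos. norm (fu u t)"
      have gi: "integrable Rpos (\<lambda>t. norm (gv v t))" using gv_int(1)[of "\<lambda>x. x"] by simp
      have "norm (LINT \<rho>|Rpos. laplace \<theta> (fu u) \<rho> * gv v \<rho>) \<le> (LINT \<rho>|Rpos. ?F * norm (gv v \<rho>))"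
      proof (cases "integrable Rpos (\<lambda>\<rho>. laplace \<theta> (fu u) \<rho> * gv v \<rho>)")
        case True
        show ?thesis
        proof (rule order_trans[OF integral_norm_bound integral_mono[OF integrable_norm[OF True] integrable_mult_right[OF gi]]])
          fix \<rho> assume "\<rho> \<in> space Rpos"
          then show "norm (laplace \<theta> (fu u) \<rho> * gv v \<rho>) \<le> ?F * norm (gv v \<rho>)"
            unfolding norm_mult by (intro mult_right_mono norm_laplace_le c0 fui) (auto simp: space_restrict_space)
        qed
      qed (simp add: not_integrable_integral_eq Bochner_Integration.integral_nonneg)
      then show ?thesis
        using fu_int(2)[of "\<lambda>x. x" u] gv_int(2)[of "\<lambda>x. x" v] by (simp add: form)
    qed
    show "norm (\<Sum>x\<in>?I. \<Sum>y\<in>?J. u x * v y * c x y)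
       \<le> K1 \<theta> * sqrt (\<Sum>x\<in>?I. (norm (u x))\<^sup>2 * measure Rpos (A x)) * sqrt (\<Sum>y\<in>?J. (norm (v y))\<^sup>2 * measure Rpos (B y))" for u v
    proof -
      note F2 = fu_int[of "\<lambda>x. x\<^sup>2" u, simplified] and G2 = gv_int[of "\<lambda>x. x\<^sup>2" v, simplified]
      note L = laplace_square_le[OF th fui F2(1)]
      have "norm (LINT \<rho>|Rpos. laplace \<theta> (fu u) \<rho> * gv v \<rho>)
         \<le> sqrt (LINT \<rho>|Rpos. (norm (laplace \<theta> (fu u) \<rho>))\<^sup>2) * sqrt (LINT \<rho>|Rpos. (norm (gv v \<rho>))\<^sup>2)"
        by (rule Cauchy_Schwarz_integral[OF _ _ L(1) G2(1)]) measurable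
      also have "\<dots> \<le> sqrt ((K1 \<theta>)\<^sup>2 * (LINT t|Rpos. (norm (fu u t))\<^sup>2)) * sqrt (LINT \<rho>|Rpos. (norm (gv v \<rho>))\<^sup>2)"
        using L(2) by (intro mult_right_mono) (auto intro!: Bochner_Integration.integral_nonneg)
      finally show ?thesis
        using K1_pos[of \<theta>] by (simp add: form F2(2) G2(2) real_sqrt_mult)
    qed
  qed (use K1_pos P PQ Q in auto)
  moreover have "(LINT x|Rpos. norm (f x) powr P) = (\<Sum>x\<in>?I. norm x powr P * measure Rpos (A x))"
    "(LINT x|Rpos. norm (g x) powr P) = (\<Sum>x\<in>?J. norm x powr P * measure Rpos (B x))"
    using simple_function_comp_integral(2)[OF f fP, of "\<lambda>x. norm x powr P"] 
      simple_function_comp_integral(2)[OF g gP, of "\<lambda>x. norm x powr P"]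
    by (simp_all add: A_def B_def)
  moreover have "(LINT \<rho>|Rpos. laplace \<theta> f \<rho> * g \<rho>) = (LINT \<rho>|Rpos. laplace \<theta> (fu (\<lambda>x. x)) \<rho> * gv (\<lambda>x. x) \<rho>)"
  proof (intro Bochner_Integration.integral_cong refl arg_cong2[where f = "(*)"])
    show "laplace \<theta> f \<rho> = laplace \<theta> (fu (\<lambda>x. x)) \<rho>" for \<rho>
      unfolding laplace_def by (intro Bochner_Integration.integral_cong refl) (simp add: fu)
  qed (simp add: gv)
  ultimately show ?thesis by (simp add: form)
qed

end

context laplace_interpolation
begin

text \<open>Duality: for the extremal function g = cnj h * |h|^(Q - 2) Hoelder's inequality is an
  equality, so the bilinear bound reads N \<le> C * ?F * N^(1/P), and N^(1/P) cancels.\<close>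

lemma laplace_simple_power_le:
  assumes f: "simple_function Rpos f" and fP: "integrable Rpos (\<lambda>x. norm (f x) powr P)"
  shows "integrable Rpos (\<lambda>\<rho>. norm (laplace \<theta> f \<rho>) powr Q)"
    and "(LINT \<rho>|Rpos. norm (laplace \<theta> f \<rho>) powr Q) powr (1 / Q) \<le> C * (LINT x|Rpos. norm (f x) powr P) powr (1 / P)"
proof -
  have c0: "0 \<le> cos \<theta>" using th by (rule cos_nonneg_halfpi)
  have [measurable]: "f \<in> borel_measurable Rpos" using f by (rule borel_measurable_simple_function)
  have fi: "integrable Rpos f"
    using simple_function_comp_integral(1)[OF f fP, of norm] by (simp add: integrable_norm_iff)
  have f2: "integrable Rpos (\<lambda>x. (norm (f x))\<^sup>2)"
    using simple_function_comp_integral(1)[OF f fP, of "\<lambda>y. (norm y)\<^sup>2"] by simp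
  define h where "h = laplace \<theta> f"
  have [measurable]: "h \<in> borel_measurable Rpos" unfolding h_def by measurable
  define B where "B = (LINT t|Rpos. norm (f t))"
  have hB: "norm (h \<rho>) \<le> B" if "\<rho> \<in> space Rpos" for \<rho>
    using norm_laplace_le[OF c0 _ fi, of \<rho>] that by (simp add: h_def B_def space_restrict_space)
  have split: "norm z powr Q = norm z powr (Q - 2) * (norm z)\<^sup>2" for z :: complex
    by (cases "z = 0") (simp_all add: powr_diff)
  \<comment> \<open>h is bounded and square-integrable, so Q \<ge> 2 gives |h|^Q \<le> B^(Q - 2) *
    |h|^2. A genuinely finite N is required before cancelling.\<close>
  show hQ: "integrable Rpos (\<lambda>\<rho>. norm (laplace \<theta> f \<rho>) powr Q)"
    unfolding h_def[symmetric]
  proof (rule Bochner_Integration.integrable_bound)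
    show "integrable Rpos (\<lambda>\<rho>. B powr (Q - 2) * (norm (h \<rho>))\<^sup>2)"
      unfolding h_def by (intro integrable_mult_right laplace_square_le(1) th fi f2)
    show "AE \<rho> in Rpos. norm (norm (h \<rho>) powr Q) \<le> norm (B powr (Q - 2) * (norm (h \<rho>))\<^sup>2)"
    proof (rule AE_I2)
      fix \<rho> assume "\<rho> \<in> space Rpos"
      then have "norm (h \<rho>) powr (Q - 2) * (norm (h \<rho>))\<^sup>2 \<le> B powr (Q - 2) * (norm (h \<rho>))\<^sup>2"
        using hB Q by (intro mult_right_mono powr_mono2) auto
      then show "norm (norm (h \<rho>) powr Q) \<le> norm (B powr (Q - 2) * (norm (h \<rho>))\<^sup>2)"
        by (simp add: split[symmetric])
    qed
  qed measurable
  define N where "N = (LINT \<rho>|Rpos. norm (h \<rho>) powr Q)"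
  define g where "g \<rho> = cnj (h \<rho>) * of_real (norm (h \<rho>) powr (Q - 2))" for \<rho>
  have [measurable]: "(\<lambda>\<rho>. cnj (h \<rho>)) \<in> borel_measurable Rpos"
    by (rule measurable_compose[where g = cnj]) (auto intro!: borel_measurable_continuous_onI continuous_intros)
  have gm[measurable]: "g \<in> borel_measurable Rpos" unfolding g_def[abs_def] by measurable
  have PQ': "(Q - 1) * P = Q" using PQ P Q by (simp add: field_simps)
  have ng: "norm (g \<rho>) = norm (h \<rho>) powr (Q - 1)" for \<rho>
  proof (cases "h \<rho> = 0")
    case False
    then have "norm (g \<rho>) = norm (h \<rho>) powr 1 * norm (h \<rho>) powr (Q - 2)" by (simp add: g_def norm_mult)
    then show ?thesis unfolding powr_add[symmetric] by simp
  qed (simp add: g_def)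
  have gP: "norm (g \<rho>) powr P = norm (h \<rho>) powr Q" for \<rho>
    unfolding ng powr_powr PQ' ..
  have hg: "h \<rho> * g \<rho> = of_real (norm (h \<rho>) powr Q)" for \<rho>
    unfolding split g_def of_real_mult complex_norm_square by (simp add: mult_ac)
  have nhg: "norm (h \<rho>) * norm (g \<rho>) = norm (h \<rho>) powr Q" for \<rho>
    using arg_cong[OF hg[of \<rho>], of norm] by (simp add: norm_mult)
  \<comment> \<open>g need not be simple, while the bilinear bound is known only for simple
    functions; the domination by 2 * |g| carries it over to g in the limit.\<close>
  obtain s where s: "\<And>i. simple_function Rpos (s i)" 
      "\<And>x. x \<in> space Rpos \<Longrightarrow> (\<lambda>i. s i x) \<longlonglongrightarrow> g x"
      "\<And>i x. x \<in> space Rpos \<Longrightarrow> norm (s i x) \<le> 2 * norm (g x)"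
    using borel_measurable_implies_sequence_metric[OF gm, of 0] unfolding norm_conv_dist by metis
  have [measurable]: "s i \<in> borel_measurable Rpos" for i using s(1) by (rule borel_measurable_simple_function)
  have dom: "integrable Rpos (\<lambda>\<rho>. 2 powr P * norm (h \<rho>) powr Q)"
    using hQ unfolding h_def by (rule integrable_mult_right)
  have sP_le: "norm (s i \<rho>) powr P \<le> 2 powr P * norm (h \<rho>) powr Q" if "\<rho> \<in> space Rpos" for i \<rho>
    using powr_mono2[OF _ _ s(3)[OF that], of P i] P by (simp add: powr_mult gP)
  have sP: "integrable Rpos (\<lambda>\<rho>. norm (s i \<rho>) powr P)" for i
    by (rule Bochner_Integration.integrable_bound[OF dom]) (auto intro!: AE_I2 sP_le)
  have lim1: "(\<lambda>i. LINT \<rho>|Rpos. norm (s i \<rho>) powr P) \<longlonglongrightarrow> N"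
    unfolding N_def
  proof (rule integral_dominated_convergence[OF _ _ dom])
    show "AE \<rho> in Rpos. (\<lambda>i. norm (s i \<rho>) powr P) \<longlonglongrightarrow> norm (h \<rho>) powr Q"
      unfolding gP[symmetric] using P by (intro AE_I2 tendsto_powr' tendsto_norm s(2) tendsto_const) auto
  qed (auto intro!: AE_I2 sP_le)
  have lim2: "(\<lambda>i. LINT \<rho>|Rpos. h \<rho> * s i \<rho>) \<longlonglongrightarrow> (LINT \<rho>|Rpos. complex_of_real (norm (h \<rho>) powr Q))"
  proof (rule integral_dominated_convergence)
    show "integrable Rpos (\<lambda>\<rho>. 2 * norm (h \<rho>) powr Q)" using hQ unfolding h_def by (rule integrable_mult_right)
    show "AE \<rho> in Rpos. (\<lambda>i. h \<rho> * s i \<rho>) \<longlonglongrightarrow> complex_of_real (norm (h \<rho>) powr Q)"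
      unfolding hg[symmetric] by (intro AE_I2 tendsto_mult_left s(2))
    show "AE \<rho> in Rpos. norm (h \<rho> * s i \<rho>) \<le> 2 * norm (h \<rho>) powr Q" for i
    proof (rule AE_I2)
      fix \<rho> assume "\<rho> \<in> space Rpos"
      then have "norm (h \<rho>) * norm (s i \<rho>) \<le> norm (h \<rho>) * (2 * norm (g \<rho>))" by (intro mult_left_mono s(3)) auto
      then show "norm (h \<rho> * s i \<rho>) \<le> 2 * norm (h \<rho>) powr Q" by (simp add: norm_mult nhg[symmetric] mult_ac)
    qed
  qed measurable
  have lim3: "(\<lambda>i. norm (LINT \<rho>|Rpos. h \<rho> * s i \<rho>)) \<longlonglongrightarrow> N"
  proof -
    have "norm (LINT \<rho>|Rpos. complex_of_real (norm (h \<rho>) powr Q)) = N"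
      unfolding integral_complex_of_real N_def by (simp add: Bochner_Integration.integral_nonneg)
    then show ?thesis using tendsto_norm[OF lim2] by (simp only:)
  qed
  let ?F = "(LINT x|Rpos. norm (f x) powr P) powr (1 / P)"
  have N0: "0 \<le> N" unfolding N_def by (intro Bochner_Integration.integral_nonneg) auto
  have "N \<le> C * ?F * N powr (1 / P)"
  proof (rule LIMSEQ_le[OF lim3])
    show "(\<lambda>i. C * ?F * (LINT \<rho>|Rpos. norm (s i \<rho>) powr P) powr (1 / P)) \<longlonglongrightarrow> C * ?F * N powr (1 / P)"
      using P by (intro tendsto_mult_left tendsto_powr' lim1 tendsto_const) (auto intro!: Bochner_Integration.integral_nonneg)
    show "\<exists>n. \<forall>i\<ge>n. norm (LINT \<rho>|Rpos. h \<rho> * s i \<rho>) \<le> C * ?F * (LINT \<rho>|Rpos. norm (s i \<rho>) powr P) powr (1 / P)"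
      unfolding h_def using laplace_simple_bilinear_le[OF f fP s(1) sP] by blast
  qed
  also have "N \<le> C * ?F * N powr (1 / P) \<longleftrightarrow> N powr (1 / Q) * N powr (1 / P) \<le> C * ?F * N powr (1 / P)"
    using N0 PQ by (simp add: add.commute flip: powr_add)
  finally show "(LINT \<rho>|Rpos. norm (laplace \<theta> f \<rho>) powr Q) powr (1 / Q) \<le> C * ?F"
    unfolding h_def[symmetric] N_def[symmetric]
    using N0 by (cases "N = 0") (auto simp: mult_le_cancel_right)
qed

text \<open>The domination |s i| \<le> 2 * |f| serves twice: through integrability of f it gives
  pointwise convergence of the transforms, through that of |f|^P convergence of the right-hand
  sides. Fatou's lemma does the rest.\<close>

lemma laplace_power_le:
  assumes f: "integrable Rpos f" and fP: "integrable Rpos (\<lambda>x. norm (f x) powr P)"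
  shows "integrable Rpos (\<lambda>\<rho>. norm (laplace \<theta> f \<rho>) powr Q)"
    and "(LINT \<rho>|Rpos. norm (laplace \<theta> f \<rho>) powr Q) powr (1 / Q) \<le> C * (LINT x|Rpos. norm (f x) powr P) powr (1 / P)"
proof -
  have c0: "0 \<le> cos \<theta>" using th by (rule cos_nonneg_halfpi)
  have fm[measurable]: "f \<in> borel_measurable Rpos" using f by auto
  obtain s where s: "\<And>i. simple_function Rpos (s i)" 
      "\<And>x. x \<in> space Rpos \<Longrightarrow> (\<lambda>i. s i x) \<longlonglongrightarrow> f x"
      "\<And>i x. x \<in> space Rpos \<Longrightarrow> norm (s i x) \<le> 2 * norm (f x)"
    using borel_measurable_implies_sequence_metric[OF fm, of 0] unfolding norm_conv_dist by metis
  have [measurable]: "s i \<in> borel_measurable Rpos" for i using s(1) by (rule borel_measurable_simple_function)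
  have dom: "integrable Rpos (\<lambda>\<rho>. 2 powr P * norm (f \<rho>) powr P)"
    using fP by (rule integrable_mult_right)
  have sP_le: "norm (s i \<rho>) powr P \<le> 2 powr P * norm (f \<rho>) powr P" if "\<rho> \<in> space Rpos" for i \<rho>
    using powr_mono2[OF _ _ s(3)[OF that], of P i] P by (simp add: powr_mult)
  have sP: "integrable Rpos (\<lambda>\<rho>. norm (s i \<rho>) powr P)" for i
    by (rule Bochner_Integration.integrable_bound[OF dom]) (auto intro!: AE_I2 sP_le)
  define F where "F = (LINT x|Rpos. norm (f x) powr P)"
  have lim1: "(\<lambda>i. LINT \<rho>|Rpos. norm (s i \<rho>) powr P) \<longlonglongrightarrow> F"
    unfolding F_def
  proof (rule integral_dominated_convergence[OF _ _ dom])
    show "AE \<rho> in Rpos. (\<lambda>i. norm (s i \<rho>) powr P) \<longlonglongrightarrow> norm (f \<rho>) powr P"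
      using P by (intro AE_I2 tendsto_powr' tendsto_norm s(2) tendsto_const) auto
  qed (auto intro!: AE_I2 sP_le)
  let ?b = "\<lambda>i. (C * (LINT x|Rpos. norm (s i x) powr P) powr (1 / P)) powr Q"
  have b: "?b \<longlonglongrightarrow> (C * F powr (1 / P)) powr Q"
    using P Q by (intro tendsto_mult_left tendsto_powr' lim1 tendsto_const) (auto intro!: Bochner_Integration.integral_nonneg)
  have le: "(LINT \<rho>|Rpos. norm (laplace \<theta> (s i) \<rho>) powr Q) \<le> ?b i" for i
  proof -
    have "0 \<le> (LINT \<rho>|Rpos. norm (laplace \<theta> (s i) \<rho>) powr Q)" by (intro Bochner_Integration.integral_nonneg) auto
    then have "(LINT \<rho>|Rpos. norm (laplace \<theta> (s i) \<rho>) powr Q) = ((LINT \<rho>|Rpos. norm (laplace \<theta> (s i) \<rho>) powr Q) powr (1 / Q)) powr Q"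
      using Q by (simp add: powr_powr)
    also have "\<dots> \<le> ?b i" using Q by (intro powr_mono2 laplace_simple_power_le(2) s(1) sP) auto
    finally show ?thesis .
  qed
  have lim: "AE \<rho> in Rpos. (\<lambda>i. norm (laplace \<theta> (s i) \<rho>) powr Q) \<longlonglongrightarrow> norm (laplace \<theta> f \<rho>) powr Q"
    using Q by (intro AE_I2 tendsto_powr' tendsto_norm tendsto_const laplace_tendsto[where F = "\<lambda>t. 2 * norm (f t)"] c0
        integrable_mult_right integrable_norm f s(2,3)) (auto simp: space_restrict_space)
  note Fat = Fatou_real[OF laplace_simple_power_le(1)[OF s(1) sP] _ _ _ lim le b]
  show "integrable Rpos (\<lambda>\<rho>. norm (laplace \<theta> f \<rho>) powr Q)" by (rule Fat(1)) auto
  have "(LINT \<rho>|Rpos. norm (laplace \<theta> f \<rho>) powr Q) \<le> (C * F powr (1 / P)) powr Q" by (rule Fat(2)) auto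
  then have "(LINT \<rho>|Rpos. norm (laplace \<theta> f \<rho>) powr Q) powr (1 / Q) \<le> ((C * F powr (1 / P)) powr Q) powr (1 / Q)"
    using Q by (intro powr_mono2) (auto intro!: Bochner_Integration.integral_nonneg)
  also have "\<dots> = C * F powr (1 / P)" using Q by (simp add: powr_powr)
  finally show "(LINT \<rho>|Rpos. norm (laplace \<theta> f \<rho>) powr Q) powr (1 / Q) \<le> C * (LINT x|Rpos. norm (f x) powr P) powr (1 / P)"
    by (simp add: F_def)
qed

end

section \<open>Spaces of p-integrable functions\<close>

lemma mem_Lp_ennreal:
  "0 \<le> p \<Longrightarrow> f \<in> Lp (ennreal p) M \<longleftrightarrow> f \<in> borel_measurable M \<and> integrable M (\<lambda>x. norm (f x) powr p)"
  by (simp add: Lp_def)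

lemma Lp_norm_ennreal:
  "0 \<le> p \<Longrightarrow> Lp_norm (ennreal p) M f = (LINT x|M. norm (f x) powr p) powr (1 / p)"
  by (simp add: Lp_norm_def)

lemma Lp_norm_ennreal_nonneg: "0 \<le> p \<Longrightarrow> 0 \<le> Lp_norm (ennreal p) M f"
  by (simp add: Lp_norm_ennreal)

lemma Lp_norm_ennreal_powr:
  assumes "1 \<le> p"
  shows "Lp_norm (ennreal p) M f powr p = (LINT x|M. norm (f x) powr p)"
  using assms by (simp add: Lp_norm_ennreal powr_powr Bochner_Integration.integral_nonneg)

lemma Lp_norm_ennreal_le_iff:
  assumes "1 \<le> p" "0 \<le> A"
  shows "Lp_norm (ennreal p) M f \<le> A \<longleftrightarrow> (LINT x|M. norm (f x) powr p) \<le> A powr p"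
  unfolding Lp_norm_ennreal_powr[OF assms(1), symmetric]
  using assms powr_mono2[of p "Lp_norm (ennreal p) M f" A] powr_less_mono2[of p A "Lp_norm (ennreal p) M f"]
    Lp_norm_ennreal_nonneg[of p M f]
  by (auto simp: not_le[symmetric])

text \<open>When a or b is 0, convexity reduces to w powr p \<le> w for w in [0, 1].\<close>

lemma powr_convex_nonneg:
  fixes a b :: real
  assumes "1 \<le> p" "0 \<le> a" "0 \<le> b" "0 \<le> u" "0 \<le> v" "u + v = 1"
  shows "(u * a + v * b) powr p \<le> u * a powr p + v * b powr p"
proof -
  have scale: "(w * c) powr p \<le> w * c powr p" if "0 \<le> w" "w \<le> 1" for w c :: real
    using that assms(1) powr_mono'[of 1 p w] by (auto simp: powr_mult intro!: mult_right_mono)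
  show ?thesis
  proof (cases "a = 0 \<or> b = 0")
    case True
    then show ?thesis using scale[of u a] scale[of v b] assms by auto
  next
    case False
    moreover have u: "u = 1 - v" using assms by simp
    ultimately show ?thesis
      using convex_onD[OF powr_convex[OF assms(1)], of v a b] assms by (simp add: u)
  qed
qed

text \<open>Minkowski's inequality from convexity of the p-th power: f / A and g / B are averaged
  with weights A / (A + B) and B / (A + B), where A and B are slightly larger than the two
  norms.\<close>

lemma Lp_add:
  assumes p: "1 \<le> p" and f: "f \<in> Lp (ennreal p) M" and g: "g \<in> Lp (ennreal p) M"
  shows "(\<lambda>x. f x + g x) \<in> Lp (ennreal p) M"
    and "Lp_norm (ennreal p) M (\<lambda>x. f x + g x) \<le> Lp_norm (ennreal p) M f + Lp_norm (ennreal p) M g"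
proof -
  have [measurable]: "f \<in> borel_measurable M" "g \<in> borel_measurable M"
    and fi: "integrable M (\<lambda>x. norm (f x) powr p)" and gi: "integrable M (\<lambda>x. norm (g x) powr p)"
    using f g p by (auto simp: mem_Lp_ennreal)
  let ?A = "Lp_norm (ennreal p) M f" and ?B = "Lp_norm (ennreal p) M g"
  have A0: "0 \<le> ?A" "0 \<le> ?B" using p by (auto intro!: Lp_norm_ennreal_nonneg)
  have pw: "norm (f x + g x) powr p \<le> (A + B) powr p * (A / (A + B) / A powr p * norm (f x) powr p + B / (A + B) / B powr p * norm (g x) powr p)"
    if AB: "0 < A" "0 < B" for A B x
  proof -
    have "norm (f x + g x) powr p \<le> ((A + B) * (A / (A + B) * (norm (f x) / A) + B / (A + B) * (norm (g x) / B))) powr p"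
    proof -
      have "(A + B) * (A / (A + B) * (norm (f x) / A) + B / (A + B) * (norm (g x) / B)) = norm (f x) + norm (g x)"
      proof -
        have "s * (c / s * (x / c)) = x" if "0 < s" "0 < c" for s c x :: real using that by simp
        then show ?thesis using AB by (simp only: distrib_left add_pos_pos)
      qed
      then show ?thesis using p by (intro powr_mono2) (auto intro: norm_triangle_ineq)
    qed
    also have "\<dots> = (A + B) powr p * (A / (A + B) * (norm (f x) / A) + B / (A + B) * (norm (g x) / B)) powr p"
      by (rule powr_mult)
    also have "\<dots> \<le> (A + B) powr p * (A / (A + B) * (norm (f x) / A) powr p + B / (A + B) * (norm (g x) / B) powr p)"
      using AB p by (intro mult_left_mono powr_convex_nonneg) (auto simp flip: add_divide_distrib)
    finally show ?thesis using AB by (simp add: powr_divide)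
  qed
  have int: "integrable M (\<lambda>x. (A + B) powr p * (A / (A + B) / A powr p * norm (f x) powr p + B / (A + B) / B powr p * norm (g x) powr p))" for A B
    by (intro integrable_mult_right Bochner_Integration.integrable_add fi gi)
  have si: "integrable M (\<lambda>x. norm (f x + g x) powr p)"
    \<comment> \<open>A = B = 1 is enough for integrability; the sharp choice is made below.\<close>
    by (rule Bochner_Integration.integrable_bound[OF int[of 1 1]]) (use pw[of 1 1] in \<open>auto intro!: AE_I2 intro: order_trans[OF _ abs_ge_self]\<close>)
  then show "(\<lambda>x. f x + g x) \<in> Lp (ennreal p) M" using p by (simp add: mem_Lp_ennreal)
  show "Lp_norm (ennreal p) M (\<lambda>x. f x + g x) \<le> ?A + ?B"
  proof (rule field_le_epsilon)
    fix e :: real assume e: "0 < e"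
    \<comment> \<open>The added e / 2 keeps both divisors positive when a norm is 0.\<close>
    define A B where "A = ?A + e / 2" and "B = ?B + e / 2"
    have AB: "0 < A" "0 < B" using A0 e by (auto simp: A_def B_def)
    have fA: "(LINT x|M. norm (f x) powr p) \<le> A powr p" and gB: "(LINT x|M. norm (g x) powr p) \<le> B powr p"
      using p e A0 by (auto simp: Lp_norm_ennreal_le_iff[symmetric] A_def B_def)
    have "(LINT x|M. norm (f x + g x) powr p) \<le> (LINT x|M. (A + B) powr p * (A / (A + B) / A powr p * norm (f x) powr p + B / (A + B) / B powr p * norm (g x) powr p))"
      by (intro integral_mono si int pw AB)
    also have "\<dots> = (A + B) powr p * (A / (A + B) / A powr p * (LINT x|M. norm (f x) powr p) + B / (A + B) / B powr p * (LINT x|M. norm (g x) powr p))"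
      by (subst integral_mult_right_zero, subst Bochner_Integration.integral_add) (intro integrable_mult_right fi gi | simp)+
    also have "\<dots> \<le> (A + B) powr p * (A / (A + B) / A powr p * A powr p + B / (A + B) / B powr p * B powr p)"
      using AB by (intro mult_left_mono add_mono fA gB) auto
    also have "\<dots> = (A + B) powr p" using AB by (simp flip: add_divide_distrib)
    finally have "Lp_norm (ennreal p) M (\<lambda>x. f x + g x) \<le> A + B"
      using AB p by (subst Lp_norm_ennreal_le_iff) auto
    then show "Lp_norm (ennreal p) M (\<lambda>x. f x + g x) \<le> ?A + ?B + e" by (simp add: A_def B_def)
  qed
qed

lemma Lp_cmult:
  assumes p: "1 \<le> p" and f: "f \<in> Lp (ennreal p) M"
  shows "(\<lambda>x. a * f x) \<in> Lp (ennreal p) M"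
    and "Lp_norm (ennreal p) M (\<lambda>x. a * f x) = norm a * Lp_norm (ennreal p) M f"
  using p f by (auto simp: mem_Lp_ennreal Lp_norm_ennreal norm_mult powr_mult powr_powr Bochner_Integration.integral_nonneg)

lemma Lp_lin:
  assumes p: "1 \<le> p" and f: "f \<in> Lp (ennreal p) M" and g: "g \<in> Lp (ennreal p) M"
  shows "(\<lambda>x. a * f x + b * g x) \<in> Lp (ennreal p) M"
  using Lp_add(1)[OF p Lp_cmult(1)[OF p f, of a] Lp_cmult(1)[OF p g, of b]] .

lemma Lp_diff:
  assumes p: "1 \<le> p" and f: "f \<in> Lp (ennreal p) M" and g: "g \<in> Lp (ennreal p) M"
  shows "(\<lambda>x. f x - g x) \<in> Lp (ennreal p) M"
    and "Lp_norm (ennreal p) M (\<lambda>x. f x - g x) \<le> Lp_norm (ennreal p) M f + Lp_norm (ennreal p) M g"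
  using Lp_add[OF p f Lp_cmult(1)[OF p g, of "-1"]] Lp_cmult(2)[OF p g, of "-1"] by simp_all

lemma Lp_norm_commute: "0 \<le> p \<Longrightarrow> Lp_norm (ennreal p) M (\<lambda>x. f x - g x) = Lp_norm (ennreal p) M (\<lambda>x. g x - f x)"
  by (simp add: Lp_norm_ennreal norm_minus_commute)

lemma Lp_norm_triangle3:
  assumes p: "1 \<le> p" and f: "f \<in> Lp (ennreal p) M" and g: "g \<in> Lp (ennreal p) M" and h: "h \<in> Lp (ennreal p) M"
  shows "Lp_norm (ennreal p) M (\<lambda>x. f x - h x) \<le> Lp_norm (ennreal p) M (\<lambda>x. f x - g x) + Lp_norm (ennreal p) M (\<lambda>x. g x - h x)"
  using Lp_add(2)[OF p Lp_diff(1)[OF p f g] Lp_diff(1)[OF p g h]] by simp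

lemma Lp_norm_AE_cong:
  assumes "0 \<le> p" "f \<in> borel_measurable M" "g \<in> borel_measurable M" "AE x in M. f x = g x"
  shows "Lp_norm (ennreal p) M f = Lp_norm (ennreal p) M g"
proof -
  have [measurable]: "f \<in> borel_measurable M" "g \<in> borel_measurable M" by fact+
  have "(LINT x|M. norm (f x) powr p) = (LINT x|M. norm (g x) powr p)"
    using assms(4) by (intro integral_cong_AE) auto
  then show ?thesis using assms(1) by (simp add: Lp_norm_ennreal)
qed

lemma Lp_norm_eq_0_imp_AE:
  assumes p: "1 \<le> p" and f: "f \<in> Lp (ennreal p) M" and le: "Lp_norm (ennreal p) M f \<le> 0"
  shows "AE x in M. f x = 0"
proof -
  have fi: "integrable M (\<lambda>x. norm (f x) powr p)" using p f by (simp add: mem_Lp_ennreal)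
  have "(LINT x|M. norm (f x) powr p) \<le> 0"
    using le p by (simp add: Lp_norm_ennreal_le_iff)
  then have "(LINT x|M. norm (f x) powr p) = 0"
    by (intro antisym Bochner_Integration.integral_nonneg) auto
  then have "AE x in M. norm (f x) powr p = 0"
    using integral_nonneg_eq_0_iff_AE[OF fi] by simp
  then show ?thesis by eventually_elim simp
qed

section \<open>Extension of densely defined operators\<close>

text \<open>Extension by continuity in seminormed spaces of functions: linearity of the given
  operator is required only almost everywhere, and density is measured by the seminorm.\<close>

locale Lp_densely_defined =
  fixes M :: "'a measure" and p q C :: real and D and T0 :: "('a \<Rightarrow> complex) \<Rightarrow> 'a \<Rightarrow> complex"
  assumes p: "1 \<le> p" and q: "1 \<le> q" and C: "0 \<le> C"
    and D: "D \<subseteq> Lp (ennreal p) M"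
    and D_lin: "\<And>f g a b. f \<in> D \<Longrightarrow> g \<in> D \<Longrightarrow> (\<lambda>x. a * f x + b * g x) \<in> D"
    and T0: "\<And>f. f \<in> D \<Longrightarrow> T0 f \<in> Lp (ennreal q) M"
    and T0_le: "\<And>f. f \<in> D \<Longrightarrow> Lp_norm (ennreal q) M (T0 f) \<le> C * Lp_norm (ennreal p) M f"
    and T0_lin: "\<And>f g a b. f \<in> D \<Longrightarrow> g \<in> D \<Longrightarrow> AE x in M. T0 (\<lambda>y. a * f y + b * g y) x = a * T0 f x + b * T0 g x"
    and dense: "\<And>f e. f \<in> Lp (ennreal p) M \<Longrightarrow> 0 < e \<Longrightarrow> \<exists>g\<in>D. Lp_norm (ennreal p) M (\<lambda>x. f x - g x) < e"
begin

abbreviation "np \<equiv> Lp_norm (ennreal p) M"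
abbreviation "nq \<equiv> Lp_norm (ennreal q) M"
abbreviation "Sp \<equiv> Lp (ennreal p) M"
abbreviation "Sq \<equiv> Lp (ennreal q) M"

lemma Sp_measurable: "f \<in> Sp \<Longrightarrow> f \<in> borel_measurable M" and Sq_measurable: "f \<in> Sq \<Longrightarrow> f \<in> borel_measurable M"
  by (auto simp: Lp_def)

lemma T0_diff_le:
  assumes f: "f \<in> D" and g: "g \<in> D"
  shows "nq (\<lambda>x. T0 f x - T0 g x) \<le> C * np (\<lambda>x. f x - g x)"
proof -
  have d: "(\<lambda>y. 1 * f y + (-1) * g y) \<in> D" by (intro D_lin f g)
  have "nq (\<lambda>x. T0 f x - T0 g x) = nq (T0 (\<lambda>y. 1 * f y + (-1) * g y))"
    using T0_lin[OF f g, of 1 "-1"] q Lp_diff(1)[OF q T0[OF f] T0[OF g]] T0[OF d]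
    by (intro Lp_norm_AE_cong) (auto intro: Sq_measurable)
  also have "\<dots> \<le> C * np (\<lambda>y. 1 * f y + (-1) * g y)" by (rule T0_le[OF d])
  finally show ?thesis by simp
qed

text \<open>Characterises the value at f without an approximating sequence: by density of D the
  inequality fixes h up to a null set. Special choices of g will give the bound and the extension
  property.\<close>

definition extends_at :: "('a \<Rightarrow> complex) \<Rightarrow> ('a \<Rightarrow> complex) \<Rightarrow> bool" where
  "extends_at f h \<longleftrightarrow> h \<in> Sq \<and> (\<forall>g\<in>D. nq (\<lambda>x. h x - T0 g x) \<le> C * np (\<lambda>x. f x - g x))"

text \<open>
  Along a sequence in \<open>D\<close> approximating \<open>f\<close> at geometric rate, the images converge almost
  everywhere; the limit inherits the bounds by Fatou's lemma.
\<close>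

lemma extends_at_exists:
  assumes f: "f \<in> Sp"
  shows "\<exists>h. extends_at f h"
proof -
  have "\<exists>g\<in>D. np (\<lambda>x. f x - g x) < (1 / 4) ^ k" for k :: nat
    by (rule dense[OF f]) simp
  then obtain u where u: "\<And>k. u k \<in> D" and ulim: "\<And>k. np (\<lambda>x. f x - u k x) < (1 / 4) ^ k"
    by metis
  have uS: "u k \<in> Sp" for k using u D by auto
  have [measurable]: "T0 (u k) \<in> borel_measurable M" for k using T0[OF u] by (rule Sq_measurable)
  define d where "d k x = T0 (u (Suc k)) x - T0 (u k) x" for k x
  have [measurable]: "d k \<in> borel_measurable M" for k unfolding d_def[abs_def] by measurable
  have d_Lq: "d k \<in> Sq" for k unfolding d_def[abs_def] by (intro Lp_diff(1) q T0 u)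
  have d_norm: "nq (d k) \<le> 2 * C * (1 / 4) ^ k" for k
  proof -
    have "np (\<lambda>x. u (Suc k) x - u k x) \<le> np (\<lambda>x. u (Suc k) x - f x) + np (\<lambda>x. f x - u k x)"
      by (intro Lp_norm_triangle3 p uS f)
    also have "np (\<lambda>x. u (Suc k) x - f x) = np (\<lambda>x. f x - u (Suc k) x)"
      using p by (intro Lp_norm_commute) auto
    also have "\<dots> + np (\<lambda>x. f x - u k x) \<le> (1 / 4) ^ Suc k + (1 / 4) ^ k"
      using ulim[of k] ulim[of "Suc k"] by simp
    also have "\<dots> \<le> 2 * (1 / 4) ^ k" by simp
    finally have "C * np (\<lambda>x. u (Suc k) x - u k x) \<le> C * (2 * (1 / 4) ^ k)"
      using C by (rule mult_left_mono)
    moreover have "nq (d k) \<le> C * np (\<lambda>x. u (Suc k) x - u k x)"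
      unfolding d_def[abs_def] by (intro T0_diff_le u)
    ultimately show ?thesis by simp
  qed
  \<comment> \<open>The norms of d k decay like 4^(-k), so even after weighting by 2^k the integrals
    of q-th powers form a geometric series. Hence almost everywhere |d k| \<le> 2^(-k) eventually,
    and the telescoping series converges absolutely.\<close>
  have term_le: "(\<integral>\<^sup>+x. ennreal ((2 ^ k * norm (d k x)) powr q) \<partial>M) \<le> ennreal ((2 * C) powr q * ((1 / 2) powr q) ^ k)" for k
  proof -
    have di: "integrable M (\<lambda>x. norm (d k x) powr q)" using d_Lq[of k] q by (simp add: mem_Lp_ennreal)
    have "(\<integral>\<^sup>+x. ennreal ((2 ^ k * norm (d k x)) powr q) \<partial>M) = ennreal ((2 ^ k) powr q * (LINT x|M. norm (d k x) powr q))"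
      using di by (simp add: powr_mult nn_integral_eq_integral)
    also have "\<dots> \<le> ennreal ((2 ^ k) powr q * (2 * C * (1 / 4) ^ k) powr q)"
      using d_norm[of k] C q by (intro ennreal_leI mult_left_mono) (auto simp: Lp_norm_ennreal_le_iff)
    also have "(2 ^ k) powr q * (2 * C * (1 / 4) ^ k) powr q = (2 * C) powr q * ((1 / 2) ^ k) powr q"
    proof -
      have "(2::real) ^ k * (1 / 4) ^ k = (1 / 2) ^ k" by (simp flip: power_mult_distrib)
      then show ?thesis using C by (simp add: mult_ac flip: powr_mult)
    qed
    also have "((1 / 2) ^ k) powr q = ((1 / 2 :: real) powr q) ^ k"
      by (simp add: powr_powr mult.commute flip: powr_realpow)
    finally show ?thesis .
  qed
  have "(\<integral>\<^sup>+x. (\<Sum>k. ennreal ((2 ^ k * norm (d k x)) powr q)) \<partial>M) = (\<Sum>k. \<integral>\<^sup>+x. ennreal ((2 ^ k * norm (d k x)) powr q) \<partial>M)"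
    by (rule nn_integral_suminf) measurable
  also have "\<dots> \<le> (\<Sum>k. ennreal ((2 * C) powr q * ((1 / 2) powr q) ^ k))"
    by (intro suminf_le term_le) auto
  also have "\<dots> < \<infinity>"
  proof -
    have "(1 / 2 :: real) powr q < 1" using q powr_less_mono2[of q "1 / 2" 1] by simp
    then have "summable (\<lambda>k. (2 * C) powr q * ((1 / 2) powr q) ^ k)"
      by (intro summable_mult summable_geometric) simp
    then show ?thesis by (subst suminf_ennreal2) auto
  qed
  finally have "AE x in M. (\<Sum>k. ennreal ((2 ^ k * norm (d k x)) powr q)) \<noteq> \<infinity>"
    by (intro nn_integral_PInf_AE) auto
  then have conv: "AE x in M. convergent (\<lambda>k. T0 (u k) x)"
  proof eventually_elim
    fix x assume fin: "(\<Sum>k. ennreal ((2 ^ k * norm (d k x)) powr q)) \<noteq> \<infinity>"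
    have "summable (\<lambda>k. (2 ^ k * norm (d k x)) powr q)"
      using fin by (intro summable_suminf_not_top) auto
    then have "(\<lambda>k. (2 ^ k * norm (d k x)) powr q) \<longlonglongrightarrow> 0" by (rule summable_LIMSEQ_zero)
    then have "eventually (\<lambda>k. (2 ^ k * norm (d k x)) powr q < 1) sequentially"
      by (rule order_tendstoD) simp
    then have "eventually (\<lambda>k. norm (d k x) \<le> (1 / 2) ^ k) sequentially"
    proof eventually_elim
      fix k assume "(2 ^ k * norm (d k x)) powr q < 1"
      then have "2 ^ k * norm (d k x) \<le> 1"
        using ge_one_powr_ge_zero[of "2 ^ k * norm (d k x)" q] q by (intro leI notI) auto
      then show "norm (d k x) \<le> (1 / 2) ^ k" by (simp add: power_one_over field_simps)
    qed
    then have "summable (\<lambda>k. d k x)"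
      by (rule summable_comparison_test_ev) (intro summable_geometric, simp)
    then have "(\<lambda>n. (\<Sum>k<n. d k x) + T0 (u 0) x) \<longlonglongrightarrow> (\<Sum>k. d k x) + T0 (u 0) x"
      by (intro tendsto_add tendsto_const summable_LIMSEQ)
    moreover have "(\<Sum>k<n. d k x) + T0 (u 0) x = T0 (u n) x" for n
      using sum_lessThan_telescope[of "\<lambda>k. T0 (u k) x" n] by (simp add: d_def)
    ultimately show "convergent (\<lambda>k. T0 (u k) x)"
      by (simp add: convergentI)
  qed
  define h where "h x = lim (\<lambda>k. T0 (u k) x)" for x
  have hlim: "AE x in M. (\<lambda>k. T0 (u k) x) \<longlonglongrightarrow> h x"
    using conv by eventually_elim (simp add: h_def convergent_LIMSEQ_iff)
  have hm[measurable]: "h \<in> borel_measurable M" unfolding h_def[abs_def] by measurable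
  have bound: "integrable M (\<lambda>x. norm (h x - T0 g x) powr q)" "nq (\<lambda>x. h x - T0 g x) \<le> C * np (\<lambda>x. f x - g x)" if g: "g \<in> D" for g
  proof -
    have [measurable]: "T0 g \<in> borel_measurable M" using T0[OF g] by (rule Sq_measurable)
    have gS: "g \<in> Sp" using g D by auto
    let ?b = "\<lambda>k. (C * (np (\<lambda>x. f x - g x) + (1 / 4) ^ k)) powr q"
    have n0: "0 \<le> np (\<lambda>x. f x - g x)" using p by (intro Lp_norm_ennreal_nonneg) auto
    have i: "integrable M (\<lambda>x. norm (T0 (u k) x - T0 g x) powr q)" for k
      using Lp_diff(1)[OF q T0[OF u] T0[OF g], of k] q by (simp add: mem_Lp_ennreal)
    have le: "(LINT x|M. norm (T0 (u k) x - T0 g x) powr q) \<le> ?b k" for k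
    proof -
      have "np (\<lambda>x. u k x - g x) \<le> np (\<lambda>x. u k x - f x) + np (\<lambda>x. f x - g x)"
        by (intro Lp_norm_triangle3 p uS f gS)
      also have "np (\<lambda>x. u k x - f x) = np (\<lambda>x. f x - u k x)" using p by (intro Lp_norm_commute) auto
      also have "\<dots> + np (\<lambda>x. f x - g x) \<le> np (\<lambda>x. f x - g x) + (1 / 4) ^ k" using ulim[of k] by simp
      finally have "nq (\<lambda>x. T0 (u k) x - T0 g x) \<le> C * (np (\<lambda>x. f x - g x) + (1 / 4) ^ k)"
        by (intro order_trans[OF T0_diff_le[OF u g]] mult_left_mono C)
      then show ?thesis using q C n0 by (subst (asm) Lp_norm_ennreal_le_iff) auto
    qed
    have "(\<lambda>k. C * (np (\<lambda>x. f x - g x) + (1 / 4) ^ k)) \<longlonglongrightarrow> C * (np (\<lambda>x. f x - g x) + 0)"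
      by (intro tendsto_intros LIMSEQ_power_zero) simp
    then have b: "?b \<longlonglongrightarrow> (C * np (\<lambda>x. f x - g x)) powr q"
      using q C n0 by (intro tendsto_powr' tendsto_const) auto
    have lim: "AE x in M. (\<lambda>k. norm (T0 (u k) x - T0 g x) powr q) \<longlonglongrightarrow> norm (h x - T0 g x) powr q"
      using hlim by eventually_elim (use q in \<open>auto intro!: tendsto_powr' tendsto_norm tendsto_diff\<close>)
    note Fat = Fatou_real[OF i _ _ _ lim le b]
    show "integrable M (\<lambda>x. norm (h x - T0 g x) powr q)" by (rule Fat(1)) auto
    have "(LINT x|M. norm (h x - T0 g x) powr q) \<le> (C * np (\<lambda>x. f x - g x)) powr q" by (rule Fat(2)) auto
    then show "nq (\<lambda>x. h x - T0 g x) \<le> C * np (\<lambda>x. f x - g x)"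
      using q C n0 by (subst Lp_norm_ennreal_le_iff) auto
  qed
  have "(\<lambda>x. h x - T0 (u 0) x) \<in> Sq"
    using bound(1)[OF u] q by (simp add: mem_Lp_ennreal)
  from Lp_add(1)[OF q this T0[OF u[of 0]]] have "h \<in> Sq" by simp
  then show ?thesis using bound(2) unfolding extends_at_def by blast
qed

definition ext :: "('a \<Rightarrow> complex) \<Rightarrow> 'a \<Rightarrow> complex" where
  "ext f = (SOME h. extends_at f h)"

lemma ext: assumes "f \<in> Sp"
  shows "ext f \<in> Sq" "\<And>g. g \<in> D \<Longrightarrow> nq (\<lambda>x. ext f x - T0 g x) \<le> C * np (\<lambda>x. f x - g x)"
proof -
  have "extends_at f (ext f)"
    unfolding ext_def by (rule someI_ex[OF extends_at_exists[OF assms]])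
  then show "ext f \<in> Sq" "\<And>g. g \<in> D \<Longrightarrow> nq (\<lambda>x. ext f x - T0 g x) \<le> C * np (\<lambda>x. f x - g x)"
    by (auto simp: extends_at_def)
qed

lemma AE_eq_of_approx:
  assumes h: "h \<in> Sq" and le: "\<And>e. 0 < e \<Longrightarrow> nq h \<le> K * e"
  shows "AE x in M. h x = 0"
proof (rule Lp_norm_eq_0_imp_AE[OF q h])
  have "((\<lambda>e. K * e) \<longlongrightarrow> K * 0) (at_right 0)" by (intro tendsto_intros)
  then have "nq h \<le> K * 0"
    by (rule tendsto_lowerbound) (auto simp: eventually_at_filter le)
  then show "nq h \<le> 0" by simp
qed

text \<open>f and g are replaced by members of D within e, where \<open>T0_lin\<close> applies; all
  errors are constants times e.\<close>

lemma ext_lin: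
  assumes f: "f \<in> Sp" and g: "g \<in> Sp"
  shows "AE x in M. ext (\<lambda>y. a * f y + b * g y) x = a * ext f x + b * ext g x"
proof -
  let ?l = "\<lambda>y. a * f y + b * g y"
  have l: "?l \<in> Sp" by (intro Lp_lin p f g)
  have "AE x in M. ext ?l x - (a * ext f x + b * ext g x) = 0"
  proof (rule AE_eq_of_approx)
    show "(\<lambda>x. ext ?l x - (a * ext f x + b * ext g x)) \<in> Sq"
      by (intro Lp_diff(1) Lp_lin q ext l f g)
    fix e :: real assume e: "0 < e"
    obtain f' where f': "f' \<in> D" "np (\<lambda>x. f x - f' x) < e" using dense[OF f e] by blast
    obtain g' where g': "g' \<in> D" "np (\<lambda>x. g x - g' x) < e" using dense[OF g e] by blast
    let ?l' = "\<lambda>y. a * f' y + b * g' y"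
    have l': "?l' \<in> D" by (intro D_lin f' g')
    have fS: "f' \<in> Sp" "g' \<in> Sp" using f' g' D by auto
    let ?z = "\<lambda>x. a * (ext f x - T0 f' x) + b * (ext g x - T0 g' x)"
    have df: "(\<lambda>x. ext f x - T0 f' x) \<in> Sq" "(\<lambda>x. ext g x - T0 g' x) \<in> Sq"
      by (intro Lp_diff(1) q ext f g T0 f' g')+
    have zS: "?z \<in> Sq" by (intro Lp_lin q df)
    have dl: "(\<lambda>x. ext ?l x - T0 ?l' x) \<in> Sq" by (intro Lp_diff(1) q ext l T0 l')
    have "nq (\<lambda>x. ext ?l x - (a * ext f x + b * ext g x)) = nq (\<lambda>x. (ext ?l x - T0 ?l' x) - ?z x)"
    proof (rule Lp_norm_AE_cong)
      show "AE x in M. ext ?l x - (a * ext f x + b * ext g x) = (ext ?l x - T0 ?l' x) - ?z x"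
        using T0_lin[OF f'(1) g'(1), of a b] by eventually_elim (simp add: algebra_simps)
      show "(\<lambda>x. ext ?l x - (a * ext f x + b * ext g x)) \<in> borel_measurable M"
        by (intro Sq_measurable Lp_diff(1) Lp_lin q ext l f g)
      show "(\<lambda>x. (ext ?l x - T0 ?l' x) - ?z x) \<in> borel_measurable M"
        by (intro Sq_measurable Lp_diff(1)[OF q dl zS])
    qed (use q in auto)
    also have "\<dots> \<le> nq (\<lambda>x. ext ?l x - T0 ?l' x) + nq ?z" by (rule Lp_diff(2)[OF q dl zS])
    also have "nq ?z \<le> norm a * nq (\<lambda>x. ext f x - T0 f' x) + norm b * nq (\<lambda>x. ext g x - T0 g' x)"
      using Lp_add(2)[OF q Lp_cmult(1)[OF q df(1), of a] Lp_cmult(1)[OF q df(2), of b]]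
      by (simp add: Lp_cmult(2)[OF q df(1)] Lp_cmult(2)[OF q df(2)])
    also have "\<dots> \<le> norm a * (C * e) + norm b * (C * e)"
      using f' g' C by (intro add_mono mult_left_mono order_trans[OF ext(2)[OF f]] order_trans[OF ext(2)[OF g]]) auto
    also have "nq (\<lambda>x. ext ?l x - T0 ?l' x) \<le> C * (norm a * e + norm b * e)"
    proof -
      have d: "(\<lambda>x. f x - f' x) \<in> Sp" "(\<lambda>x. g x - g' x) \<in> Sp" by (intro Lp_diff(1) p f g fS)+
      have eq: "(\<lambda>x. ?l x - ?l' x) = (\<lambda>x. a * (f x - f' x) + b * (g x - g' x))" by (simp add: algebra_simps)
      have "np (\<lambda>x. ?l x - ?l' x) \<le> norm a * np (\<lambda>x. f x - f' x) + norm b * np (\<lambda>x. g x - g' x)"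
        using Lp_add(2)[OF p Lp_cmult(1)[OF p d(1), of a] Lp_cmult(1)[OF p d(2), of b]]
        unfolding eq by (simp add: Lp_cmult(2)[OF p d(1)] Lp_cmult(2)[OF p d(2)])
      also have "\<dots> \<le> norm a * e + norm b * e"
        using f' g' by (intro add_mono mult_left_mono) auto
      finally show ?thesis by (intro order_trans[OF ext(2)[OF l l']] mult_left_mono C)
    qed
    finally show "nq (\<lambda>x. ext ?l x - (a * ext f x + b * ext g x)) \<le> (2 * C * (norm a + norm b)) * e"
      by (simp add: algebra_simps)
  qed
  then show ?thesis by eventually_elim simp
qed

lemma ext_AE_cong:
  assumes f: "f \<in> Sp" and g: "g \<in> Sp" and fg: "AE x in M. f x = g x"
  shows "AE x in M. ext f x = ext g x"
proof -
  have "AE x in M. ext f x - ext g x = 0"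
  proof (rule AE_eq_of_approx)
    show "(\<lambda>x. ext f x - ext g x) \<in> Sq" by (intro Lp_diff(1) q ext f g)
    fix e :: real assume e: "0 < e"
    obtain f' where f': "f' \<in> D" "np (\<lambda>x. f x - f' x) < e" using dense[OF f e] by blast
    have f'S: "f' \<in> Sp" using f' D by auto
    have "np (\<lambda>x. g x - f' x) = np (\<lambda>x. f x - f' x)"
    proof (rule Lp_norm_AE_cong)
      show "AE x in M. g x - f' x = f x - f' x" using fg by eventually_elim simp
    qed (use p in \<open>auto intro!: Sp_measurable Lp_diff(1) f g f'S\<close>)
    then have g': "np (\<lambda>x. g x - f' x) < e" using f' by simp
    have "nq (\<lambda>x. ext f x - ext g x) \<le> nq (\<lambda>x. ext f x - T0 f' x) + nq (\<lambda>x. T0 f' x - ext g x)"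
      by (intro Lp_norm_triangle3 q ext f g T0 f')
    also have "nq (\<lambda>x. T0 f' x - ext g x) = nq (\<lambda>x. ext g x - T0 f' x)" using q by (intro Lp_norm_commute) auto
    also have "nq (\<lambda>x. ext f x - T0 f' x) + \<dots> \<le> C * e + C * e"
      using f' g' C by (intro add_mono order_trans[OF ext(2)[OF f]] order_trans[OF ext(2)[OF g]] mult_left_mono) auto
    finally show "nq (\<lambda>x. ext f x - ext g x) \<le> (2 * C) * e" by simp
  qed
  then show ?thesis by eventually_elim simp
qed

lemma zero_in_D: "D \<noteq> {} \<Longrightarrow> (\<lambda>x. 0) \<in> D"
  using D_lin[of _ _ 0 0] by auto

text \<open>The choice g = 0 in the characterising inequality; density makes D nonempty, so it
  contains 0.\<close>

lemma ext_le:
  assumes f: "f \<in> Sp" shows "nq (ext f) \<le> C * np f"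
proof -
  have 0: "(\<lambda>x. 0) \<in> D" using dense[OF f, of 1] by (intro zero_in_D) auto
  have "AE x in M. T0 (\<lambda>x. 0) x = 0" using T0_lin[OF 0 0, of 0 0] by simp
  then have "nq (ext f) = nq (\<lambda>x. ext f x - T0 (\<lambda>x. 0) x)"
    using q by (intro Lp_norm_AE_cong Sq_measurable Lp_diff(1) ext f T0 0) auto
  also have "\<dots> \<le> C * np (\<lambda>x. f x - 0)" by (rule ext(2)[OF f 0])
  finally show ?thesis by simp
qed

text \<open>The choice g = f in the characterising inequality leaves norm 0.\<close>

lemma ext_extends:
  assumes f: "f \<in> D" shows "AE x in M. ext f x = T0 f x"
proof -
  have fS: "f \<in> Sp" using f D by auto
  have "np (\<lambda>x. f x - f x) = 0" using p by (simp add: Lp_norm_ennreal)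
  then have "nq (\<lambda>x. ext f x - T0 f x) \<le> 0" using ext(2)[OF fS f] by simp
  then have "AE x in M. ext f x - T0 f x = 0"
    by (intro Lp_norm_eq_0_imp_AE[OF q] Lp_diff(1) q ext fS T0 f)
  then show ?thesis by eventually_elim simp
qed

lemma ext_bounded: "bounded_Lp_operator M (ennreal p) (ennreal q) ext"
  unfolding bounded_Lp_operator_def using ext(1) ext_AE_cong ext_lin ext_le by blast

text \<open>T f and \<open>ext f\<close> are compared through a nearby g in D, on which both
  operators agree with T0 almost everywhere; T contributes its own constant C'.\<close>

lemma extension_unique:
  assumes T: "bounded_Lp_operator M (ennreal p) (ennreal q) T"
    and TD: "\<And>f. f \<in> D \<Longrightarrow> AE x in M. T f x = T0 f x"
    and f: "f \<in> Sp"
  shows "AE x in M. T f x = ext f x"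
proof -
  obtain C' where C': "\<And>f. f \<in> Sp \<Longrightarrow> nq (T f) \<le> C' * np f"
    using T unfolding bounded_Lp_operator_def by blast
  have TS: "T f \<in> Sq" if "f \<in> Sp" for f using T that unfolding bounded_Lp_operator_def by blast
  have Tlin: "AE x in M. T (\<lambda>y. a * f y + b * g y) x = a * T f x + b * T g x" if "f \<in> Sp" "g \<in> Sp" for f g a b
    using T that unfolding bounded_Lp_operator_def by blast
  have n0: "0 \<le> np g" for g using p by (intro Lp_norm_ennreal_nonneg) auto
  have "AE x in M. T f x - ext f x = 0"
  proof (rule AE_eq_of_approx)
    show "(\<lambda>x. T f x - ext f x) \<in> Sq" by (intro Lp_diff(1) q TS ext f)
    fix e :: real assume e: "0 < e"
    obtain g where g: "g \<in> D" "np (\<lambda>x. f x - g x) < e" using dense[OF f e] by blast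
    have gS: "g \<in> Sp" using g D by auto
    have dS: "(\<lambda>x. f x - g x) \<in> Sp" by (intro Lp_diff(1) p f gS)
    have "nq (\<lambda>x. T f x - ext f x) \<le> nq (\<lambda>x. T f x - T0 g x) + nq (\<lambda>x. T0 g x - ext f x)"
      by (intro Lp_norm_triangle3 q TS ext f T0 g)
    also have "nq (\<lambda>x. T0 g x - ext f x) = nq (\<lambda>x. ext f x - T0 g x)" using q by (intro Lp_norm_commute) auto
    also have "nq (\<lambda>x. T f x - T0 g x) = nq (T (\<lambda>x. f x - g x))"
    proof (rule Lp_norm_AE_cong)
      have "AE x in M. T (\<lambda>y. f y - g y) x = T f x - T g x"
        using Tlin[OF f gS, of 1 "-1"] by simp
      then show "AE x in M. T f x - T0 g x = T (\<lambda>x. f x - g x) x"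
        using TD[OF g(1)] by eventually_elim simp
    qed (use q in \<open>auto intro!: Sq_measurable Lp_diff(1) TS f T0 g dS\<close>)
    also have "nq (T (\<lambda>x. f x - g x)) + nq (\<lambda>x. ext f x - T0 g x) \<le> \<bar>C'\<bar> * e + C * e"
    proof (rule add_mono)
      have "nq (T (\<lambda>x. f x - g x)) \<le> C' * np (\<lambda>x. f x - g x)" by (rule C'[OF dS])
      \<comment> \<open>\<open>bounded_Lp_operator\<close> puts no sign on its constant, hence the
        absolute value.\<close>
      also have "\<dots> \<le> \<bar>C'\<bar> * e" using g n0 by (intro mult_mono) auto
      finally show "nq (T (\<lambda>x. f x - g x)) \<le> \<bar>C'\<bar> * e" .
      show "nq (\<lambda>x. ext f x - T0 g x) \<le> C * e"
        using g C by (intro order_trans[OF ext(2)[OF f]] mult_left_mono) auto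
    qed
    finally show "nq (\<lambda>x. T f x - ext f x) \<le> (\<bar>C'\<bar> + C) * e" by (simp add: algebra_simps)
  qed
  then show ?thesis by eventually_elim simp
qed

end

section \<open>The main theorem\<close>

lemma Lp_1: "Lp 1 M = Lp (ennreal 1) M"
  by simp

lemma mem_Lp_1: "f \<in> Lp 1 M \<longleftrightarrow> integrable M f"
  by (auto simp: Lp_1 mem_Lp_ennreal integrable_norm_iff simp del: ennreal_1)

text \<open>Small values of f are discarded. Where |f| \<ge> 1 / (n + 1), the exponent 1 - p \<le> 0
  gives |f| \<le> (1 / (n + 1))^(1 - p) * |f|^p, so the truncation is integrable.\<close>

lemma Lp_1_Int_Lp_dense:
  assumes p: "1 \<le> p" and f: "f \<in> Lp (ennreal p) M" and e: "0 < e"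
  shows "\<exists>g\<in>Lp 1 M \<inter> Lp (ennreal p) M. Lp_norm (ennreal p) M (\<lambda>x. f x - g x) < e"
proof -
  have [measurable]: "f \<in> borel_measurable M" and fi: "integrable M (\<lambda>x. norm (f x) powr p)"
    using f p by (auto simp: mem_Lp_ennreal)
  define g where "g n x = (if 1 / real (Suc n) \<le> norm (f x) then f x else 0)" for n x
  have [measurable]: "g n \<in> borel_measurable M" for n unfolding g_def[abs_def] by measurable
  have gp: "norm (g n x) powr p \<le> norm (f x) powr p" "norm (f x - g n x) powr p \<le> norm (f x) powr p" for n x
    by (auto simp: g_def)
  have g1: "integrable M (g n)" for n
  proof (rule Bochner_Integration.integrable_bound)
    show "integrable M (\<lambda>x. (1 / real (Suc n)) powr (1 - p) * norm (f x) powr p)"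
      using fi by (rule integrable_mult_right)
    show "AE x in M. norm (g n x) \<le> norm ((1 / real (Suc n)) powr (1 - p) * norm (f x) powr p)"
    proof (rule AE_I2)
      fix x
      show "norm (g n x) \<le> norm ((1 / real (Suc n)) powr (1 - p) * norm (f x) powr p)"
      proof (cases "1 / real (Suc n) \<le> norm (f x)")
        case True
        moreover have "0 < 1 / real (Suc n)" by simp
        ultimately have f0: "0 < norm (f x)" by linarith
        have "norm (f x) = norm (f x) powr (1 - p) * norm (f x) powr p"
          using f0 by (simp flip: powr_add)
        also have "\<dots> \<le> (1 / real (Suc n)) powr (1 - p) * norm (f x) powr p"
          using True p by (intro mult_right_mono powr_mono2') auto
        finally show ?thesis by (simp add: g_def)
      qed (simp add: g_def)
    qed
  qed measurable
  have gL: "g n \<in> Lp 1 M \<inter> Lp (ennreal p) M" for n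
    using g1 p Bochner_Integration.integrable_bound[OF fi, of "\<lambda>x. norm (g n x) powr p"] gp
    by (auto simp: mem_Lp_1 mem_Lp_ennreal)
  have "(\<lambda>n. LINT x|M. norm (f x - g n x) powr p) \<longlonglongrightarrow> (LINT x|M. 0)"
  proof (rule integral_dominated_convergence[OF _ _ fi])
    show "AE x in M. (\<lambda>n. norm (f x - g n x) powr p) \<longlonglongrightarrow> 0"
    proof (rule AE_I2)
      fix x
      show "(\<lambda>n. norm (f x - g n x) powr p) \<longlonglongrightarrow> 0"
      proof (cases "f x = 0")
        case False
        then have "eventually (\<lambda>n. 1 / real (Suc n) < norm (f x)) sequentially"
          using LIMSEQ_inverse_real_of_nat[THEN order_tendstoD(2), of "norm (f x)"] by (simp add: divide_inverse)
        then have "eventually (\<lambda>n. norm (f x - g n x) powr p = 0) sequentially"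
          by eventually_elim (simp add: g_def)
        then show ?thesis by (rule tendsto_eventually)
      qed (simp add: g_def)
    qed
  qed (use gp in auto)
  then have "(\<lambda>n. (LINT x|M. norm (f x - g n x) powr p) powr (1 / p)) \<longlonglongrightarrow> (LINT x|M. 0) powr (1 / p)"
    using p by (intro tendsto_powr' tendsto_const) (auto intro!: Bochner_Integration.integral_nonneg)
  then have "(\<lambda>n. Lp_norm (ennreal p) M (\<lambda>x. f x - g n x)) \<longlonglongrightarrow> 0"
    using p by (simp add: Lp_norm_ennreal)
  then have "eventually (\<lambda>n. Lp_norm (ennreal p) M (\<lambda>x. f x - g n x) < e) sequentially"
    using e by (intro order_tendstoD(2)) auto
  then show ?thesis using gL eventually_happens by fastforce
qed

lemma laplace_lin:
  assumes c: "0 \<le> cos \<theta>" and f: "integrable Rpos f" and g: "integrable Rpos g"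
  shows "AE \<rho> in Rpos. laplace \<theta> (\<lambda>y. a * f y + b * g y) \<rho> = a * laplace \<theta> f \<rho> + b * laplace \<theta> g \<rho>"
proof (rule AE_I2)
  fix \<rho> assume "\<rho> \<in> space Rpos"
  then have \<rho>: "0 < \<rho>" by (simp add: space_restrict_space)
  have "laplace \<theta> (\<lambda>y. a * f y + b * g y) \<rho> = (LINT t|Rpos. a * (f t * exp (- (of_real \<rho> * of_real t * cis \<theta>)))
      + b * (g t * exp (- (of_real \<rho> * of_real t * cis \<theta>))))"
    by (simp add: laplace_def algebra_simps)
  also have "\<dots> = (LINT t|Rpos. a * (f t * exp (- (of_real \<rho> * of_real t * cis \<theta>))))
      + (LINT t|Rpos. b * (g t * exp (- (of_real \<rho> * of_real t * cis \<theta>))))"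
    by (intro Bochner_Integration.integral_add integrable_mult_right integrable_laplace_integrand c \<rho> f g)
  finally show "laplace \<theta> (\<lambda>y. a * f y + b * g y) \<rho> = a * laplace \<theta> f \<rho> + b * laplace \<theta> g \<rho>"
    by (simp only: integral_mult_right_zero laplace_def)
qed

lemma Lp_operator_norm_cong:
  assumes "\<And>f. f \<in> Lp p M \<Longrightarrow> Lp_norm q M (T f) = Lp_norm q M (T' f)"
  shows "Lp_operator_norm M p q T = Lp_operator_norm M p q T'"
  using assms by (simp add: Lp_operator_norm_def cong: ball_cong)

lemma Lp_operator_norm_le:
  assumes "0 \<le> C" "\<And>f. f \<in> Lp p M \<Longrightarrow> Lp_norm q M (T f) \<le> C * Lp_norm p M f"
  shows "Lp_operator_norm M p q T \<le> C"
  unfolding Lp_operator_norm_def using assms by (intro cInf_lower bdd_belowI[of _ 0]) auto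

section \<open>The extension of the transform for 1 < p \<le> 2\<close>

context laplace_interpolation
begin

lemma P_ge_1: "1 \<le> P" and Q_ge_1: "1 \<le> Q" and P_nonneg: "0 \<le> P" and Q_nonneg: "0 \<le> Q"
  using P Q by auto

sublocale Lp_densely_defined Rpos P Q C "Lp 1 Rpos \<inter> Lp (ennreal P) Rpos" "laplace \<theta>"
proof
  have c0: "0 \<le> cos \<theta>" using th by (rule cos_nonneg_halfpi)
  show "1 \<le> P" "1 \<le> Q" "0 \<le> C" by (simp_all add: P_ge_1 Q_ge_1)
  show "Lp 1 Rpos \<inter> Lp (ennreal P) Rpos \<subseteq> Lp (ennreal P) Rpos" by simp
  show "(\<lambda>x. a * f x + b * g x) \<in> Lp 1 Rpos \<inter> Lp (ennreal P) Rpos"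
    if "f \<in> Lp 1 Rpos \<inter> Lp (ennreal P) Rpos" "g \<in> Lp 1 Rpos \<inter> Lp (ennreal P) Rpos" for f g a b
    using that Lp_lin[OF P_ge_1, of f Rpos g a b] Lp_lin[of 1 f Rpos g a b] by simp
  show "laplace \<theta> f \<in> Lp (ennreal Q) Rpos" if "f \<in> Lp 1 Rpos \<inter> Lp (ennreal P) Rpos" for f
    using that laplace_power_le(1)[of f] Q_nonneg P_nonneg
    by (auto simp: mem_Lp_1 mem_Lp_ennreal intro!: measurable_laplace)
  show "Lp_norm (ennreal Q) Rpos (laplace \<theta> f) \<le> C * Lp_norm (ennreal P) Rpos f"
    if "f \<in> Lp 1 Rpos \<inter> Lp (ennreal P) Rpos" for f
    using that laplace_power_le(2)[of f] Q_nonneg P_nonneg by (auto simp: mem_Lp_1 mem_Lp_ennreal Lp_norm_ennreal)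
  show "AE x in Rpos. laplace \<theta> (\<lambda>y. a * f y + b * g y) x = a * laplace \<theta> f x + b * laplace \<theta> g x"
    if "f \<in> Lp 1 Rpos \<inter> Lp (ennreal P) Rpos" "g \<in> Lp 1 Rpos \<inter> Lp (ennreal P) Rpos" for f g a b
    using that by (intro laplace_lin c0) (auto simp: mem_Lp_1)
  show "\<exists>g\<in>Lp 1 Rpos \<inter> Lp (ennreal P) Rpos. Lp_norm (ennreal P) Rpos (\<lambda>x. f x - g x) < e"
    if "f \<in> Lp (ennreal P) Rpos" "0 < e" for f e
    using that by (intro Lp_1_Int_Lp_dense P_ge_1)
qed

lemma laplace_has_norm_ext:
  "laplace_has_norm \<theta> (ennreal P) (ennreal Q) (Lp_operator_norm Rpos (ennreal P) (ennreal Q) ext)"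
  unfolding laplace_has_norm_def
proof (intro conjI exI allI impI)
  show "laplace_extension \<theta> (ennreal P) (ennreal Q) ext"
    unfolding laplace_extension_def using ext_bounded ext_extends by blast
  fix T assume T: "laplace_extension \<theta> (ennreal P) (ennreal Q) T"
  show "Lp_operator_norm Rpos (ennreal P) (ennreal Q) T = Lp_operator_norm Rpos (ennreal P) (ennreal Q) ext"
  proof (intro Lp_operator_norm_cong Lp_norm_AE_cong Q_nonneg)
    fix f assume f: "f \<in> Lp (ennreal P) Rpos"
    show "AE x in Rpos. T f x = ext f x"
      using T f by (intro extension_unique) (auto simp: laplace_extension_def)
    show "T f \<in> borel_measurable Rpos" "ext f \<in> borel_measurable Rpos"
      using T f ext(1)[OF f] by (auto simp: laplace_extension_def bounded_Lp_operator_def intro!: Sq_measurable)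
  qed
qed

lemma Lp_operator_norm_ext_le: "Lp_operator_norm Rpos (ennreal P) (ennreal Q) ext \<le> C"
  by (intro Lp_operator_norm_le ext_le) auto

end

text \<open>Interpolation at P = Q = 2 has C = \<open>K1 \<theta>\<close>. Conversely, a constant
  admissible for the extension bounds the transform itself on integrable square-integrable
  functions, to which \<open>K1_square_le_of_bound\<close> applies. So the infimum is attained at
  \<open>K1 \<theta>\<close>.\<close>

lemma laplace_has_norm_2:
  assumes th: "\<theta> \<in> {- pi / 2 .. pi / 2}"
  shows "laplace_has_norm \<theta> 2 2 (K1 \<theta>)"
proof -
  interpret laplace_interpolation \<theta> 2 2 by unfold_locales (use th in auto)
  have C: "C = K1 \<theta>" using K1_pos[of \<theta>] by simp
  have p2: "x powr 2 = x\<^sup>2" if "0 \<le> x" for x :: real using that by simp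
  have "K1 \<theta> \<le> c" if c: "0 \<le> c" "\<forall>f\<in>Sp. nq (ext f) \<le> c * np f" for c
  proof -
    have "(K1 \<theta>)\<^sup>2 \<le> c\<^sup>2"
    proof (rule K1_square_le_of_bound[OF th])
      fix f :: "real \<Rightarrow> complex"
      assume f: "integrable Rpos f" "integrable Rpos (\<lambda>t. (norm (f t))\<^sup>2)"
      then have fD: "f \<in> Lp 1 Rpos \<inter> Sp" by (auto simp: mem_Lp_1 mem_Lp_ennreal simp del: ennreal_numeral)
      have "nq (laplace \<theta> f) = nq (ext f)"
        using ext_extends[OF fD] fD ext(1)[of f] T0[OF fD] by (intro Lp_norm_AE_cong Sq_measurable) (auto simp del: ennreal_numeral)
      also have "\<dots> \<le> c * np f" using c fD by blast
      finally have "(LINT \<rho>|Rpos. norm (laplace \<theta> f \<rho>) powr 2) \<le> (c * np f) powr 2"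
        using c Lp_norm_ennreal_nonneg[of 2 Rpos f] by (subst (asm) Lp_norm_ennreal_le_iff) (auto simp del: ennreal_numeral)
      also have "\<dots> = c\<^sup>2 * np f powr 2"
        using c by (simp add: powr_mult del: ennreal_numeral)
      also have "np f powr 2 = (LINT t|Rpos. norm (f t) powr 2)"
        by (rule Lp_norm_ennreal_powr) simp
      finally show "(LINT \<rho>|Rpos. (norm (laplace \<theta> f \<rho>))\<^sup>2) \<le> c\<^sup>2 * (LINT t|Rpos. (norm (f t))\<^sup>2)"
        by simp
    qed
    then show ?thesis using c(1) by (rule power2_le_imp_le)
  qed
  then have "Lp_operator_norm Rpos (ennreal 2) (ennreal 2) ext = K1 \<theta>"
    unfolding Lp_operator_norm_def using ext_le K1_pos[of \<theta>]
    by (intro cInf_eq_minimum) (auto simp: C less_imp_le simp del: ennreal_numeral)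
  then show ?thesis using laplace_has_norm_ext by simp
qed

lemma Lp_norm_infinity_laplace_le:
  assumes c: "0 \<le> cos \<theta>" and f: "integrable Rpos f"
  shows "esssup Rpos (\<lambda>\<rho>. ereal (norm (laplace \<theta> f \<rho>))) \<le> ereal (LINT t|Rpos. norm (f t))"
    and "Lp_norm \<infinity> Rpos (laplace \<theta> f) \<le> 1 * Lp_norm 1 Rpos f"
proof -
  have [measurable]: "f \<in> borel_measurable Rpos" using f by auto
  show le: "esssup Rpos (\<lambda>\<rho>. ereal (norm (laplace \<theta> f \<rho>))) \<le> ereal (LINT t|Rpos. norm (f t))"
    using norm_laplace_le[OF c _ f] by (intro esssup_I AE_I2) (auto simp: space_restrict_space)
  have "0 \<le> (LINT t|Rpos. norm (f t))" by (intro Bochner_Integration.integral_nonneg) auto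
  then show "Lp_norm \<infinity> Rpos (laplace \<theta> f) \<le> 1 * Lp_norm 1 Rpos f"
    \<comment> \<open>\<open>real_of_ereal\<close> sends infinite values to 0; for the value minus
      infinity the claim is nonnegativity of the integral.\<close>
    using le by (cases "esssup Rpos (\<lambda>\<rho>. ereal (norm (laplace \<theta> f \<rho>)))") (simp_all add: Lp_norm_def)
qed

text \<open>For p = 1 the initial domain is the whole space, so \<open>laplace \<theta>\<close> is
  its own extension and any other agrees with it almost everywhere.\<close>

lemma laplace_has_norm_1_infinity:
  assumes th: "\<theta> \<in> {- pi / 2 .. pi / 2}"
  obtains K where "laplace_has_norm \<theta> 1 \<infinity> K" "K \<le> 1"
proof -
  have c0: "0 \<le> cos \<theta>" using th by (rule cos_nonneg_halfpi)
  have ext: "laplace_extension \<theta> 1 \<infinity> (laplace \<theta>)"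
    unfolding laplace_extension_def bounded_Lp_operator_def
  proof (intro conjI ballI allI impI exI[of _ 1])
    show "laplace \<theta> f \<in> Lp \<infinity> Rpos" if "f \<in> Lp 1 Rpos" for f
    proof -
      have fi: "integrable Rpos f" using that by (simp add: mem_Lp_1)
      then have [measurable]: "f \<in> borel_measurable Rpos" by auto
      have "laplace \<theta> f \<in> borel_measurable Rpos" by measurable
      then show ?thesis
        using le_less_trans[OF Lp_norm_infinity_laplace_le(1)[OF c0 fi], of \<infinity>] by (simp add: Lp_def)
    qed
    show "Lp_norm \<infinity> Rpos (laplace \<theta> f) \<le> 1 * Lp_norm 1 Rpos f" if "f \<in> Lp 1 Rpos" for f
      using that by (intro Lp_norm_infinity_laplace_le c0) (simp add: mem_Lp_1)
    show "AE x in Rpos. laplace \<theta> (\<lambda>y. a * f y + b * g y) x = a * laplace \<theta> f x + b * laplace \<theta> g x"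
      if "f \<in> Lp 1 Rpos" "g \<in> Lp 1 Rpos" for f g a b
      using that by (intro laplace_lin c0) (auto simp: mem_Lp_1)
    fix f g assume "f \<in> Lp 1 Rpos" "g \<in> Lp 1 Rpos" and ae: "AE x in Rpos. f x = g x"
    then have [measurable]: "f \<in> borel_measurable Rpos" "g \<in> borel_measurable Rpos" by (auto simp: mem_Lp_1)
    have "laplace \<theta> f \<rho> = laplace \<theta> g \<rho>" for \<rho>
      unfolding laplace_def using ae by (intro integral_cong_AE) auto
    then show "AE x in Rpos. laplace \<theta> f x = laplace \<theta> g x" by simp
  qed simp
  have "laplace_has_norm \<theta> 1 \<infinity> (Lp_operator_norm Rpos 1 \<infinity> (laplace \<theta>))"
    unfolding laplace_has_norm_def
  proof (intro conjI exI allI impI)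
    show "laplace_extension \<theta> 1 \<infinity> (laplace \<theta>)" by (rule ext)
    fix T assume T: "laplace_extension \<theta> 1 \<infinity> T"
    show "Lp_operator_norm Rpos 1 \<infinity> T = Lp_operator_norm Rpos 1 \<infinity> (laplace \<theta>)"
    proof (rule Lp_operator_norm_cong)
      fix f assume f: "f \<in> Lp 1 Rpos"
      have [measurable]: "T f \<in> borel_measurable Rpos" "laplace \<theta> f \<in> borel_measurable Rpos"
        using T ext f by (auto simp: laplace_extension_def bounded_Lp_operator_def Lp_def)
      have "AE x in Rpos. T f x = laplace \<theta> f x" using T f by (auto simp: laplace_extension_def)
      then have "esssup Rpos (\<lambda>x. ereal (norm (T f x))) = esssup Rpos (\<lambda>x. ereal (norm (laplace \<theta> f x)))"
        by (intro esssup_AE_cong) auto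
      then show "Lp_norm \<infinity> Rpos (T f) = Lp_norm \<infinity> Rpos (laplace \<theta> f)" by (simp add: Lp_norm_def)
    qed
  qed
  moreover have "Lp_operator_norm Rpos 1 \<infinity> (laplace \<theta>) \<le> 1"
    by (intro Lp_operator_norm_le Lp_norm_infinity_laplace_le c0) (auto simp: mem_Lp_1)
  ultimately show thesis by (rule that)
qed

lemma conjugate_exponent_cases:
  fixes p p' :: ennreal
  assumes "1 \<le> p" "p \<le> 2" "1 / p + 1 / p' = 1"
  obtains "p = 1" "p' = \<infinity>"
  | P Q where "p = ennreal P" "p' = ennreal Q" "1 < P" "1 / P + 1 / Q = 1" "2 \<le> Q"
proof -
  have "p < top" using assms(2) by (rule le_less_trans) simp
  then obtain P where P: "p = ennreal P" "0 \<le> P" by (cases p) auto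
  have P1: "1 \<le> P" using assms(1) P by (simp add: P flip: ennreal_1)
  have P2: "P \<le> 2" using assms(2) P by (simp add: P flip: ennreal_numeral)
  have ip: "1 / p = ennreal (1 / P)"
    using P1 by (simp add: P divide_ennreal flip: ennreal_1)
  show thesis
  proof (cases p')
    case top
    then have "ennreal (1 / P) = ennreal 1" using assms(3) by (simp add: ip)
    then have "P = 1" using P1 by (subst (asm) ennreal_inj) auto
    then show thesis using that(1) top P by simp
  next
    case (real Q)
    \<comment> \<open>In \<open>ennreal\<close>, 1 / 0 is infinite, which would make the sum of
      reciprocals infinite.\<close>
    have "Q \<noteq> 0" using assms(3) real by auto
    then have Q: "0 < Q" using real by simp
    have iq: "1 / p' = ennreal (1 / Q)" using Q by (simp add: real divide_ennreal flip: ennreal_1)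
    have "ennreal (1 / P + 1 / Q) = ennreal 1"
      using assms(3) P1 Q by (simp add: ip iq ennreal_plus)
    then have PQ: "1 / P + 1 / Q = 1" using P1 Q by (subst (asm) ennreal_inj) auto
    then have "P \<noteq> 1" using Q by auto
    then have "1 < P" using P1 by simp
    moreover have "1 / 2 \<le> 1 / P" using P1 P2 by (simp add: field_simps)
    then have "1 / Q \<le> 1 / 2" using PQ by linarith
    then have "2 \<le> Q" using Q by (simp add: field_simps)
    ultimately show thesis using that(2) P real PQ by blast
  qed
qed

theorem theorem2:
  fixes p p' :: ennreal and \<theta> :: real
  assumes "1 \<le> p" and "p \<le> 2"
    and "1 / p + 1 / p' = 1"
    and "\<theta> \<in> {- pi / 2 .. pi / 2}"
  shows "laplace_has_norm \<theta> 2 2 (K1 \<theta>) \<and>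
    (\<exists>K2. laplace_has_norm \<theta> p p' K2 \<and>
       K2 \<le> K1 \<theta> powr enn2real (2 / p') \<and>
       K2 \<le> (2 * pi) powr enn2real (1 / p'))"
proof
  show "laplace_has_norm \<theta> 2 2 (K1 \<theta>)" by (rule laplace_has_norm_2[OF assms(4)])
  show "\<exists>K2. laplace_has_norm \<theta> p p' K2 \<and>
       K2 \<le> K1 \<theta> powr enn2real (2 / p') \<and>
       K2 \<le> (2 * pi) powr enn2real (1 / p')"
    using assms(1-3)
  proof (cases rule: conjugate_exponent_cases)
    case 1
    obtain K where "laplace_has_norm \<theta> 1 \<infinity> K" "K \<le> 1"
      using laplace_has_norm_1_infinity[OF assms(4)] .
    \<comment> \<open>Both exponents are 0 here, and positivity of the bases turns both right-hand
      sides into 1.\<close>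
    then show ?thesis using 1 K1_pos[of \<theta>] by (intro exI[of _ K]) simp
  next
    case (2 P Q)
    interpret laplace_interpolation \<theta> P Q by unfold_locales (use 2 assms(4) in auto)
    have e: "enn2real (2 / p') = 2 / Q" "enn2real (1 / p') = 1 / Q"
      using 2 by (simp_all add: divide_ennreal flip: ennreal_numeral ennreal_1)
    have "K1 \<theta> powr (2 / Q) = (K1 \<theta>)\<^sup>2 powr (1 / Q)"
      using K1_pos[of \<theta>] by (simp add: powr_powr flip: powr_numeral)
    also have "\<dots> \<le> (2 * pi) powr (1 / Q)"
      using 2 K1_square_le by (intro powr_mono2) auto
    finally show ?thesis
      using laplace_has_norm_ext Lp_operator_norm_ext_le unfolding e unfolding 2(1,2)
      by (intro exI[of _ "Lp_operator_norm Rpos (ennreal P) (ennreal Q) ext"]) auto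
  qed
qed

end
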